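(* Let $\lambda>0$, let $F:L^2(0,1)\to\mathbb{R}$ be a continuous linear map and let $T_0\in(0,+\infty)$. Consider the closed-loop Kuramoto-Sivashinsky problem $$ \begin{cases} v_t+v_{xxxx}+\lambda v_{xx}+vv_x=0 & \text{for } (t,x)\in(0,T_0)\times(0,1),\\ v(t,0)=v(t,1)=0 & \text{for } t\in(0,T_0),\\ v_{xx}(t,0)=F(v(t,\cdot)),\quad v_{xx}(t,1)=0 & \text{for } t\in(0,T_0),\\ v(0,\cdot)=v^0 & \text{in }(0,1). \end{cases}\qquad ( * ) $$ Then for every given $v^0\in L^2(0,1)$ there exists at most one solution $v\in X_{T_0}$ of $( * )$. Moreover, there exist $r_0>0$ and $C_0>0$ such that, for every $v^0\in L^2(0,1)$ with $|v^0|_{L^2(0,1)}\le r_0$, there exists one solution $v\in X_{T_0}$ of $( * )$, and this solution satisfies $$|v|_{X_{T_0}}\le C_0\,|v^0|_{L^2(0,1)}.$$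
   Context: All functions are real valued. For $T>0$, $X_T=C^0([0,T];L^2(0,1))\cap L^2(0,T;H^2(0,1)\cap H^1_0(0,1))$, with norm $|v|_{X_T}=\big(|v|^2_{C^0([0,T];L^2(0,1))}+|v|^2_{L^2(0,T;H^2(0,1)\cap H^1_0(0,1))}\big)^{1/2}$. Notion of solution (standard weak form): $v\in X_{T}$ is a solution on $[0,T]$ with initial datum $v^0\in L^2(0,1)$ and boundary data $v_{xx}(t,0)=f(t)$, $v_{xx}(t,1)=0$, where $f\in L^2(0,T)$, if for every $\tau\in[0,T]$ and every $\theta\in H^2(0,1)\cap H^1_0(0,1)$, $$\int_0^1 v(\tau,x)\theta(x)dx-\int_0^1 v^0(x)\theta(x)dx+\int_0^\tau\int_0^1\big[v_{xx}\theta''+\lambda v_{xx}\theta+vv_x\theta\big]dx\,dt+\theta'(0)\int_0^\tau f(t)\,dt=0 .$$ Here $f(t)=F(v(t,\cdot))$. *)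

theory Defs
  imports "HOL-Analysis.Analysis"
begin

text \<open>
  Elements of Lebesgue and Sobolev spaces are represented by functions
  \<open>real \<Rightarrow> real\<close>, of which only the values on the underlying interval matter and which are
  identified when they agree almost everywhere there. All norms below are therefore seminorms
  on representatives, and equality of two elements is written out as equality almost everywhere.
\<close>


section \<open>The Lebesgue space of square integrable functions\<close>

definition L2_on :: "real set \<Rightarrow> (real \<Rightarrow> real) set" where
  "L2_on S = {u \<in> borel_measurable (lebesgue_on S). integrable (lebesgue_on S) (\<lambda>x. (u x)\<^sup>2)}"

abbreviation I01 :: "real set" where
  "I01 \<equiv> {0<..<1}"

definition L2_norm :: "(real \<Rightarrow> real) \<Rightarrow> real" where
  "L2_norm u = sqrt (LINT x|lebesgue_on I01. (u x)\<^sup>2)"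

text \<open>
  The conditions below imply \<open>F u = F w\<close> whenever \<open>u = w\<close> almost everywhere, as then
  \<open>L2_norm (w - u) = 0\<close>. Hence such an \<open>F\<close> is a function on equivalence classes.
\<close>

definition continuous_linear_L2 :: "((real \<Rightarrow> real) \<Rightarrow> real) \<Rightarrow> bool" where
  "continuous_linear_L2 F \<longleftrightarrow>
     (\<forall>u\<in>L2_on I01. \<forall>w\<in>L2_on I01. F (\<lambda>x. u x + w x) = F u + F w) \<and>
     (\<forall>c. \<forall>u\<in>L2_on I01. F (\<lambda>x. c * u x) = c * F u) \<and>
     (\<forall>u\<in>L2_on I01. \<forall>\<epsilon>>0. \<exists>\<delta>>0. \<forall>w\<in>L2_on I01.
        L2_norm (\<lambda>x. w x - u x) < \<delta> \<longrightarrow> \<bar>F w - F u\<bar> < \<epsilon>)"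


section \<open>Sobolev spaces on the unit interval\<close>

definition test_functions :: "(real \<Rightarrow> real) set" where
  "test_functions = {\<phi>. (\<forall>n. (deriv ^^ n) \<phi> differentiable_on UNIV) \<and>
                         closure {x. \<phi> x \<noteq> 0} \<subseteq> I01}"

definition has_weak_deriv :: "(real \<Rightarrow> real) \<Rightarrow> (real \<Rightarrow> real) \<Rightarrow> bool" where
  "has_weak_deriv u g \<longleftrightarrow>
     (\<forall>\<phi>\<in>test_functions.
        (LINT x|lebesgue_on I01. u x * deriv \<phi> x) = - (LINT x|lebesgue_on I01. g x * \<phi> x))"

definition H1 :: "(real \<Rightarrow> real) set" where
  "H1 = {u \<in> L2_on I01. \<exists>g\<in>L2_on I01. has_weak_deriv u g}"

text \<open>The weak derivative is unique up to null sets; an arbitrary representative is chosen.\<close>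

definition weak_deriv :: "(real \<Rightarrow> real) \<Rightarrow> real \<Rightarrow> real" where
  "weak_deriv u = (SOME g. g \<in> L2_on I01 \<and> has_weak_deriv u g)"

definition H1_norm :: "(real \<Rightarrow> real) \<Rightarrow> real" where
  "H1_norm u = sqrt ((L2_norm u)\<^sup>2 + (L2_norm (weak_deriv u))\<^sup>2)"

definition H2 :: "(real \<Rightarrow> real) set" where
  "H2 = {u \<in> H1. weak_deriv u \<in> H1}"

definition H2_norm :: "(real \<Rightarrow> real) \<Rightarrow> real" where
  "H2_norm u =
     sqrt ((L2_norm u)\<^sup>2 + (L2_norm (weak_deriv u))\<^sup>2 + (L2_norm (weak_deriv (weak_deriv u)))\<^sup>2)"

definition H10 :: "(real \<Rightarrow> real) set" where
  "H10 = {u \<in> H1. \<forall>\<epsilon>>0. \<exists>\<phi>\<in>test_functions. H1_norm (\<lambda>x. u x - \<phi> x) < \<epsilon>}"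

text \<open>
  The value at \<open>a\<close>, where \<open>0 \<le> a \<le> 1\<close>, of the representative of \<open>u\<close> that is continuous up to the
  boundary; such a representative exists for every \<open>u\<close> in \<open>H1\<close>.
\<close>

definition trace :: "(real \<Rightarrow> real) \<Rightarrow> real \<Rightarrow> real" where
  "trace u a = (THE c. \<exists>w. continuous_on {0..1} w \<and> (AE x in lebesgue_on I01. w x = u x) \<and> c = w a)"


section \<open>Spaces of functions of time\<close>

text \<open>A function \<open>v\<close> of time and space is written in curried form: \<open>v t\<close> is its spatial profile.\<close>

definition C0_L2 :: "real \<Rightarrow> (real \<Rightarrow> real \<Rightarrow> real) set" where
  "C0_L2 T = {v. (\<forall>t\<in>{0..T}. v t \<in> L2_on I01) \<and>
     (\<forall>t\<in>{0..T}. ((\<lambda>s. L2_norm (\<lambda>x. v s x - v t x)) \<longlongrightarrow> 0) (at t within {0..T}))}"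

definition C0_L2_norm :: "real \<Rightarrow> (real \<Rightarrow> real \<Rightarrow> real) \<Rightarrow> real" where
  "C0_L2_norm T v = (SUP t\<in>{0..T}. L2_norm (v t))"

text \<open>
  Strong (Bochner) measurability with values in \<open>H2 \<inter> H10\<close>: almost everywhere in time, \<open>v\<close> is
  the limit, in the norm of that space, of simple functions with values in that space.
\<close>

definition strongly_measurable_H2 :: "real \<Rightarrow> (real \<Rightarrow> real \<Rightarrow> real) \<Rightarrow> bool" where
  "strongly_measurable_H2 T v \<longleftrightarrow>
     (\<exists>s :: nat \<Rightarrow> real \<Rightarrow> real \<Rightarrow> real.
        (\<forall>n. simple_function (lebesgue_on {0<..<T}) (s n) \<and> s n ` {0<..<T} \<subseteq> H2 \<inter> H10) \<and>
        (AE t in lebesgue_on {0<..<T}.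
           v t \<in> H2 \<inter> H10 \<and> (\<lambda>n. H2_norm (\<lambda>x. s n t x - v t x)) \<longlonglongrightarrow> 0))"

definition L2_H2 :: "real \<Rightarrow> (real \<Rightarrow> real \<Rightarrow> real) set" where
  "L2_H2 T = {v. strongly_measurable_H2 T v \<and>
                 integrable (lebesgue_on {0<..<T}) (\<lambda>t. (H2_norm (v t))\<^sup>2)}"

definition L2_H2_norm :: "real \<Rightarrow> (real \<Rightarrow> real \<Rightarrow> real) \<Rightarrow> real" where
  "L2_H2_norm T v = sqrt (LINT t|lebesgue_on {0<..<T}. (H2_norm (v t))\<^sup>2)"

definition X_space :: "real \<Rightarrow> (real \<Rightarrow> real \<Rightarrow> real) set" where
  "X_space T = C0_L2 T \<inter> L2_H2 T"

definition X_norm :: "real \<Rightarrow> (real \<Rightarrow> real \<Rightarrow> real) \<Rightarrow> real" where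
  "X_norm T v = sqrt ((C0_L2_norm T v)\<^sup>2 + (L2_H2_norm T v)\<^sup>2)"


section \<open>The Kuramoto-Sivashinsky equation\<close>

text \<open>
  Weak solutions in \<open>X_space T\<close> of \<open>v\<^sub>t + v\<^sub>x\<^sub>x\<^sub>x\<^sub>x + lam v\<^sub>x\<^sub>x + v v\<^sub>x = 0\<close> with \<open>v = 0\<close> at both ends,
  \<open>v\<^sub>x\<^sub>x(t,0) = f(t)\<close>, \<open>v\<^sub>x\<^sub>x(t,1) = 0\<close> and initial datum \<open>v0\<close>. The condition \<open>v = 0\<close> is contained in
  the membership of \<open>v t\<close> in \<open>H10\<close>; the remaining conditions are contained in the integral identity.
\<close>

definition KS_solution ::
  "real \<Rightarrow> real \<Rightarrow> (real \<Rightarrow> real) \<Rightarrow> (real \<Rightarrow> real) \<Rightarrow> (real \<Rightarrow> real \<Rightarrow> real) \<Rightarrow> bool" where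
  "KS_solution lam T v0 f v \<longleftrightarrow>
     v0 \<in> L2_on I01 \<and> f \<in> L2_on {0<..<T} \<and> v \<in> X_space T \<and>
     (\<forall>\<tau>\<in>{0..T}. \<forall>\<theta>\<in>H2 \<inter> H10.
        (LINT x|lebesgue_on I01. v \<tau> x * \<theta> x) - (LINT x|lebesgue_on I01. v0 x * \<theta> x)
        + (LINT t|lebesgue_on {0<..<\<tau>}. LINT x|lebesgue_on I01.
             weak_deriv (weak_deriv (v t)) x * weak_deriv (weak_deriv \<theta>) x
             + lam * weak_deriv (weak_deriv (v t)) x * \<theta> x
             + v t x * weak_deriv (v t) x * \<theta> x)
        + trace (weak_deriv \<theta>) 0 * (LINT t|lebesgue_on {0<..<\<tau>}. f t) = 0)"

definition closed_loop_KS_solution ::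
  "real \<Rightarrow> ((real \<Rightarrow> real) \<Rightarrow> real) \<Rightarrow> real \<Rightarrow> (real \<Rightarrow> real) \<Rightarrow> (real \<Rightarrow> real \<Rightarrow> real) \<Rightarrow> bool" where
  "closed_loop_KS_solution lam F T v0 v \<longleftrightarrow> KS_solution lam T v0 (\<lambda>t. F (v t)) v"

end

theory Submission
  imports Defs
begin

text \<open>
  In the sine basis the closed-loop problem is the infinite system
  \<open>c\<^sub>n' = - mu\<^sub>n c\<^sub>n - b\<^sub>n(v)\<close>. As
  \<open>\<integral> v v\<^sub>x sin(om\<^sub>n x) dx = - (om\<^sub>n/2) \<integral> v\<^sup>2 cos(om\<^sub>n x) dx\<close>, the nonlinearity and the boundary
  feedback both enter \<open>b\<^sub>n\<close> with size \<open>O(om\<^sub>n)\<close>, locally Lipschitz in the \<open>L\<^sup>2\<close> norm of \<open>v\<close>, while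
  \<open>mu\<^sub>n\<close> grows like \<open>om\<^sub>n\<^sup>4\<close>. Hence the Duhamel operator is a contraction for norms weighted by
  \<open>exp (- \<gamma> t)\<close> with \<open>\<gamma>\<close> large. It gains four powers of \<open>om\<^sub>n\<close>, so the forced part is \<open>O(om\<^sub>n\<^sup>-\<^sup>3)\<close> and
  bounded in time with values in \<open>H\<^sup>2\<close>; the free part is in \<open>L\<^sup>2(0,T;H\<^sup>2)\<close> because
  \<open>\<integral> om\<^sub>n\<^sup>4 exp (- 2 mu\<^sub>n t) dt\<close> over \<open>(0,T)\<close> is bounded uniformly in \<open>n\<close>.
\<close>


section \<open>The Hilbert space of square integrable functions\<close>

text \<open>The coefficients of the free part are merely square summable in \<open>n\<close>,
  whereas the Duhamel integral gains decay, so one weighted sup norm cannot serve both. The fixed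
  point is therefore sought for the forced part alone, rescaled by
  \<open>(om n)\<^sup>2 * exp (- ga * t)\<close>, among the bounded continuous functions of the pair
  \<open>(n, t)\<close>. Two powers of \<open>om n\<close> make the rescaled sequence square
  summable; the power left over makes \<open>om n ^ 3 / (mu lam n + ga)\<close> uniformly small for
  large \<open>ga\<close>. The same shift absorbs low modes, where \<open>mu lam n\<close> may be
  negative.

  The nonlinearity is quadratic. Small data keep the \<open>L2\<close> norm below 1, where the
  right-hand side has a linear bound; this is what gives a bound proportional to the norm of
  \<open>v0\<close>. For uniqueness the size of the two solutions is bounded by continuity on a
  compact time interval, so data of any size are covered.

  Testing the weak form with a sine requires membership in \<open>H10\<close>, a closure of test
  functions. This is why smooth bumps and the density of their derivatives come before the Fourier
  analysis.\<close>

abbreviation L2 :: "(real \<Rightarrow> real) set" where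
  "L2 \<equiv> L2_on I01"

abbreviation L2_dist :: "(real \<Rightarrow> real) \<Rightarrow> (real \<Rightarrow> real) \<Rightarrow> real" where
  "L2_dist u w \<equiv> L2_norm (\<lambda>x. u x - w x)"

abbreviation M01 :: "real measure" where
  "M01 \<equiv> lebesgue_on I01"

definition ip :: "(real \<Rightarrow> real) \<Rightarrow> (real \<Rightarrow> real) \<Rightarrow> real" where
  "ip u w = (LINT x|M01. u x * w x)"

text \<open>The problem is stated with Lebesgue integrals over open intervals, while the fundamental
  theorem of calculus is applied to gauge integrals over closed ones; continuity makes the two
  agree.\<close>

lemma lint_eq_integral:
  fixes f :: "real \<Rightarrow> real"
  assumes "continuous_on {a..b} f"
  shows "(LINT x|lebesgue_on {a<..<b}. f x) = integral {a..b} f"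
    and "integrable (lebesgue_on {a<..<b}) f"
proof -
  have 1: "integrable (lebesgue_on {a..b}) f"
    using continuous_imp_integrable_real[OF assms] .
  then have "f absolutely_integrable_on {a..b}"
    by (simp add: absolutely_integrable_continuous_real assms)
  then have "f absolutely_integrable_on {a<..<b}"
    by (rule set_integrable_subset) auto
  then show 2: "integrable (lebesgue_on {a<..<b}) f"
    by (simp add: integrable_restrict_space set_integrable_def)
  have "(LINT x|lebesgue_on {a<..<b}. f x) = integral {a<..<b} f"
    using lebesgue_integral_eq_integral[OF 2] by simp
  then show "(LINT x|lebesgue_on {a<..<b}. f x) = integral {a..b} f"
    by (simp add: integral_open_interval_real)
qed

lemma finite_measure_M01 [simp]: "finite_measure M01"
  by (rule finite_measureI) (simp add: emeasure_restrict_space space_restrict_space)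

lemma L2D:
  assumes "u \<in> L2"
  shows "u \<in> borel_measurable M01" "integrable M01 (\<lambda>x. (u x)\<^sup>2)"
  using assms by (auto simp: L2_on_def)

lemma L2_mult_integrable:
  assumes "u \<in> L2" "w \<in> L2"
  shows "integrable M01 (\<lambda>x. u x * w x)"
proof (rule Bochner_Integration.integrable_bound)
  show "integrable M01 (\<lambda>x. (u x)\<^sup>2 + (w x)\<^sup>2)"
    using assms by (intro Bochner_Integration.integrable_add L2D)
  show "(\<lambda>x. u x * w x) \<in> borel_measurable M01"
    using assms by (intro borel_measurable_times L2D)
  have "\<bar>a * b\<bar> \<le> \<bar>a\<^sup>2 + b\<^sup>2\<bar>" for a b :: real
  proof -
    have "2 * \<bar>a * b\<bar> \<le> a\<^sup>2 + b\<^sup>2"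
      using sum_squares_bound[of "\<bar>a\<bar>" "\<bar>b\<bar>"] by (simp add: abs_mult)
    then show ?thesis using abs_ge_zero[of "a * b"] by linarith
  qed
  then show "AE x in M01. norm (u x * w x) \<le> norm ((u x)\<^sup>2 + (w x)\<^sup>2)"
    by simp
qed

lemma L2_add: 
  assumes "u \<in> L2" "w \<in> L2"
  shows "(\<lambda>x. u x + w x) \<in> L2"
proof -
  have "integrable M01 (\<lambda>x. (u x)\<^sup>2 + (w x)\<^sup>2 + 2 * (u x * w x))"
    using assms by (intro Bochner_Integration.integrable_add integrable_mult_right L2D L2_mult_integrable)
  then show ?thesis
    using assms by (auto simp: L2_on_def power2_sum mult.assoc)
qed

lemma L2_cmult: 
  assumes "u \<in> L2"
  shows "(\<lambda>x. c * u x) \<in> L2"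
  using assms by (auto simp: L2_on_def power_mult_distrib)

lemma L2_diff: 
  assumes "u \<in> L2" "w \<in> L2"
  shows "(\<lambda>x. u x - w x) \<in> L2"
  using L2_add[OF assms(1) L2_cmult[OF assms(2), of "-1"]] by simp

lemma L2_minus: 
  assumes "u \<in> L2"
  shows "(\<lambda>x. - u x) \<in> L2"
  using L2_cmult[OF assms(1), of "-1"] by simp

lemma L2_zero [simp]: "(\<lambda>x. 0) \<in> L2"
  by (auto simp: L2_on_def)

lemma L2_sum:
  assumes "\<And>i. i \<in> A \<Longrightarrow> u i \<in> L2"
  shows "(\<lambda>x. \<Sum>i\<in>A. u i x) \<in> L2"
  using assms by (induction A rule: infinite_finite_induct) (auto intro!: L2_add)

lemma L2_bounded:
  assumes "f \<in> borel_measurable M01" "\<And>x. x \<in> I01 \<Longrightarrow> \<bar>f x\<bar> \<le> B"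
  shows "f \<in> L2"
proof -
  have "integrable M01 (\<lambda>x. (f x)\<^sup>2)"
  proof (rule finite_measure.integrable_const_bound)
    show "AE x in M01. norm ((f x)\<^sup>2) \<le> B\<^sup>2"
    proof (rule AE_I2)
      fix x assume "x \<in> space M01"
      then have "\<bar>f x\<bar> \<le> B" using assms by (simp add: space_restrict_space)
      then have "\<bar>f x\<bar>^2 \<le> B^2" by (intro power_mono) auto
      then show "norm ((f x)\<^sup>2) \<le> B\<^sup>2" by simp
    qed
  qed (use assms in auto)
  then show ?thesis using assms by (simp add: L2_on_def)
qed

lemma continuous_measurable_M01:
  assumes "continuous_on {0..1} f"
  shows "f \<in> borel_measurable M01"
proof (rule continuous_imp_measurable_on_sets_lebesgue)
  show "continuous_on I01 f" by (rule continuous_on_subset[OF assms]) auto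
qed simp

lemma L2_continuous:
  assumes "continuous_on {0..1} f"
  shows "f \<in> L2"
proof -
  have "f \<in> borel_measurable M01"
    by (rule continuous_measurable_M01[OF assms])
  moreover obtain B where "\<And>x. x \<in> {0..1} \<Longrightarrow> \<bar>f x\<bar> \<le> B"
    using compact_continuous_image[OF assms compact_Icc] 
    by (metis bounded_iff compact_imp_bounded imageI real_norm_def)
  ultimately show ?thesis by (intro L2_bounded[where B=B]) auto
qed

lemma L2_mult_bounded:
  assumes "u \<in> L2" "g \<in> borel_measurable M01" "\<And>x. x \<in> I01 \<Longrightarrow> \<bar>g x\<bar> \<le> B"
  shows "(\<lambda>x. g x * u x) \<in> L2" "L2_norm (\<lambda>x. g x * u x) \<le> B * L2_norm u"
proof -
  have B: "B \<ge> 0" using assms(3)[of "1/2"] by force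
  have le: "(g x * u x)\<^sup>2 \<le> B\<^sup>2 * (u x)\<^sup>2" if "x \<in> I01" for x
  proof -
    have "\<bar>g x\<bar>^2 \<le> B^2" using assms(3)[OF that] by (intro power_mono) auto
    then show ?thesis by (simp add: power_mult_distrib mult_right_mono)
  qed
  have m: "(\<lambda>x. (g x * u x)\<^sup>2) \<in> borel_measurable M01"
    using L2D(1)[OF assms(1)] assms(2) by measurable
  have i: "integrable M01 (\<lambda>x. (g x * u x)\<^sup>2)"
    by (rule Bochner_Integration.integrable_bound[where f="\<lambda>x. B\<^sup>2 * (u x)\<^sup>2"])
      (use le m L2D(2)[OF assms(1)] in \<open>auto simp: space_restrict_space intro!: AE_I2\<close>)
  then show "(\<lambda>x. g x * u x) \<in> L2"
    using L2D(1)[OF assms(1)] assms(2) by (simp add: L2_on_def)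
  have "(LINT x|M01. (g x * u x)\<^sup>2) \<le> (LINT x|M01. B\<^sup>2 * (u x)\<^sup>2)"
    by (rule integral_mono[OF i]) (use le L2D(2)[OF assms(1)] in \<open>auto simp: space_restrict_space\<close>)
  also have "\<dots> = B\<^sup>2 * (LINT x|M01. (u x)\<^sup>2)" by simp
  finally have "sqrt (LINT x|M01. (g x * u x)\<^sup>2) \<le> sqrt (B\<^sup>2 * (LINT x|M01. (u x)\<^sup>2))"
    by (rule real_sqrt_le_mono)
  then show "L2_norm (\<lambda>x. g x * u x) \<le> B * L2_norm u"
    unfolding L2_norm_def using B by (simp add: real_sqrt_mult)
qed

lemma L2_mult_continuous:
  assumes "u \<in> L2" "continuous_on {0..1} g"
  shows "(\<lambda>x. g x * u x) \<in> L2"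
proof -
  have "g \<in> borel_measurable M01"
    by (rule continuous_measurable_M01[OF assms(2)])
  moreover obtain B where "\<And>x. x \<in> {0..1} \<Longrightarrow> \<bar>g x\<bar> \<le> B"
    using compact_continuous_image[OF assms(2) compact_Icc] 
    by (metis bounded_iff compact_imp_bounded imageI real_norm_def)
  ultimately show ?thesis using assms by (intro L2_mult_bounded[where B=B]) auto
qed

lemma ip_commute: "ip u w = ip w u"
  by (simp add: ip_def mult.commute)

lemma ip_add_left: "\<lbrakk>u \<in> L2; v \<in> L2; w \<in> L2\<rbrakk> \<Longrightarrow> ip (\<lambda>x. u x + v x) w = ip u w + ip v w"
  unfolding ip_def by (simp add: distrib_right L2_mult_integrable)

lemma ip_diff_left: "\<lbrakk>u \<in> L2; v \<in> L2; w \<in> L2\<rbrakk> \<Longrightarrow> ip (\<lambda>x. u x - v x) w = ip u w - ip v w"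
  unfolding ip_def by (simp add: left_diff_distrib L2_mult_integrable)

lemma ip_cmult_left: "ip (\<lambda>x. c * u x) w = c * ip u w"
  unfolding ip_def by (simp add: mult.assoc)

lemma ip_sum_left: 
  assumes "\<And>i. i \<in> A \<Longrightarrow> u i \<in> L2" "w \<in> L2"
  shows "ip (\<lambda>x. \<Sum>i\<in>A. u i x) w = (\<Sum>i\<in>A. ip (u i) w)"
  unfolding ip_def sum_distrib_right
  by (rule Bochner_Integration.integral_sum) (use assms in \<open>auto intro: L2_mult_integrable\<close>)

lemma ip_cmult_right: "ip w (\<lambda>x. c * u x) = c * ip w u"
  by (metis ip_cmult_left ip_commute)

lemma ip_add_right: "\<lbrakk>u \<in> L2; v \<in> L2; w \<in> L2\<rbrakk> \<Longrightarrow> ip w (\<lambda>x. u x + v x) = ip w u + ip w v"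
  by (simp add: ip_commute[of w] ip_add_left)

lemma ip_diff_right: "\<lbrakk>u \<in> L2; v \<in> L2; w \<in> L2\<rbrakk> \<Longrightarrow> ip w (\<lambda>x. u x - v x) = ip w u - ip w v"
  by (simp add: ip_commute[of w] ip_diff_left)

lemma ip_sum_right:
  assumes "\<And>i. i \<in> A \<Longrightarrow> u i \<in> L2" "w \<in> L2"
  shows "ip w (\<lambda>x. \<Sum>i\<in>A. u i x) = (\<Sum>i\<in>A. ip w (u i))"
  using ip_sum_left[OF assms] by (simp add: ip_commute)

lemma L2_norm_nonneg [simp]: "0 \<le> L2_norm u"
  by (simp add: L2_norm_def)

lemma ip_self: "ip u u = (L2_norm u)\<^sup>2"
  by (simp add: ip_def L2_norm_def power2_eq_square)

lemma ip_cong_AE: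
  assumes "AE x in M01. u x = u' x" "u \<in> L2" "u' \<in> L2" "w \<in> L2"
  shows "ip u w = ip u' w"
  unfolding ip_def by (rule integral_cong_AE) (use assms L2_mult_integrable in auto)

lemma L2_norm_cong_AE:
  assumes "AE x in M01. u x = u' x" "u \<in> L2" "u' \<in> L2"
  shows "L2_norm u = L2_norm u'"
  unfolding L2_norm_def 
  by (intro arg_cong[where f=sqrt] integral_cong_AE) (use assms L2D in auto)

lemma L2_norm_cmult: "L2_norm (\<lambda>x. c * u x) = \<bar>c\<bar> * L2_norm u"
  by (simp add: L2_norm_def power_mult_distrib real_sqrt_mult)

lemma L2_norm_minus_commute: "L2_dist u v = L2_dist v u"
  by (simp add: L2_norm_def power2_commute)

lemma L2_norm_minus: "L2_norm (\<lambda>x. - u x) = L2_norm u"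
  by (simp add: L2_norm_def)

lemma L2_norm_zero [simp]: "L2_norm (\<lambda>x. 0) = 0"
  by (simp add: L2_norm_def)

lemma L2_norm_eq_0_iff:
  assumes "u \<in> L2"
  shows "L2_norm u = 0 \<longleftrightarrow> (AE x in M01. u x = 0)"
  unfolding L2_norm_def using integral_nonneg_eq_0_iff_AE[OF L2D(2)[OF assms]] by simp

lemma L2_norm_add_sq:
  assumes "u \<in> L2" "w \<in> L2"
  shows "(L2_norm (\<lambda>x. u x + w x))\<^sup>2 = (L2_norm u)\<^sup>2 + 2 * ip u w + (L2_norm w)\<^sup>2"
  using assms by (simp add: ip_self[symmetric] ip_add_left ip_add_right L2_add ip_commute)

lemma ip_Cauchy_Schwarz:
  assumes "u \<in> L2" "w \<in> L2"
  shows "\<bar>ip u w\<bar> \<le> L2_norm u * L2_norm w"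
proof -
  let ?a = "L2_norm u" and ?b = "L2_norm w"
  \<comment> \<open>The squared norm of \<open>s u + t w\<close>. Two parameters, later set to
    \<open>- ip u w\<close> and \<open>?a\<^sup>2\<close>, avoid a division.\<close>
  have key: "0 \<le> s\<^sup>2 * ?a\<^sup>2 + 2 * s * t * ip u w + t\<^sup>2 * ?b\<^sup>2" for s t
  proof -
    have "0 \<le> (L2_norm (\<lambda>x. s * u x + t * w x))\<^sup>2" by simp
    also have "\<dots> = s\<^sup>2 * ?a\<^sup>2 + 2 * s * t * ip u w + t\<^sup>2 * ?b\<^sup>2"
      using assms by (subst L2_norm_add_sq)
        (auto simp: L2_norm_cmult power_mult_distrib ip_cmult_left ip_cmult_right intro: L2_cmult)
    finally show ?thesis .
  qed
  show ?thesis
  proof (cases "?a = 0")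
    case True
    then have "AE x in M01. u x = 0" using L2_norm_eq_0_iff assms by blast
    then have "ip u w = ip (\<lambda>x. 0) w" using assms by (intro ip_cong_AE) auto
    then show ?thesis using True by (simp add: ip_def)
  next
    case False
    then have a: "?a > 0" using L2_norm_nonneg[of u] by linarith
    have "0 \<le> (ip u w)\<^sup>2 * ?a\<^sup>2 - 2 * ip u w * ?a\<^sup>2 * ip u w + (?a\<^sup>2)\<^sup>2 * ?b\<^sup>2"
      using key[of "- ip u w" "?a\<^sup>2"] by simp
    also have "\<dots> = ?a\<^sup>2 * (?a\<^sup>2 * ?b\<^sup>2 - (ip u w)\<^sup>2)"
      by (simp add: power2_eq_square algebra_simps)
    finally have "(ip u w)\<^sup>2 \<le> (?a * ?b)\<^sup>2"
      using a by (simp add: zero_le_mult_iff power_mult_distrib)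
    then show ?thesis using abs_le_square_iff[of "ip u w" "?a * ?b"] by simp
  qed
qed

lemma L2_norm_triangle:
  assumes "u \<in> L2" "w \<in> L2"
  shows "L2_norm (\<lambda>x. u x + w x) \<le> L2_norm u + L2_norm w"
proof -
  have "(L2_norm (\<lambda>x. u x + w x))\<^sup>2 \<le> (L2_norm u + L2_norm w)\<^sup>2"
    using L2_norm_add_sq[OF assms] ip_Cauchy_Schwarz[OF assms] by (simp add: power2_sum)
  then show ?thesis by (rule power2_le_imp_le) simp
qed

lemma L2_norm_triangle_diff:
  assumes "u \<in> L2" "v \<in> L2" "w \<in> L2"
  shows "L2_dist u w \<le> L2_dist u v + L2_dist v w"
  using L2_norm_triangle[OF L2_diff[OF assms(1,2)] L2_diff[OF assms(2,3)]] by simp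

lemma L2_norm_diff_ineq:
  assumes "u \<in> L2" "w \<in> L2"
  shows "\<bar>L2_norm u - L2_norm w\<bar> \<le> L2_dist u w"
  using L2_norm_triangle[OF L2_diff[OF assms] assms(2)]
    L2_norm_triangle[OF L2_diff[OF assms(2,1)] assms(1)] L2_norm_minus_commute[of u w]
  by simp

lemma L2_norm_le_bound:
  assumes "f \<in> L2" "\<And>x. x \<in> I01 \<Longrightarrow> \<bar>f x\<bar> \<le> B"
  shows "L2_norm f \<le> B"
proof -
  have "L2_norm (\<lambda>x. f x * 1) \<le> B * L2_norm (\<lambda>x. 1)"
    by (rule L2_mult_bounded(2)) (use assms L2D L2_bounded[of "\<lambda>_. 1" 1] in auto)
  moreover have "L2_norm (\<lambda>x. 1) = 1" 
    by (simp add: L2_norm_def space_restrict_space measure_restrict_space)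
  ultimately show ?thesis by simp
qed

lemma L2_const [simp]: "(\<lambda>x. c) \<in> L2"
  by (rule L2_continuous) simp

lemma L2_integrable:
  assumes "u \<in> L2" shows "integrable M01 u"
  using L2_mult_integrable[OF assms L2_const[of 1]] by simp

lemma abs_lint_le_L2_norm:
  assumes "u \<in> L2"
  shows "\<bar>LINT x|M01. u x\<bar> \<le> L2_norm u"
  using ip_Cauchy_Schwarz[OF assms L2_const[of 1]] L2_norm_le_bound[of "\<lambda>x. 1" 1]
    mult_left_mono[of "L2_norm (\<lambda>x. 1)" 1 "L2_norm u"]
  by (simp add: ip_def)

text \<open>Membership in \<open>L2\<close> is built in because \<open>L2_norm\<close> evaluates to
  0 when the square is not integrable, so that a small distance alone would say nothing.\<close>

definition L2_tendsto :: "(nat \<Rightarrow> real \<Rightarrow> real) \<Rightarrow> (real \<Rightarrow> real) \<Rightarrow> bool" where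
  "L2_tendsto s u \<longleftrightarrow> (\<forall>n. s n \<in> L2) \<and> u \<in> L2 \<and> (\<lambda>n. L2_dist (s n) u) \<longlonglongrightarrow> 0"

lemma L2_tendsto_ip:
  assumes "L2_tendsto s u" "w \<in> L2"
  shows "(\<lambda>n. ip (s n) w) \<longlonglongrightarrow> ip u w"
proof -
  have "(\<lambda>n. ip (s n) w - ip u w) \<longlonglongrightarrow> 0"
  proof (rule Lim_null_comparison)
    show "\<forall>\<^sub>F n in sequentially. norm (ip (s n) w - ip u w) \<le> L2_dist (s n) u * L2_norm w"
      using assms ip_Cauchy_Schwarz[OF L2_diff assms(2)] 
      by (auto simp: L2_tendsto_def ip_diff_left)
    show "(\<lambda>n. L2_dist (s n) u * L2_norm w) \<longlonglongrightarrow> 0"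
      using assms by (auto simp: L2_tendsto_def intro: tendsto_mult_left_zero)
  qed
  then show ?thesis by (simp add: LIM_zero_iff)
qed

lemma L2_tendsto_norm:
  assumes "L2_tendsto s u"
  shows "(\<lambda>n. L2_norm (s n)) \<longlonglongrightarrow> L2_norm u"
proof -
  have "(\<lambda>n. L2_norm (s n) - L2_norm u) \<longlonglongrightarrow> 0"
  proof (rule Lim_null_comparison)
    show "\<forall>\<^sub>F n in sequentially. norm (L2_norm (s n) - L2_norm u) \<le> L2_dist (s n) u"
      using assms L2_norm_diff_ineq by (auto simp: L2_tendsto_def)
  qed (use assms in \<open>auto simp: L2_tendsto_def\<close>)
  then show ?thesis by (simp add: LIM_zero_iff)
qed

lemma L2_tendsto_unique:
  assumes "L2_tendsto s u" "L2_tendsto s w"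
  shows "AE x in M01. u x = w x"
proof -
  have "(\<lambda>n. L2_dist (s n) u + L2_dist (s n) w) \<longlonglongrightarrow> 0 + 0"
    using assms unfolding L2_tendsto_def by (intro tendsto_add) auto
  moreover have "L2_dist u w \<le> L2_dist (s n) u + L2_dist (s n) w" for n
    using assms L2_norm_triangle_diff[of u "s n" w] L2_norm_minus_commute[of u "s n"] 
    unfolding L2_tendsto_def by auto
  ultimately have "L2_dist u w \<le> 0 + 0"
    using LIMSEQ_le_const by blast
  then have "L2_dist u w = 0" using L2_norm_nonneg[of "\<lambda>x. u x - w x"] by linarith
  then show ?thesis
    using assms L2_norm_eq_0_iff[OF L2_diff] by (auto simp: L2_tendsto_def)
qed

section \<open>Completeness of the space of square integrable functions\<close>

lemma L2_norm_le_nn: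
  assumes "u \<in> borel_measurable M01" "(\<integral>\<^sup>+x. ennreal ((u x)\<^sup>2) \<partial>M01) \<le> ennreal B" "B \<ge> 0"
  shows "u \<in> L2" "L2_norm u \<le> sqrt B"
proof -
  have i: "integrable M01 (\<lambda>x. (u x)\<^sup>2)"
  proof (rule integrableI_bounded)
    show "(\<integral>\<^sup>+x. ennreal (norm ((u x)\<^sup>2)) \<partial>M01) < \<infinity>"
      using le_less_trans[OF assms(2) ennreal_less_top] by simp
  qed (use assms in measurable)
  then show "u \<in> L2" using assms by (simp add: L2_on_def)
  have "ennreal (LINT x|M01. (u x)\<^sup>2) \<le> ennreal B"
    using nn_integral_eq_integral[OF i] assms by simp
  then have "(LINT x|M01. (u x)\<^sup>2) \<le> B" using assms by (simp add: ennreal_le_iff)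
  then show "L2_norm u \<le> sqrt B" unfolding L2_norm_def by (rule real_sqrt_le_mono)
qed

text \<open>A rapidly converging subsequence converges almost everywhere, since its increments are
  absolutely summable; Fatou's lemma then bounds the distance of the whole sequence to the pointwise
  limit.\<close>

theorem L2_complete:
  assumes s: "\<And>n. s n \<in> L2"
    and Cauchy: "\<And>e. e > 0 \<Longrightarrow> \<exists>N. \<forall>m\<ge>N. \<forall>n\<ge>N. L2_dist (s m) (s n) < e"
  obtains u where "L2_tendsto s u"
proof -
  have "\<exists>N. \<forall>k. (\<forall>m\<ge>N k. \<forall>n\<ge>N k. L2_dist (s m) (s n) < (1/2) ^ k)"
    by (rule choice) (use Cauchy in simp)
  then obtain N where N: "\<And>k m n. \<lbrakk>m \<ge> N k; n \<ge> N k\<rbrakk> \<Longrightarrow> L2_dist (s m) (s n) < (1/2) ^ k"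
    by blast
  \<comment> \<open>\<open>r k\<close> lies beyond every threshold \<open>N j\<close> with
    \<open>j \<le> k\<close>, hence consecutive members of the subsequence differ by at most
    \<open>(1/2) ^ k\<close>.\<close>
  define r where "r k = Max (N ` {..k}) + k" for k
  have r: "N j \<le> r k" if "j \<le> k" for j k
    using that Max_ge[of "N ` {..k}" "N j"] by (simp add: r_def trans_le_add1)
  define h where "h k x = s (r (Suc k)) x - s (r k) x" for k x
  have h: "h k \<in> L2" for k unfolding h_def using s by (intro L2_diff)
  have hn: "L2_norm (h k) \<le> (1/2) ^ k" for k
    unfolding h_def using N[of k "r (Suc k)" "r k"] r by (simp add: less_imp_le)
  have meas [measurable]: "h k \<in> borel_measurable M01" "s k \<in> borel_measurable M01" for k
    using L2D h s by auto
  \<comment> \<open>The interval has length one, so the integral of \<open>\<bar>h k x\<bar>\<close>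
    is at most \<open>L2_norm (h k)\<close> and the increments have a geometric majorant.\<close>
  have "(\<integral>\<^sup>+x. ennreal \<bar>h k x\<bar> \<partial>M01) \<le> ennreal ((1/2) ^ k)" for k
  proof -
    have "(\<lambda>x. \<bar>h k x\<bar>) \<in> L2" using h[of k] by (auto simp: L2_on_def)
    moreover have "L2_norm (\<lambda>x. \<bar>h k x\<bar>) = L2_norm (h k)" by (simp add: L2_norm_def)
    ultimately have "(LINT x|M01. \<bar>h k x\<bar>) \<le> (1/2) ^ k"
      using abs_lint_le_L2_norm[of "\<lambda>x. \<bar>h k x\<bar>"] hn[of k] by simp
    moreover have "integrable M01 (\<lambda>x. \<bar>h k x\<bar>)" using L2_integrable[OF h] by simp
    ultimately show ?thesis using nn_integral_eq_integral[of M01 "\<lambda>x. \<bar>h k x\<bar>"]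
      by (simp add: ennreal_leI)
  qed
  then have "(\<Sum>k. \<integral>\<^sup>+x. ennreal \<bar>h k x\<bar> \<partial>M01) \<le> (\<Sum>k. ennreal ((1/2) ^ k))"
    by (intro suminf_le) auto
  also have "\<dots> = ennreal 2"
    using geometric_sums[of "1/2::real"] by (intro suminf_ennreal_eq) auto
  finally have "(\<integral>\<^sup>+x. (\<Sum>k. ennreal \<bar>h k x\<bar>) \<partial>M01) \<le> ennreal 2"
    by (subst nn_integral_suminf) auto
  then have "(\<integral>\<^sup>+x. (\<Sum>k. ennreal \<bar>h k x\<bar>) \<partial>M01) \<noteq> \<infinity>"
    by (metis ennreal_less_top infinity_ennreal_def leD)
  then have "AE x in M01. (\<Sum>k. ennreal \<bar>h k x\<bar>) \<noteq> \<infinity>"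
    by (intro nn_integral_PInf_AE) auto
  then have conv: "AE x in M01. convergent (\<lambda>k. s (r k) x)"
  proof eventually_elim
    case (elim x)
    then have "summable (\<lambda>k. \<bar>h k x\<bar>)" 
      by (intro summable_suminf_not_top) (auto simp: infinity_ennreal_def)
    then have "summable (\<lambda>k. h k x)" by (rule summable_rabs_cancel)
    then have "convergent (\<lambda>n. \<Sum>k<n. h k x)" by (simp add: summable_iff_convergent)
    moreover have "(\<Sum>k<n. h k x) = s (r n) x - s (r 0) x" for n
      unfolding h_def by (rule sum_lessThan_telescope)
    ultimately show ?case by (simp add: convergent_diff_const_right_iff)
  qed
  define u where "u x = lim (\<lambda>k. s (r k) x)" for x
  have [measurable]: "u \<in> borel_measurable M01"
    unfolding u_def by measurable
  have lim: "AE x in M01. (\<lambda>k. s (r k) x) \<longlonglongrightarrow> u x"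
    using conv by eventually_elim (simp add: u_def convergent_LIMSEQ_iff)
  have near: "(\<lambda>x. s n x - u x) \<in> L2 \<and> L2_dist (s n) u \<le> (1/2)^k" if n: "n \<ge> N k" for n k
  proof -
    have "(\<integral>\<^sup>+x. ennreal ((s n x - u x)\<^sup>2) \<partial>M01) 
        = (\<integral>\<^sup>+x. liminf (\<lambda>j. ennreal ((s n x - s (r j) x)\<^sup>2)) \<partial>M01)"
    proof (rule nn_integral_cong_AE)
      show "AE x in M01. ennreal ((s n x - u x)\<^sup>2) = liminf (\<lambda>j. ennreal ((s n x - s (r j) x)\<^sup>2))"
        using lim
      proof eventually_elim
        case (elim x)
        have "(\<lambda>j. ennreal ((s n x - s (r j) x)\<^sup>2)) \<longlonglongrightarrow> ennreal ((s n x - u x)\<^sup>2)"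
          using elim by (intro tendsto_ennrealI tendsto_intros)
        then show ?case by (rule lim_imp_Liminf[OF sequentially_bot, symmetric])
      qed
    qed
    also have "\<dots> \<le> liminf (\<lambda>j. \<integral>\<^sup>+x. ennreal ((s n x - s (r j) x)\<^sup>2) \<partial>M01)"
      by (rule nn_integral_liminf) measurable
    also have "\<dots> \<le> ennreal (((1/2)^k)\<^sup>2)"
    proof (rule Liminf_le)
      show "\<forall>\<^sub>F j in sequentially. (\<integral>\<^sup>+x. ennreal ((s n x - s (r j) x)\<^sup>2) \<partial>M01) \<le> ennreal (((1/2)^k)\<^sup>2)"
        using eventually_ge_at_top[of k]
      proof eventually_elim
        case (elim j)
        have d: "(\<lambda>x. s n x - s (r j) x) \<in> L2" using s by (intro L2_diff)
        have "(L2_dist (s n) (s (r j)))\<^sup>2 \<le> ((1/2)^k)\<^sup>2"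
          using N[OF n r[OF elim]] by (intro power_mono) auto
        then have "(LINT x|M01. (s n x - s (r j) x)\<^sup>2) \<le> ((1/2)^k)\<^sup>2"
          by (simp add: L2_norm_def)
        then show ?case
          using nn_integral_eq_integral[OF L2D(2)[OF d]] by (simp add: ennreal_leI)
      qed
    qed simp
    finally show ?thesis using L2_norm_le_nn[of "\<lambda>x. s n x - u x" "((1/2)^k)\<^sup>2"] by simp
  qed
  have "u \<in> L2" using L2_diff[OF s[of "N 0"] conjunct1[OF near[of 0 "N 0"]]] by simp
  moreover have "(\<lambda>n. L2_dist (s n) u) \<longlonglongrightarrow> 0"
  proof (rule LIMSEQ_I)
    fix e :: real assume "e > 0"
    then obtain k where k: "(1/2)^k < e" using real_arch_pow_inv[of e "1/2"] by auto
    show "\<exists>no. \<forall>n\<ge>no. norm (L2_dist (s n) u - 0) < e"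
      using near[of k] k by (intro exI[of _ "N k"]) (force intro: le_less_trans)
  qed
  ultimately show thesis using that s by (simp add: L2_tendsto_def)
qed


section \<open>Density of test functions\<close>

lemma L2_norm_dominated:
  assumes s: "\<And>n. s n \<in> borel_measurable M01" and w: "w \<in> L2"
    and bound: "\<And>n x. x \<in> I01 \<Longrightarrow> \<bar>s n x\<bar> \<le> \<bar>w x\<bar>"
    and lim: "AE x in M01. (\<lambda>n. s n x) \<longlonglongrightarrow> 0"
  shows "\<And>n. s n \<in> L2" "(\<lambda>n. L2_norm (s n)) \<longlonglongrightarrow> 0"
proof -
  have sq: "(s n x)\<^sup>2 \<le> (w x)\<^sup>2" if "x \<in> I01" for n x
    using bound[OF that, of n] abs_le_square_iff by blast
  have ae: "AE x in M01. norm ((s n x)\<^sup>2) \<le> (w x)\<^sup>2" for n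
    by (rule AE_I2) (simp add: space_restrict_space sq)
  have "(\<lambda>n. LINT x|M01. (s n x)\<^sup>2) \<longlonglongrightarrow> (LINT x|M01. 0)"
  proof (rule integral_dominated_convergence[where w="\<lambda>x. (w x)\<^sup>2"])
    show "AE x in M01. (\<lambda>n. (s n x)\<^sup>2) \<longlonglongrightarrow> 0"
      using lim by eventually_elim (auto intro: tendsto_eq_intros)
  qed (use s L2D[OF w] ae in auto)
  then show "(\<lambda>n. L2_norm (s n)) \<longlonglongrightarrow> 0"
    using tendsto_real_sqrt by (fastforce simp: L2_norm_def)
  show "s n \<in> L2" for n
    using Bochner_Integration.integrable_bound[OF L2D(2)[OF w], of "\<lambda>x. (s n x)\<^sup>2"] s ae
    by (auto simp: L2_on_def)
qed

lemma L2_clamp_approx: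
  assumes u: "u \<in> L2" and e: "e > 0"
  obtains k :: nat where "(\<lambda>x. max (- real k) (min (real k) (u x))) \<in> L2"
    "L2_norm (\<lambda>x. u x - max (- real k) (min (real k) (u x))) < e"
proof -
  define h where "h k x = max (- real k) (min (real k) (u x))" for k :: nat and x
  note [measurable] = L2D(1)[OF u]
  have lim: "(\<lambda>k. u x - h k x) \<longlonglongrightarrow> 0" for x
  proof (rule tendsto_eventually)
    obtain N :: nat where "\<bar>u x\<bar> \<le> real N" using real_arch_simple by blast
    then show "\<forall>\<^sub>F k in sequentially. u x - h k x = 0"
      by (intro eventually_sequentiallyI[of N]) (auto simp: h_def max_def min_def)
  qed
  have "(\<lambda>k. L2_dist u (h k)) \<longlonglongrightarrow> 0"
    by (rule L2_norm_dominated(2)[OF _ u]) (use lim in \<open>auto simp: h_def max_def min_def\<close>)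
  then obtain k where k: "L2_dist u (h k) < e"
    using LIMSEQ_D[OF _ e] by fastforce
  have "h k \<in> L2" unfolding h_def
    by (rule L2_bounded[where B="real k"]) auto
  then show thesis using that[of k] k by (simp add: h_def[abs_def])
qed

text \<open>Measurability yields continuous functions that converge almost everywhere, but without a
  common majorant. Clamping both the limit and the approximants at level \<open>k\<close> supplies
  one for dominated convergence.\<close>

lemma L2_continuous_dense:
  assumes u: "u \<in> L2" and e: "e > 0"
  obtains g where "continuous_on UNIV g" "L2_dist u g < e"
proof -
  obtain k where h: "(\<lambda>x. max (- real k) (min (real k) (u x))) \<in> L2"
    "L2_norm (\<lambda>x. u x - max (- real k) (min (real k) (u x))) < e / 2"
    using L2_clamp_approx[OF u, of "e/2"] e by auto
  define h where "h x = max (- real k) (min (real k) (u x))" for x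
  have "u measurable_on I01"
    using L2D(1)[OF u] by (simp add: measurable_on_iff_borel_measurable)
  then obtain N g where N: "negligible N" and g: "\<And>n::nat. continuous_on UNIV (g n)"
    and lim: "\<And>x. x \<notin> N \<Longrightarrow> (\<lambda>n. g n x) \<longlonglongrightarrow> (if x \<in> I01 then u x else 0)"
    unfolding measurable_on_def by blast
  define c where "c n x = max (- real k) (min (real k) (g n x))" for n x
  have c: "continuous_on UNIV (c n)" for n unfolding c_def
    by (intro continuous_intros g)
  have cm: "c n \<in> L2" for n
    by (rule L2_continuous[OF continuous_on_subset[OF c]]) auto
  have hl: "h \<in> L2" using h(1) by (simp add: h_def[abs_def])
  have "(\<lambda>n. L2_dist h (c n)) \<longlonglongrightarrow> 0"
  proof (rule L2_norm_dominated(2)[where w="\<lambda>x. 2 * real k"])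
    show "AE x in M01. (\<lambda>n. h x - c n x) \<longlonglongrightarrow> 0"
    proof -
      have "AE x in lebesgue. x \<notin> N"
        using N by (simp add: AE_not_in negligible_iff_null_sets)
      then have "AE x in M01. x \<notin> N"
        by (subst AE_restrict_space_iff) auto
      moreover have "AE x in M01. x \<in> I01" by (rule AE_I2) (simp add: space_restrict_space)
      ultimately show ?thesis
      proof eventually_elim
        case (elim x)
        then have "(\<lambda>n. g n x) \<longlonglongrightarrow> u x" using lim[of x] by simp
        then have "(\<lambda>n. c n x) \<longlonglongrightarrow> h x" unfolding c_def h_def by (intro tendsto_intros)
        from tendsto_diff[OF tendsto_const[of "h x"] this] show ?case by simp
      qed
    qed
    show "\<bar>h x - c n x\<bar> \<le> \<bar>2 * real k\<bar>" for n x by (auto simp: h_def c_def max_def min_def)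
  qed (use L2D(1)[OF hl] L2D(1)[OF cm] in auto)
  then obtain n where n: "L2_dist h (c n) < e / 2"
    using LIMSEQ_D[of _ 0 "e/2"] e by fastforce
  have "L2_dist u (c n) < e"
    using L2_norm_triangle_diff[OF u hl cm[of n]] n h(2) by (simp add: h_def)
  then show thesis using that c by blast
qed

lemma L2_poly [simp]: "poly p \<in> L2"
  by (rule L2_continuous) (intro continuous_intros)

lemma continuous_poly_approx:
  fixes f :: "real \<Rightarrow> real"
  assumes "continuous_on {a..b} f" "e > 0"
  obtains p :: "real poly" where "\<And>x. x \<in> {a..b} \<Longrightarrow> \<bar>f x - poly p x\<bar> < e"
proof -
  obtain g where g: "real_polynomial_function g" "\<And>x. x \<in> {a..b} \<Longrightarrow> \<bar>f x - g x\<bar> < e"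
    using Stone_Weierstrass_real_polynomial_function[OF compact_Icc assms] by blast
  then obtain a n where "g = (\<lambda>x. \<Sum>i\<le>n. a i * x^i)"
    using real_polynomial_function_imp_sum by blast
  then have "g x = poly (\<Sum>i\<le>n. monom (a i) i) x" for x
    by (simp add: poly_sum poly_monom)
  then show thesis using that g(2) by metis
qed

lemma L2_poly_dense:
  assumes u: "u \<in> L2" and e: "e > 0"
  obtains p where "L2_dist u (poly p) < e"
proof -
  obtain g where g: "continuous_on UNIV g" "L2_dist u g < e / 2"
    using L2_continuous_dense[OF u, of "e/2"] e by auto
  have g': "continuous_on {0..1} g" by (rule continuous_on_subset[OF g(1)]) auto
  obtain p where p: "\<And>x. x \<in> {0..1} \<Longrightarrow> \<bar>g x - poly p x\<bar> < e / 2"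
    using continuous_poly_approx[OF g', of "e/2"] e by auto
  have gl: "g \<in> L2" using g' by (rule L2_continuous)
  have "L2_dist g (poly p) \<le> e / 2"
    using p by (intro L2_norm_le_bound L2_diff gl) (auto simp: less_imp_le)
  then have "L2_dist u (poly p) < e"
    using L2_norm_triangle_diff[OF u gl L2_poly[of p]] g(2) by simp
  then show thesis using that by blast
qed

section \<open>Smooth bumps supported inside the unit interval\<close>

definition bump_quad :: "real \<Rightarrow> real poly" where
  "bump_quad d = [:- d, 1:] * [:1 - d, - 1:]"

text \<open>The parameters \<open>j\<close> and \<open>p\<close> make the family closed under
  differentiation. Smoothness of all orders, which \<open>test_functions\<close> demands through
  \<open>deriv ^^ n\<close>, thus reduces to a single derivative formula.\<close>

definition bump :: "real \<Rightarrow> real \<Rightarrow> nat \<Rightarrow> real poly \<Rightarrow> real \<Rightarrow> real" where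
  "bump d c j p x = (if poly (bump_quad d) x > 0
     then poly p x * inverse (poly (bump_quad d) x) ^ j * exp (- c / poly (bump_quad d) x) else 0)"

lemma poly_bump_quad: "poly (bump_quad d) x = (x - d) * (1 - d - x)"
  by (simp add: bump_quad_def algebra_simps)

lemma DERIV_squeeze_zero:
  fixes g r :: "real \<Rightarrow> real"
  assumes r: "(r has_field_derivative 0) (at x)" and "r x = 0" and le: "\<And>y. \<bar>g y\<bar> \<le> \<bar>r y\<bar>"
  shows "(g has_field_derivative 0) (at x)"
proof -
  have gx: "g x = 0" using le[of x] assms(2) by simp
  have "((\<lambda>h. (r (x + h) - r x) / h) \<longlongrightarrow> 0) (at 0)" using r by (simp add: DERIV_def)
  then have "((\<lambda>h. norm (r (x + h) / h)) \<longlongrightarrow> 0) (at 0)"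
    using assms(2) by (intro tendsto_norm_zero) simp
  then have "((\<lambda>h. g (x + h) / h) \<longlongrightarrow> 0) (at 0)"
    by (rule Lim_null_comparison[rotated]) (simp add: le divide_right_mono)
  then show ?thesis by (simp add: DERIV_def gx)
qed

lemma power_div_fact_le_exp:
  fixes z :: real
  assumes "z \<ge> 0"
  shows "z ^ m / fact m \<le> exp z"
proof -
  have "(\<Sum>n\<in>{m}. inverse (fact n) * z ^ n) \<le> (\<Sum>n. inverse (fact n) * z ^ n)"
    by (rule sum_le_suminf) (use assms summable_exp in auto)
  then show ?thesis by (simp add: exp_def divide_inverse mult.commute)
qed

text \<open>Keeping the term of order \<open>j + 2\<close> of the exponential series beats the pole
  of order \<open>j\<close> and leaves \<open>q\<^sup>2\<close>, a double zero at the edge of the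
  support.\<close>

lemma exp_inverse_le:
  fixes q c :: real
  assumes "q > 0" "c > 0"
  shows "inverse q ^ j * exp (- c / q) \<le> fact (j + 2) / c ^ (j + 2) * q\<^sup>2"
proof -
  let ?m = "j + 2"
  have "(c / q) ^ ?m / fact ?m \<le> exp (c / q)"
    using assms by (intro power_div_fact_le_exp) simp
  then have "inverse (exp (c / q)) \<le> inverse ((c / q) ^ ?m / fact ?m)"
    using assms by (intro le_imp_inverse_le) auto
  then have "exp (- c / q) \<le> fact ?m / (c / q) ^ ?m"
    by (simp only: exp_minus minus_divide_left[symmetric] inverse_divide)
  also have "\<dots> = fact ?m / c ^ ?m * (q ^ j * q\<^sup>2)"
    by (simp only: power_divide power_add divide_divide_eq_right times_divide_eq_left
        times_divide_eq_right mult.assoc mult.commute[of "q\<^sup>2" "q ^ j"])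
  finally have "inverse q ^ j * exp (- c / q) \<le> inverse q ^ j * (fact ?m / c ^ ?m * (q ^ j * q\<^sup>2))"
    using assms by (intro mult_left_mono) auto
  also have "\<dots> = fact ?m / c ^ ?m * q\<^sup>2 * (inverse q * q) ^ j"
    by (simp only: power_mult_distrib mult_ac)
  finally show ?thesis using assms by simp
qed

text \<open>Differentiating \<open>exp (- c / q)\<close> or \<open>inverse q ^ j\<close> costs at
  most two further powers of \<open>inverse q\<close>; the rest is a polynomial. At a zero of
  \<open>q\<close> the bump is squeezed by a multiple of \<open>p * q\<^sup>2\<close>, whose
  derivative vanishes there; where \<open>q\<close> is negative the bump is locally zero.\<close>

lemma bump_has_derivative:
  fixes d :: real
  assumes c: "c > 0"
  defines "q \<equiv> bump_quad d"
  shows "(bump d c j p has_field_derivative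
    bump d c (j + 2) (pderiv p * q ^ 2 - smult (of_nat j) (p * pderiv q * q) + smult c (p * pderiv q)) x) (at x)"
proof (cases "poly q x > 0")
  case True
  have op: "open {y. poly q y > 0}"
    by (intro open_Collect_less continuous_intros)
  have dp: "(poly r has_field_derivative poly (pderiv r) x) (at x)" for r :: "real poly"
    by (rule poly_DERIV)
  define D where "D = poly p x * inverse (poly q x) ^ j * (exp (- c / poly q x) * (c * poly (pderiv q) x / (poly q x)\<^sup>2)) +
    (poly p x * (of_nat j * (inverse (poly q x) ^ (j - 1) * (- (poly (pderiv q) x / (poly q x)\<^sup>2))))
     + poly (pderiv p) x * inverse (poly q x) ^ j) * exp (- c / poly q x)"
  have "((\<lambda>y. poly p y * inverse (poly q y) ^ j * exp (- c / poly q y)) has_field_derivative D) (at x)"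
    using True unfolding D_def
    by (auto intro!: derivative_eq_intros dp simp: power2_eq_square divide_inverse algebra_simps)
  moreover have "D = bump d c (j + 2) (pderiv p * q ^ 2 - smult (of_nat j) (p * pderiv q * q) + smult c (p * pderiv q)) x"
    using True unfolding D_def bump_def q_def[symmetric]
    by (cases j) (simp_all add: power2_eq_square field_simps)
  ultimately have "((\<lambda>y. poly p y * inverse (poly q y) ^ j * exp (- c / poly q y)) has_field_derivative
    bump d c (j + 2) (pderiv p * q ^ 2 - smult (of_nat j) (p * pderiv q * q) + smult c (p * pderiv q)) x) (at x)"
    by simp
  then show ?thesis
    by (rule has_field_derivative_transform_within_open[OF _ op])
      (use True in \<open>auto simp: bump_def q_def\<close>)
next
  case False
  then have D0: "bump d c (j + 2) r x = 0" for r by (simp add: bump_def q_def)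
  have "(bump d c j p has_field_derivative 0) (at x)"
  proof (cases "poly q x = 0")
    case True
    show ?thesis
    proof (rule DERIV_squeeze_zero)
      let ?K = "fact (j + 2) / c ^ (j + 2)"
      show "((\<lambda>y. ?K * (poly p y * (poly q y)\<^sup>2)) has_field_derivative 0) (at x)"
        using True c by (auto intro!: derivative_eq_intros poly_DERIV)
      show "?K * (poly p x * (poly q x)\<^sup>2) = 0" using True by simp
      show "\<bar>bump d c j p y\<bar> \<le> \<bar>?K * (poly p y * (poly q y)\<^sup>2)\<bar>" for y
      proof (cases "poly q y > 0")
        case True
        have "\<bar>bump d c j p y\<bar> = \<bar>poly p y\<bar> * (inverse (poly q y) ^ j * exp (- c / poly q y))"
          using True by (simp add: bump_def q_def[symmetric] abs_mult)
        also have "\<dots> \<le> \<bar>poly p y\<bar> * (?K * (poly q y)\<^sup>2)"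
          using exp_inverse_le[OF True c] by (intro mult_left_mono) auto
        also have "\<dots> = \<bar>?K * (poly p y * (poly q y)\<^sup>2)\<bar>"
          using c by (simp add: abs_mult)
        finally show ?thesis .
      qed (simp add: bump_def q_def)
    qed
  next
    case nz: False
    have op: "open {y. poly q y < 0}"
      by (intro open_Collect_less continuous_intros)
    have "((\<lambda>y. 0) has_field_derivative 0) (at x)" by simp
    then show ?thesis
      by (rule has_field_derivative_transform_within_open[OF _ op])
        (use nz False in \<open>auto simp: bump_def q_def\<close>)
  qed
  then show ?thesis using D0 by simp
qed

lemma deriv_iterate_bump:
  assumes "c > 0"
  shows "\<exists>i r. (deriv ^^ n) (bump d c j p) = bump d c i r"
proof (induction n)
  case 0
  then show ?case by auto
next
  case (Suc n)
  then obtain i r where "(deriv ^^ n) (bump d c j p) = bump d c i r" by blast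
  then show ?case using DERIV_imp_deriv[OF bump_has_derivative[OF assms]] by auto
qed

lemma smooth_bump:
  assumes "c > 0"
  shows "(deriv ^^ n) (bump d c j p) differentiable_on UNIV"
  using deriv_iterate_bump[OF assms, of n d j p] bump_has_derivative[OF assms]
  by (metis differentiable_on_def differentiable_at_withinI real_differentiable_def)

lemma continuous_bump:
  assumes "c > 0"
  shows "continuous_on S (bump d c j p)"
  using bump_has_derivative[OF assms] by (meson DERIV_isCont continuous_at_imp_continuous_on)

lemma bump_nonzeroD:
  assumes "bump d c j p x \<noteq> 0" "d < 1/2"
  shows "d < x" "x < 1 - d"
proof -
  have "(x - d) * (1 - d - x) > 0"
    using assms by (auto simp: bump_def poly_bump_quad split: if_splits)
  then show "d < x" "x < 1 - d" using assms(2) by (auto simp: zero_less_mult_iff)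
qed

lemma bump_test_function:
  assumes "c > 0" "0 < d" "d < 1/2"
  shows "bump d c j p \<in> test_functions"
proof -
  have "closure {x. bump d c j p x \<noteq> 0} \<subseteq> {d..1-d}"
    by (rule closure_minimal) (use bump_nonzeroD[OF _ assms(3)] in \<open>auto simp: less_imp_le\<close>)
  then show ?thesis using smooth_bump[OF assms(1)] assms by (force simp: test_functions_def)
qed

text \<open>The primitive that vanishes at 0 vanishes at 1 as well, because the mean is zero;
  therefore it keeps the compact support of the bump.\<close>

lemma bump_antiderivative_test_function:
  assumes c: "c > 0" and d: "0 < d" "d < 1/2" and int0: "(LINT x|M01. bump d c j p x) = 0"
  obtains \<phi> where "\<phi> \<in> test_functions" "\<And>x. (\<phi> has_field_derivative bump d c j p x) (at x)"
proof -
  let ?b = "bump d c j p"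
  have cont: "isCont ?b x" for x using bump_has_derivative[OF c] DERIV_isCont by blast
  obtain F where F: "\<And>x. (F has_vector_derivative ?b x) (at x)"
    using einterval_antiderivative[of "-\<infinity>" "\<infinity>" ?b] cont by auto
  define \<phi> where "\<phi> x = F x - F 0" for x
  have \<phi>: "(\<phi> has_field_derivative ?b x) (at x)" for x
    using F[of x] unfolding \<phi>_def by (auto intro!: derivative_eq_intros simp: has_real_derivative_iff_has_vector_derivative)
  have "(?b has_integral (\<phi> 1 - \<phi> 0)) {0..1}"
    by (rule fundamental_theorem_of_calculus)
      (use \<phi> in \<open>auto simp: has_real_derivative_iff_has_vector_derivative[symmetric] intro: has_field_derivative_at_within\<close>)
  moreover have "integral {0..1} ?b = 0"
    using lint_eq_integral(1)[OF continuous_bump[OF c]] int0 by metis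
  ultimately have \<phi>01: "\<phi> 1 = \<phi> 0" by (auto dest: integral_unique)
  have zero: "?b x = 0" if "x \<le> d \<or> x \<ge> 1 - d" for x
    using bump_nonzeroD[OF _ d(2), of c j p x] that by force
  \<comment> \<open>On each half line outside the support the primitive is constant; the left one
    contains 0 and the right one contains 1, where its value is zero.\<close>
  have out: "\<phi> x = 0" if x: "x \<in> S" and S: "S = {..d} \<or> S = {1-d..}" for x S
  proof -
    have "\<exists>k. \<forall>x\<in>S. \<phi> x = k"
    proof (rule has_field_derivative_zero_constant)
      show "convex S" using S by auto
      fix x assume "x \<in> S"
      then have "?b x = 0" using S zero by auto
      then show "(\<phi> has_field_derivative 0) (at x within S)" 
        using has_field_derivative_at_within[OF \<phi>[of x]] by simp
    qed
    moreover have "0 \<in> S \<or> 1 \<in> S" using S d by auto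
    moreover have "\<phi> 0 = 0" by (simp add: \<phi>_def)
    ultimately show ?thesis using \<phi>01 x by metis
  qed
  have "closure {x. \<phi> x \<noteq> 0} \<subseteq> {d..1-d}"
  proof (rule closure_minimal)
    show "{x. \<phi> x \<noteq> 0} \<subseteq> {d..1-d}"
    proof
      fix x assume "x \<in> {x. \<phi> x \<noteq> 0}"
      then show "x \<in> {d..1-d}" using out[of x "{..d}"] out[of x "{1-d..}"] by (metis atLeastAtMost_iff atLeast_iff atMost_iff linear mem_Collect_eq)
    qed
  qed simp
  then have supp: "closure {x. \<phi> x \<noteq> 0} \<subseteq> I01" using d by force
  have "deriv \<phi> = ?b" using DERIV_imp_deriv[OF \<phi>] by auto
  then have "(deriv ^^ n) \<phi> differentiable_on UNIV" for n
  proof (cases n)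
    case 0
    have "\<phi> differentiable (at x)" for x using \<phi> real_differentiable_def by blast
    then show ?thesis using 0 by (simp add: differentiable_at_imp_differentiable_on)
  next
    case (Suc m)
    then show ?thesis using smooth_bump[OF c] \<open>deriv \<phi> = ?b\<close> by (simp only: funpow_Suc_right o_apply)
  qed
  then have "\<phi> \<in> test_functions" using supp by (simp add: test_functions_def)
  then show thesis using that \<phi> by blast
qed

text \<open>These bumps increase to \<open>1\<close> on the open unit interval.\<close>

definition eta :: "nat \<Rightarrow> real \<Rightarrow> real" where
  "eta k = bump (1 / real (k + 3)) (1 / real (k + 3)) 0 1"

lemma bump_eq_eta: "bump (1 / real (k + 3)) (1 / real (k + 3)) 0 p x = poly p x * eta k x"
  by (simp add: bump_def eta_def)

lemma eta_bounds: "0 \<le> eta k x" "eta k x \<le> 1"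
  by (auto simp: eta_def bump_def)

text \<open>Both parameters \<open>1 / real (k + 3)\<close> tend to 0: one makes the support fill
  the interval, the other makes the exponent vanish. The shift by 3 keeps the inner endpoint below
  \<open>1/2\<close>.\<close>

lemma eta_tendsto:
  assumes "x \<in> I01"
  shows "(\<lambda>k. eta k x) \<longlonglongrightarrow> 1"
proof -
  define q where "q k = (x - 1 / real (k + 3)) * (1 - 1 / real (k + 3) - x)" for k
  have l0: "(\<lambda>k. 1 / real (k + 3)) \<longlonglongrightarrow> 0"
    by (rule LIMSEQ_ignore_initial_segment[OF lim_1_over_n])
  have q: "q \<longlonglongrightarrow> (x - 0) * (1 - 0 - x)" unfolding q_def
    by (intro tendsto_intros l0)
  have pos: "(x - 0) * (1 - 0 - x) > 0" using assms by simp
  have ev: "\<forall>\<^sub>F k in sequentially. q k > 0"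
    using order_tendstoD(1)[OF q pos] .
  have "(\<lambda>k. exp (- (1 / real (k + 3)) / q k)) \<longlonglongrightarrow> exp (- 0 / ((x - 0) * (1 - 0 - x)))"
    by (intro tendsto_intros l0 q) (use pos in \<open>metis less_irrefl\<close>)
  then have "(\<lambda>k. exp (- (1 / real (k + 3)) / q k)) \<longlonglongrightarrow> 1" by simp
  then show ?thesis
    by (rule Lim_transform_eventually)
      (use ev in \<open>eventually_elim, simp add: eta_def bump_def poly_bump_quad q_def\<close>)
qed

lemma eta_measurable: "eta k \<in> borel_measurable M01"
  unfolding eta_def by (rule continuous_measurable_M01[OF continuous_bump]) simp

section \<open>Density of the bumps and of derivatives of test functions\<close>

lemma eta_mult_tendsto:
  assumes p: "p \<in> L2"
  shows "L2_tendsto (\<lambda>k x. p x * eta k x) p"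
proof -
  have pm: "p \<in> borel_measurable M01" by (rule L2D(1)[OF p])
  have L: "(\<lambda>x. p x * eta k x) \<in> L2" for k
    using L2_mult_bounded(1)[OF p eta_measurable[of k], of 1] eta_bounds
    by (simp add: mult.commute)
  have "(\<lambda>k. L2_norm (\<lambda>x. p x * eta k x - p x)) \<longlonglongrightarrow> 0"
  proof (rule L2_norm_dominated(2)[OF _ p])
    show "(\<lambda>x. p x * eta k x - p x) \<in> borel_measurable M01" for k
      using pm eta_measurable[of k] by measurable
    show "\<bar>p x * eta k x - p x\<bar> \<le> \<bar>p x\<bar>" for k x
    proof -
      have "\<bar>p x * eta k x - p x\<bar> = \<bar>p x\<bar> * \<bar>eta k x - 1\<bar>" 
        by (simp add: abs_mult[symmetric] algebra_simps)
      also have "\<dots> \<le> \<bar>p x\<bar> * 1" using eta_bounds[of k x] by (intro mult_left_mono) auto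
      finally show ?thesis by simp
    qed
    show "AE x in M01. (\<lambda>k. p x * eta k x - p x) \<longlonglongrightarrow> 0"
    proof (rule AE_I2)
      fix x assume "x \<in> space M01"
      then have "(\<lambda>k. p x * eta k x - p x) \<longlonglongrightarrow> p x * 1 - p x"
        by (intro tendsto_intros eta_tendsto) (simp add: space_restrict_space)
      then show "(\<lambda>k. p x * eta k x - p x) \<longlonglongrightarrow> 0" by simp
    qed
  qed
  then show ?thesis using p L by (simp add: L2_tendsto_def)
qed

text \<open>The polynomial is fixed first and every large \<open>k\<close> then works, so further
  conditions on \<open>k\<close> can be imposed, as in
  \<open>test_derivatives_dense\<close>.\<close>

lemma eta_approx:
  assumes u: "u \<in> L2" and e: "e > 0"
  obtains p where "\<forall>\<^sub>F k in sequentially. L2_norm (\<lambda>x. u x - poly p x * eta k x) < e"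
proof -
  obtain p where p: "L2_dist u (poly p) < e / 2"
    using L2_poly_dense[OF u, of "e/2"] e by auto
  have T: "L2_tendsto (\<lambda>k x. poly p x * eta k x) (poly p)"
    by (rule eta_mult_tendsto) simp
  then have "\<forall>\<^sub>F k in sequentially. L2_norm (\<lambda>x. poly p x * eta k x - poly p x) < e / 2"
    using e unfolding L2_tendsto_def by (intro order_tendstoD(2)[of _ 0]) auto
  then have "\<forall>\<^sub>F k in sequentially. L2_norm (\<lambda>x. u x - poly p x * eta k x) < e"
  proof eventually_elim
    case (elim k)
    have "(\<lambda>x. poly p x * eta k x) \<in> L2" using T by (simp add: L2_tendsto_def)
    from L2_norm_triangle_diff[OF u L2_poly[of p] this] show ?case
      using elim p L2_norm_minus_commute[of "poly p" "\<lambda>x. poly p x * eta k x"] by simp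
  qed
  then show thesis using that by blast
qed

lemma test_functions_dense:
  assumes u: "u \<in> L2" and e: "e > 0"
  obtains \<phi> where "\<phi> \<in> test_functions" "\<phi> \<in> L2" "L2_dist u \<phi> < e"
proof -
  obtain p where "\<forall>\<^sub>F k in sequentially. L2_norm (\<lambda>x. u x - poly p x * eta k x) < e"
    using eta_approx[OF assms] .
  then obtain k where k: "L2_norm (\<lambda>x. u x - poly p x * eta k x) < e"
    by (auto simp: eventually_sequentially)
  let ?b = "bump (1 / real (k + 3)) (1 / real (k + 3)) 0 p"
  have "?b \<in> test_functions" by (rule bump_test_function) (auto simp: field_simps)
  moreover have "?b \<in> L2" by (rule L2_continuous[OF continuous_bump]) simp
  ultimately show thesis using that[of ?b] k unfolding bump_eq_eta by blast
qed

text \<open>A multiple of \<open>eta k\<close> is subtracted from the approximating bump to make its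
  mean zero, which makes its primitive a test function. As \<open>u\<close> has mean zero, the mean
  \<open>m\<close> to be removed is below \<open>e/3\<close>; with the mean of \<open>eta k\<close>
  above \<open>1/2\<close> the correction costs less than \<open>2 * e / 3\<close>.\<close>

lemma test_derivatives_dense:
  assumes u: "u \<in> L2" and e: "e > 0" and mean: "(LINT x|M01. u x) = 0"
  obtains \<phi> where "\<phi> \<in> test_functions" "L2_dist u (deriv \<phi>) < e"
proof -
  obtain p where p: "\<forall>\<^sub>F k in sequentially. L2_norm (\<lambda>x. u x - poly p x * eta k x) < e / 3"
    using eta_approx[OF u, of "e/3"] e by auto
  have "L2_tendsto (\<lambda>k x. 1 * eta k x) (\<lambda>x. 1)" by (rule eta_mult_tendsto) simp
  from L2_tendsto_ip[OF this L2_const[of 1]] have "(\<lambda>k. LINT x|M01. eta k x) \<longlonglongrightarrow> 1"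
    by (simp add: ip_def space_restrict_space measure_restrict_space)
  then have "\<forall>\<^sub>F k in sequentially. (LINT x|M01. eta k x) > 1/2"
    by (rule order_tendstoD) simp
  from eventually_happens[OF eventually_conj[OF p this]]
  obtain k where k: "L2_norm (\<lambda>x. u x - poly p x * eta k x) < e / 3" "(LINT x|M01. eta k x) > 1/2"
    by auto
  define m where "m = (LINT x|M01. poly p x * eta k x)"
  define I where "I = (LINT x|M01. eta k x)"
  let ?b = "bump (1 / real (k + 3)) (1 / real (k + 3)) 0 (p - [:m / I:])"
  have el: "eta k \<in> L2" unfolding eta_def by (rule L2_continuous[OF continuous_bump]) simp
  have pl: "(\<lambda>x. poly p x * eta k x) \<in> L2"
    using eta_mult_tendsto[OF L2_poly] by (simp add: L2_tendsto_def)
  have b: "?b x = poly p x * eta k x - m / I * eta k x" for x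
    unfolding bump_eq_eta by (simp add: algebra_simps)
  then have b': "?b = (\<lambda>x. poly p x * eta k x - m / I * eta k x)" by auto
  have "(LINT x|M01. ?b x) = m - m / I * I"
    unfolding b' unfolding m_def I_def using L2_integrable[OF el] L2_integrable[OF pl] by simp
  then have int0: "(LINT x|M01. ?b x) = 0" using k(2) by (simp add: I_def)
  obtain \<phi> where \<phi>: "\<phi> \<in> test_functions" "\<And>x. (\<phi> has_field_derivative ?b x) (at x)"
    by (rule bump_antiderivative_test_function[OF _ _ _ int0]) (auto simp: field_simps)
  have "\<bar>m\<bar> = \<bar>LINT x|M01. u x - poly p x * eta k x\<bar>"
    using mean L2_integrable[OF u] L2_integrable[OF pl] by (simp add: m_def)
  also have "\<dots> \<le> L2_norm (\<lambda>x. u x - poly p x * eta k x)"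
    by (rule abs_lint_le_L2_norm[OF L2_diff[OF u pl]])
  finally have "\<bar>m\<bar> < e / 3" using k by simp
  then have "\<bar>m / I\<bar> < 2 * e / 3"
  proof -
    have "\<bar>m / I\<bar> = \<bar>m\<bar> / I" using k(2) by (simp add: I_def)
    also have "\<dots> \<le> \<bar>m\<bar> / (1/2)" using k(2) by (intro divide_left_mono) (auto simp: I_def)
    also have "\<dots> < 2 * e / 3" using \<open>\<bar>m\<bar> < e / 3\<close> by simp
    finally show ?thesis .
  qed
  moreover have "L2_norm (eta k) \<le> 1" using eta_bounds[of k] by (intro L2_norm_le_bound el) auto
  ultimately have le: "L2_norm (\<lambda>x. m / I * eta k x) < 2 * e / 3"
    unfolding L2_norm_cmult using mult_left_mono[of "L2_norm (eta k)" 1 "\<bar>m / I\<bar>"] by linarith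
  have "L2_norm (\<lambda>x. (u x - poly p x * eta k x) + m / I * eta k x) < e"
    using L2_norm_triangle[OF L2_diff[OF u pl] L2_cmult[OF el, of "m / I"]] k le by simp
  moreover have "deriv \<phi> x = ?b x" for x using DERIV_imp_deriv[OF \<phi>(2)] by auto
  then have "(\<lambda>x. (u x - poly p x * eta k x) + m / I * eta k x) = (\<lambda>x. u x - deriv \<phi> x)"
    unfolding b by auto
  ultimately have "L2_dist u (deriv \<phi>) < e" by simp
  then show thesis using that \<phi> by blast
qed


section \<open>Weak derivatives\<close>

lemma L2_tendsto_ip2:
  assumes "L2_tendsto s u" "L2_tendsto t w"
  shows "(\<lambda>n. ip (s n) (t n)) \<longlonglongrightarrow> ip u w"
proof -
  have s: "s n \<in> L2" "u \<in> L2" "t n \<in> L2" "w \<in> L2" for n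
    using assms by (auto simp: L2_tendsto_def)
  have "(\<lambda>n. ip (s n) (\<lambda>x. t n x - w x)) \<longlonglongrightarrow> 0"
  proof (rule Lim_null_comparison)
    show "\<forall>\<^sub>F n in sequentially. norm (ip (s n) (\<lambda>x. t n x - w x)) \<le> L2_norm (s n) * L2_dist (t n) w"
      using ip_Cauchy_Schwarz[OF s(1) L2_diff[OF s(3,4)]] by simp
    have "(\<lambda>n. L2_dist (t n) w) \<longlonglongrightarrow> 0" using assms by (simp add: L2_tendsto_def)
    from tendsto_mult[OF L2_tendsto_norm[OF assms(1)] this]
    show "(\<lambda>n. L2_norm (s n) * L2_dist (t n) w) \<longlonglongrightarrow> 0" by simp
  qed
  from tendsto_add[OF this L2_tendsto_ip[OF assms(1) s(4)]]
  show ?thesis by (simp add: ip_diff_right s)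
qed

lemma L2_tendsto_mult_continuous:
  assumes s: "L2_tendsto s u" and c: "continuous_on {0..1} c"
  shows "L2_tendsto (\<lambda>n x. c x * s n x) (\<lambda>x. c x * u x)"
proof -
  have L: "s n \<in> L2" "u \<in> L2" for n using s by (auto simp: L2_tendsto_def)
  obtain B where B: "\<And>x. x \<in> {0..1} \<Longrightarrow> \<bar>c x\<bar> \<le> B"
    using compact_continuous_image[OF c compact_Icc] 
    by (metis bounded_iff compact_imp_bounded imageI real_norm_def)
  have "(\<lambda>n. L2_norm (\<lambda>x. c x * (s n x - u x))) \<longlonglongrightarrow> 0"
  proof (rule Lim_null_comparison)
    show "\<forall>\<^sub>F n in sequentially. norm (L2_norm (\<lambda>x. c x * (s n x - u x))) \<le> B * L2_dist (s n) u"
      using L2_mult_bounded(2)[OF L2_diff[OF L] continuous_measurable_M01[OF c], of B] B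
      by (simp add: always_eventually)
    show "(\<lambda>n. B * L2_dist (s n) u) \<longlonglongrightarrow> 0"
      using s by (auto simp: L2_tendsto_def intro: tendsto_mult_right_zero)
  qed
  then show ?thesis
    using L2_mult_continuous[OF L(1) c] L2_mult_continuous[OF L(2) c]
    by (simp add: L2_tendsto_def right_diff_distrib)
qed

lemma L2_tendstoI:
  assumes "\<And>n. s n \<in> L2" "u \<in> L2" "\<And>n. L2_dist (s n) u \<le> b n" "b \<longlonglongrightarrow> 0"
  shows "L2_tendsto s u"
  using assms unfolding L2_tendsto_def
  by (auto intro!: Lim_null_comparison[OF _ assms(4)] always_eventually)

lemma L2_tendsto_eventually:
  assumes "L2_tendsto s u" "e > 0"
  shows "\<forall>\<^sub>F n in sequentially. L2_dist (s n) u < e"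
  using assms order_tendstoD(2)[of _ 0] by (auto simp: L2_tendsto_def)

lemma L2_tendsto_const: "u \<in> L2 \<Longrightarrow> L2_tendsto (\<lambda>n. u) u"
  by (simp add: L2_tendsto_def)

text \<open>A function approximated by elements orthogonal to itself is orthogonal to itself. This
  serves both the uniqueness of weak derivatives and the completeness of the sines.\<close>

lemma AE_zero_if_approx_orthogonal:
  assumes d: "d \<in> L2"
    and approx: "\<And>e. e > 0 \<Longrightarrow> \<exists>\<phi>\<in>L2. ip d \<phi> = 0 \<and> L2_dist d \<phi> \<le> e"
  shows "AE x in M01. d x = 0"
proof -
  have "L2_norm d = 0"
  proof (rule ccontr)
    assume "L2_norm d \<noteq> 0"
    then have pos: "L2_norm d > 0" using L2_norm_nonneg[of d] by linarith
    obtain \<phi> where \<phi>: "\<phi> \<in> L2" "ip d \<phi> = 0" "L2_dist d \<phi> \<le> L2_norm d / 2"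
      using approx[of "L2_norm d / 2"] pos by auto
    have "(L2_norm d)\<^sup>2 = ip d (\<lambda>x. d x - \<phi> x)"
      using \<phi> d by (simp add: ip_diff_right ip_self)
    also have "\<dots> \<le> L2_norm d * L2_dist d \<phi>"
      using ip_Cauchy_Schwarz[OF d L2_diff[OF d \<phi>(1)]] by linarith
    also have "\<dots> \<le> L2_norm d * (L2_norm d / 2)" using \<phi>(3) pos by (intro mult_left_mono) auto
    finally show False using pos by (simp add: power2_eq_square)
  qed
  then show ?thesis using L2_norm_eq_0_iff[OF d] by simp
qed

section \<open>Integration by parts for classical derivatives\<close>

lemma lint_M01_FTC:
  assumes "\<And>x. x \<in> {0..1} \<Longrightarrow> (F has_field_derivative f x) (at x)" "continuous_on {0..1} f"
  shows "(LINT x|M01. f x) = F 1 - F 0"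
proof -
  have "(f has_integral (F 1 - F 0)) {0..1}"
    by (rule fundamental_theorem_of_calculus)
      (use assms in \<open>auto simp: has_real_derivative_iff_has_vector_derivative[symmetric] intro: has_field_derivative_at_within\<close>)
  then show ?thesis using lint_eq_integral(1)[OF assms(2)] by (auto dest: integral_unique)
qed

text \<open>The derivative is two-sided also at 0 and 1; sine sums and test functions are given on
  the whole line and satisfy this.\<close>

definition C1_deriv :: "(real \<Rightarrow> real) \<Rightarrow> (real \<Rightarrow> real) \<Rightarrow> bool" where
  "C1_deriv w w' \<longleftrightarrow> (\<forall>x\<in>{0..1}. (w has_field_derivative w' x) (at x)) \<and> continuous_on {0..1} w'"

lemma C1_derivD:
  assumes "C1_deriv w w'"
  shows "\<And>x. x \<in> {0..1} \<Longrightarrow> (w has_field_derivative w' x) (at x)"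
    "continuous_on {0..1} w" "continuous_on {0..1} w'" "w \<in> L2" "w' \<in> L2"
proof -
  show D: "\<And>x. x \<in> {0..1} \<Longrightarrow> (w has_field_derivative w' x) (at x)" and c: "continuous_on {0..1} w'"
    using assms by (auto simp: C1_deriv_def)
  then show "continuous_on {0..1} w" by (meson DERIV_isCont continuous_at_imp_continuous_on)
  then show "w \<in> L2" "w' \<in> L2" using c L2_continuous by auto
qed

lemma C1_deriv_mult:
  assumes "C1_deriv v v'" "C1_deriv w w'"
  shows "C1_deriv (\<lambda>x. v x * w x) (\<lambda>x. v x * w' x + v' x * w x)"
  unfolding C1_deriv_def
proof
  show "\<forall>x\<in>{0..1}. ((\<lambda>x. v x * w x) has_field_derivative v x * w' x + v' x * w x) (at x)"
    using DERIV_mult'[OF C1_derivD(1)[OF assms(1)] C1_derivD(1)[OF assms(2)]] by blast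
  show "continuous_on {0..1} (\<lambda>x. v x * w' x + v' x * w x)"
    by (intro continuous_intros C1_derivD[OF assms(1)] C1_derivD[OF assms(2)])
qed

lemma C1_deriv_diff:
  assumes "C1_deriv v v'" "C1_deriv w w'"
  shows "C1_deriv (\<lambda>x. v x - w x) (\<lambda>x. v' x - w' x)"
  using C1_derivD[OF assms(1)] C1_derivD[OF assms(2)]
  by (auto simp: C1_deriv_def intro!: derivative_eq_intros continuous_intros)

lemma C1_deriv_integral:
  assumes "C1_deriv w w'"
  shows "(LINT x|M01. w' x) = w 1 - w 0"
  using lint_M01_FTC C1_derivD[OF assms] by blast

lemma C1_parts:
  assumes v: "C1_deriv v v'" and w: "C1_deriv w w'" and "v 1 * w 1 = 0" "v 0 * w 0 = 0"
  shows "ip v w' = - ip v' w"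
proof -
  have "(LINT x|M01. v x * w' x + v' x * w x) = 0"
    using C1_deriv_integral[OF C1_deriv_mult[OF v w]] assms(3,4) by simp
  then show ?thesis
    using L2_mult_integrable C1_derivD[OF v] C1_derivD[OF w] by (simp add: ip_def)
qed

text \<open>Integrate the derivative from the endpoint 0. The estimate reduces approximation in
  \<open>H1\<close> to approximation of the derivative alone.\<close>

lemma C1_sup_le:
  assumes w: "C1_deriv w w'" and "w 0 = 0" and x: "x \<in> {0..1}"
  shows "\<bar>w x\<bar> \<le> L2_norm w'"
proof -
  have c: "continuous_on {0..1} w'" using C1_derivD[OF w] by blast
  then have c': "continuous_on {0..x} w'" using x by (auto intro: continuous_on_subset)
  have "(w' has_integral (w x - w 0)) {0..x}"
    by (rule fundamental_theorem_of_calculus)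
      (use x C1_derivD(1)[OF w] in \<open>auto simp: has_real_derivative_iff_has_vector_derivative[symmetric] intro: has_field_derivative_at_within\<close>)
  then have "w x = integral {0..x} w'" using assms(2) by (auto dest: integral_unique)
  then have "\<bar>w x\<bar> \<le> integral {0..x} (\<lambda>x. \<bar>w' x\<bar>)"
    using integral_norm_bound_integral[of w' "{0..x}" "\<lambda>x. \<bar>w' x\<bar>"] integrable_continuous_real[OF c']
      integrable_continuous_real[OF continuous_on_rabs[OF c']] by simp
  also have "\<dots> \<le> integral {0..1} (\<lambda>x. \<bar>w' x\<bar>)"
    by (rule integral_subset_le)
      (use x c c' in \<open>auto intro!: integrable_continuous_real continuous_intros\<close>)
  also have "\<dots> = (LINT x|M01. \<bar>w' x\<bar>)"
    by (rule lint_eq_integral(1)[symmetric]) (intro continuous_intros c)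
  also have "\<dots> \<le> L2_norm (\<lambda>x. \<bar>w' x\<bar>)"
    using abs_lint_le_L2_norm[OF L2_continuous[OF continuous_on_rabs[OF c]]] by simp
  also have "\<dots> = L2_norm w'" by (simp add: L2_norm_def)
  finally show ?thesis .
qed

section \<open>Calculus of weak derivatives\<close>

lemma test_function_facts:
  assumes "\<phi> \<in> test_functions"
  shows "C1_deriv \<phi> (deriv \<phi>)" "\<phi> 0 = 0" "\<phi> 1 = 0"
proof -
  have d: "(deriv ^^ n) \<phi> differentiable_on UNIV" for n
    using assms by (simp add: test_functions_def)
  have cl: "closure {x. \<phi> x \<noteq> 0} \<subseteq> I01"
    using assms by (simp add: test_functions_def)
  have "\<phi> differentiable (at x)" for x
    using d[of 0] by (simp add: differentiable_on_def)
  then have 1: "(\<phi> has_field_derivative deriv \<phi> x) (at x)" for x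
    by (simp add: DERIV_deriv_iff_real_differentiable)
  have "continuous_on UNIV (deriv \<phi>)"
    using d[of 1] differentiable_imp_continuous_on by simp
  then show "C1_deriv \<phi> (deriv \<phi>)" using 1 by (auto simp: C1_deriv_def intro: continuous_on_subset)
  show "\<phi> 0 = 0" "\<phi> 1 = 0"
    using cl closure_subset[of "{x. \<phi> x \<noteq> 0}"] by force+
qed

lemma test_function_L2:
  assumes "\<phi> \<in> test_functions"
  shows "\<phi> \<in> L2" "deriv \<phi> \<in> L2"
  using C1_derivD[OF test_function_facts(1)[OF assms]] by auto

lemma has_weak_deriv_ip:
  "has_weak_deriv u g \<longleftrightarrow> (\<forall>\<phi>\<in>test_functions. ip u (deriv \<phi>) = - ip g \<phi>)"
  by (simp add: has_weak_deriv_def ip_def)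

lemma has_weak_deriv_unique:
  assumes "has_weak_deriv u g" "has_weak_deriv u h" "g \<in> L2" "h \<in> L2"
  shows "AE x in M01. g x = h x"
proof -
  have d: "(\<lambda>x. g x - h x) \<in> L2" using assms by (intro L2_diff)
  have "AE x in M01. g x - h x = 0"
  proof (rule AE_zero_if_approx_orthogonal[OF d])
    fix e :: real assume "e > 0"
    then obtain \<phi> where \<phi>: "\<phi> \<in> test_functions" "\<phi> \<in> L2" "L2_norm (\<lambda>x. g x - h x - \<phi> x) < e"
      using test_functions_dense[OF d] by metis
    moreover have "ip (\<lambda>x. g x - h x) \<phi> = 0"
      using \<phi> assms by (simp add: ip_diff_left has_weak_deriv_ip)
    ultimately show "\<exists>\<phi>\<in>L2. ip (\<lambda>x. g x - h x) \<phi> = 0 \<and> L2_norm (\<lambda>x. g x - h x - \<phi> x) \<le> e"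
      by (auto intro!: bexI[of _ \<phi>])
  qed
  then show ?thesis by simp
qed

text \<open>Opens the choice inside \<open>weak_deriv\<close>: from here on any explicitly known
  weak derivative may replace the chosen one up to a null set.\<close>

lemma weak_deriv_AE:
  assumes "has_weak_deriv u g" "g \<in> L2"
  shows "weak_deriv u \<in> L2" "has_weak_deriv u (weak_deriv u)" "AE x in M01. weak_deriv u x = g x"
proof -
  have "weak_deriv u \<in> L2 \<and> has_weak_deriv u (weak_deriv u)"
    unfolding weak_deriv_def using someI[of "\<lambda>g. g \<in> L2 \<and> has_weak_deriv u g" g] assms by blast
  then show "weak_deriv u \<in> L2" "has_weak_deriv u (weak_deriv u)" by auto
  then show "AE x in M01. weak_deriv u x = g x" using has_weak_deriv_unique assms by blast
qed

lemma H1D: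
  assumes "u \<in> H1"
  shows "u \<in> L2" "weak_deriv u \<in> L2" "has_weak_deriv u (weak_deriv u)"
  using assms weak_deriv_AE by (auto simp: H1_def)

lemma H1I: "u \<in> L2 \<Longrightarrow> g \<in> L2 \<Longrightarrow> has_weak_deriv u g \<Longrightarrow> u \<in> H1"
  by (auto simp: H1_def)

lemma has_weak_deriv_cong:
  assumes "has_weak_deriv u g" "AE x in M01. u x = u' x" "AE x in M01. g x = g' x"
    "u \<in> L2" "u' \<in> L2" "g \<in> L2" "g' \<in> L2"
  shows "has_weak_deriv u' g'"
  unfolding has_weak_deriv_ip
proof
  fix \<phi> assume "\<phi> \<in> test_functions"
  then show "ip u' (deriv \<phi>) = - ip g' \<phi>"
    using assms test_function_L2[of \<phi>] ip_cong_AE[OF assms(2,4,5), of "deriv \<phi>"] ip_cong_AE[OF assms(3,6,7), of \<phi>]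
    by (simp add: has_weak_deriv_ip)
qed

lemma has_weak_deriv_diff:
  assumes "has_weak_deriv u g" "has_weak_deriv v h" "u \<in> L2" "v \<in> L2" "g \<in> L2" "h \<in> L2"
  shows "has_weak_deriv (\<lambda>x. u x - v x) (\<lambda>x. g x - h x)"
  using assms test_function_L2 by (simp add: has_weak_deriv_ip ip_diff_left)

lemma has_weak_deriv_limit:
  assumes "L2_tendsto s u" "L2_tendsto t g" "\<And>n. has_weak_deriv (s n) (t n)"
  shows "has_weak_deriv u g"
  unfolding has_weak_deriv_ip
proof
  fix \<phi> assume \<phi>: "\<phi> \<in> test_functions"
  have "(\<lambda>n. ip (s n) (deriv \<phi>)) \<longlonglongrightarrow> ip u (deriv \<phi>)"
    by (rule L2_tendsto_ip[OF assms(1) test_function_L2(2)[OF \<phi>]])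
  moreover have "(\<lambda>n. ip (s n) (deriv \<phi>)) \<longlonglongrightarrow> - ip g \<phi>"
    using tendsto_minus[OF L2_tendsto_ip[OF assms(2) test_function_L2(1)[OF \<phi>]]] assms(3) \<phi>
    by (simp add: has_weak_deriv_ip)
  ultimately show "ip u (deriv \<phi>) = - ip g \<phi>" by (rule LIMSEQ_unique)
qed

lemma C1_has_weak_deriv:
  assumes "C1_deriv w w'"
  shows "has_weak_deriv w w'"
  unfolding has_weak_deriv_ip
  using C1_parts[OF assms test_function_facts(1)] test_function_facts by simp

text \<open>The norm in the definition of \<open>H10\<close> contains the chosen weak derivative of
  \<open>u - \<phi>\<close>; uniqueness identifies it with \<open>g - deriv \<phi>\<close>, and the
  condition splits into two limits in \<open>L2\<close>.\<close>

lemma H10_approx: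
  assumes u: "u \<in> H10" and g: "has_weak_deriv u g" "g \<in> L2"
  obtains \<phi> where "\<And>n. \<phi> n \<in> test_functions" "L2_tendsto \<phi> u" "L2_tendsto (\<lambda>n. deriv (\<phi> n)) g"
proof -
  have uL: "u \<in> L2" using u by (simp add: H10_def H1_def)
  have "\<forall>n. \<exists>\<phi>\<in>test_functions. H1_norm (\<lambda>x. u x - \<phi> x) < 1 / real (Suc n)"
    using u by (auto simp: H10_def)
  then obtain \<phi> where \<phi>: "\<And>n. \<phi> n \<in> test_functions" "\<And>n. H1_norm (\<lambda>x. u x - \<phi> n x) < 1 / real (Suc n)"
    by metis
  have wd: "has_weak_deriv (\<lambda>x. u x - \<phi> n x) (\<lambda>x. g x - deriv (\<phi> n) x)" for n
    using \<phi>(1)[of n] test_function_L2 g uL test_function_facts(1) C1_has_weak_deriv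
    by (intro has_weak_deriv_diff) auto
  have l: "(\<lambda>n. 1 / real (Suc n)) \<longlonglongrightarrow> 0" by (rule LIMSEQ_Suc[OF lim_1_over_n])
  have gL: "(\<lambda>x. g x - deriv (\<phi> n) x) \<in> L2" for n using g \<phi> test_function_L2 by (intro L2_diff) auto
  have "L2_norm (weak_deriv (\<lambda>x. u x - \<phi> n x)) = L2_dist g (deriv (\<phi> n))" for n
    using weak_deriv_AE[OF wd gL] gL by (intro L2_norm_cong_AE) auto
  then have H1n: "H1_norm (\<lambda>x. u x - \<phi> n x) = sqrt ((L2_dist u (\<phi> n))\<^sup>2 + (L2_dist g (deriv (\<phi> n)))\<^sup>2)" for n
    by (simp add: H1_norm_def)
  have "L2_dist (\<phi> n) u \<le> 1 / real (Suc n)" "L2_dist (deriv (\<phi> n)) g \<le> 1 / real (Suc n)" for n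
    using \<phi>(2)[of n] H1n[of n] real_sqrt_sum_squares_ge1[of "L2_dist u (\<phi> n)" "L2_dist g (deriv (\<phi> n))"]
      real_sqrt_sum_squares_ge2[of "L2_dist g (deriv (\<phi> n))" "L2_dist u (\<phi> n)"] 
      L2_norm_minus_commute[of "\<phi> n" u] L2_norm_minus_commute[of "deriv (\<phi> n)" g]
    by linarith+
  then have "L2_tendsto \<phi> u" "L2_tendsto (\<lambda>n. deriv (\<phi> n)) g"
    using l \<phi>(1) test_function_L2 uL g(2) by (auto intro!: L2_tendstoI[where b="\<lambda>n. 1 / real (Suc n)"])
  then show thesis using that \<phi>(1) by blast
qed

lemma H10I:
  assumes u: "u \<in> L2" and g: "has_weak_deriv u g" "g \<in> L2"
    and approx: "\<And>e. e > 0 \<Longrightarrow> \<exists>\<phi>\<in>test_functions. L2_dist u \<phi> < e \<and> L2_dist g (deriv \<phi>) < e"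
  shows "u \<in> H10"
proof -
  have "\<exists>\<phi>\<in>test_functions. H1_norm (\<lambda>x. u x - \<phi> x) < e" if e: "e > 0" for e
  proof -
    obtain \<phi> where \<phi>: "\<phi> \<in> test_functions" "L2_dist u \<phi> < e / 2" "L2_dist g (deriv \<phi>) < e / 2"
      using approx[OF half_gt_zero[OF e]] by blast
    have gL: "(\<lambda>x. g x - deriv \<phi> x) \<in> L2" using g \<phi> test_function_L2 by (intro L2_diff) auto
    have "has_weak_deriv (\<lambda>x. u x - \<phi> x) (\<lambda>x. g x - deriv \<phi> x)"
      using \<phi>(1) test_function_L2 g u test_function_facts(1) C1_has_weak_deriv
      by (intro has_weak_deriv_diff) auto
    then have "L2_norm (weak_deriv (\<lambda>x. u x - \<phi> x)) = L2_dist g (deriv \<phi>)"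
      using weak_deriv_AE gL by (intro L2_norm_cong_AE) auto
    then have "H1_norm (\<lambda>x. u x - \<phi> x) = sqrt ((L2_dist u \<phi>)\<^sup>2 + (L2_dist g (deriv \<phi>))\<^sup>2)"
      by (simp add: H1_norm_def)
    also have "\<dots> \<le> L2_dist u \<phi> + L2_dist g (deriv \<phi>)"
      by (rule sqrt_sum_squares_le_sum) auto
    finally show ?thesis using \<phi> by (intro bexI[of _ \<phi>]) auto
  qed
  then show ?thesis using H1I[OF u g(2,1)] by (simp add: H10_def)
qed

text \<open>Two approximations with tolerance \<open>e/2\<close> are composed: first by a member of
  the sequence, then by a test function near that member.\<close>

lemma H10_limit:
  assumes s: "\<And>n. s n \<in> H10" "\<And>n. has_weak_deriv (s n) (t n)" 
    and lim: "L2_tendsto s u" "L2_tendsto t g"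
  shows "u \<in> H10"
proof (rule H10I)
  show u: "u \<in> L2" and g: "g \<in> L2" using lim by (auto simp: L2_tendsto_def)
  show "has_weak_deriv u g" by (rule has_weak_deriv_limit[OF lim s(2)])
  fix e :: real assume "e > 0"
  then have e: "e/2 > 0" by simp
  have "\<forall>\<^sub>F n in sequentially. L2_dist (s n) u < e/2" "\<forall>\<^sub>F n in sequentially. L2_dist (t n) g < e/2"
    using L2_tendsto_eventually lim e by blast+
  from eventually_happens[OF eventually_conj[OF this]]
  obtain n where n: "L2_dist (s n) u < e/2" "L2_dist (t n) g < e/2" by auto
  have sL: "s n \<in> L2" and tL: "t n \<in> L2" using lim by (auto simp: L2_tendsto_def)
  obtain \<phi> where \<phi>: "\<And>k. \<phi> k \<in> test_functions" "L2_tendsto \<phi> (s n)" "L2_tendsto (\<lambda>k. deriv (\<phi> k)) (t n)"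
    using H10_approx[OF s(1,2) tL] by blast
  have "\<forall>\<^sub>F k in sequentially. L2_dist (\<phi> k) (s n) < e/2" "\<forall>\<^sub>F k in sequentially. L2_dist (deriv (\<phi> k)) (t n) < e/2"
    using L2_tendsto_eventually \<phi> e by blast+
  from eventually_happens[OF eventually_conj[OF this]]
  obtain k where k: "L2_dist (\<phi> k) (s n) < e/2" "L2_dist (deriv (\<phi> k)) (t n) < e/2" by auto
  have fL: "\<phi> k \<in> L2" "deriv (\<phi> k) \<in> L2" using \<phi>(1) test_function_L2 by auto
  have "L2_dist (\<phi> k) u < e" "L2_dist (deriv (\<phi> k)) g < e"
    using L2_norm_triangle_diff[OF fL(1) sL u] L2_norm_triangle_diff[OF fL(2) tL g] n k by linarith+
  then show "\<exists>\<phi>\<in>test_functions. L2_dist u \<phi> < e \<and> L2_dist g (deriv \<phi>) < e"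
    using \<phi>(1) L2_norm_minus_commute by metis
qed

text \<open>The boundary values give \<open>w'\<close> mean zero, so derivatives of test functions
  approximate \<open>w'\<close>; \<open>C1_sup_le\<close> transfers this to \<open>w\<close>. This
  is what admits the sines as test functions of the weak form.\<close>

lemma C1_H10:
  assumes w: "C1_deriv w w'" and bc: "w 0 = 0" "w 1 = 0"
  shows "w \<in> H10"
proof (rule H10I)
  show "w \<in> L2" "w' \<in> L2" using C1_derivD[OF w] by auto
  show "has_weak_deriv w w'" by (rule C1_has_weak_deriv[OF w])
  fix e :: real assume "e > 0"
  moreover have "(LINT x|M01. w' x) = 0" using C1_deriv_integral[OF w] bc by simp
  ultimately obtain \<phi> where \<phi>: "\<phi> \<in> test_functions" "L2_dist w' (deriv \<phi>) < e"
    using test_derivatives_dense[OF \<open>w' \<in> L2\<close>] by metis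
  have d: "C1_deriv (\<lambda>x. w x - \<phi> x) (\<lambda>x. w' x - deriv \<phi> x)"
    using C1_deriv_diff[OF w test_function_facts(1)[OF \<phi>(1)]] .
  have "L2_dist w \<phi> \<le> L2_dist w' (deriv \<phi>)"
    using C1_sup_le[OF d] bc test_function_facts[OF \<phi>(1)] C1_derivD[OF d]
    by (intro L2_norm_le_bound) auto
  then show "\<exists>\<phi>\<in>test_functions. L2_dist w \<phi> < e \<and> L2_dist w' (deriv \<phi>) < e"
    using \<phi> by force
qed

text \<open>Boundary terms are absent because \<open>w\<close> is a limit of test functions. Only
  \<open>w\<close> vanishes at the ends, so the first factor may be the cosine
  \<open>des n\<close>.\<close>

lemma H1_H10_parts:
  assumes u: "u \<in> L2" "has_weak_deriv u g" "g \<in> L2"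
    and w: "w \<in> H10" "has_weak_deriv w h" "h \<in> L2"
  shows "ip u h = - ip g w"
proof -
  obtain \<phi> where \<phi>: "\<And>n. \<phi> n \<in> test_functions" "L2_tendsto \<phi> w" "L2_tendsto (\<lambda>n. deriv (\<phi> n)) h"
    using H10_approx[OF w] by blast
  have "(\<lambda>n. ip u (deriv (\<phi> n))) \<longlonglongrightarrow> ip u h"
    using L2_tendsto_ip[OF \<phi>(3) u(1)] by (simp add: ip_commute)
  moreover have "(\<lambda>n. ip u (deriv (\<phi> n))) \<longlonglongrightarrow> - ip g w"
    using tendsto_minus[OF L2_tendsto_ip[OF \<phi>(2) u(3)]] u(2) \<phi>(1)
    by (simp add: has_weak_deriv_ip ip_commute)
  ultimately show ?thesis by (rule LIMSEQ_unique)
qed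

text \<open>For a test function this is the integral of the derivative of
  \<open>c * \<phi>\<^sup>2\<close>. As \<open>c\<close> and \<open>c'\<close> are continuous on the
  closed interval, multiplication by them is continuous in \<open>L2\<close> and both sides pass to
  the limit.\<close>

lemma H10_burgers_parts:
  assumes u: "u \<in> H10" "has_weak_deriv u g" "g \<in> L2" and c: "C1_deriv c c'"
  shows "ip u (\<lambda>x. c x * g x) = - (1/2) * ip u (\<lambda>x. c' x * u x)"
proof -
  obtain \<phi> where \<phi>: "\<And>n. \<phi> n \<in> test_functions" "L2_tendsto \<phi> u" "L2_tendsto (\<lambda>n. deriv (\<phi> n)) g"
    using H10_approx[OF u] by blast
  note cc = C1_derivD[OF c]
  have eq: "ip (\<phi> n) (\<lambda>x. c x * deriv (\<phi> n) x) = - (1/2) * ip (\<phi> n) (\<lambda>x. c' x * \<phi> n x)" for n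
  proof -
    note T = test_function_facts[OF \<phi>(1)[of n]]
    have "ip (\<phi> n) (\<lambda>x. \<phi> n x * c' x + deriv (\<phi> n) x * c x) = - ip (deriv (\<phi> n)) (\<lambda>x. \<phi> n x * c x)"
      by (rule C1_parts[OF T(1) C1_deriv_mult[OF T(1) c]]) (simp_all add: T)
    moreover have "ip (deriv (\<phi> n)) (\<lambda>x. \<phi> n x * c x) = ip (\<phi> n) (\<lambda>x. c x * deriv (\<phi> n) x)"
      by (simp add: ip_def mult_ac)
    moreover have "ip (\<phi> n) (\<lambda>x. \<phi> n x * c' x + deriv (\<phi> n) x * c x) = 
      ip (\<phi> n) (\<lambda>x. c' x * \<phi> n x) + ip (\<phi> n) (\<lambda>x. c x * deriv (\<phi> n) x)"
      using ip_add_right[OF L2_mult_continuous[OF test_function_L2(1) cc(3)] L2_mult_continuous[OF test_function_L2(2) cc(2)] test_function_L2(1),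
          OF \<phi>(1)[of n] \<phi>(1)[of n] \<phi>(1)[of n]] by (simp add: mult.commute)
    ultimately show ?thesis by simp
  qed
  have "(\<lambda>n. ip (\<phi> n) (\<lambda>x. c x * deriv (\<phi> n) x)) \<longlonglongrightarrow> ip u (\<lambda>x. c x * g x)"
    by (rule L2_tendsto_ip2[OF \<phi>(2) L2_tendsto_mult_continuous[OF \<phi>(3) cc(2)]])
  moreover have "(\<lambda>n. - (1/2) * ip (\<phi> n) (\<lambda>x. c' x * \<phi> n x)) \<longlonglongrightarrow> - (1/2) * ip u (\<lambda>x. c' x * u x)"
    by (intro tendsto_mult tendsto_const L2_tendsto_ip2[OF \<phi>(2) L2_tendsto_mult_continuous[OF \<phi>(2) cc(3)]])
  ultimately show ?thesis unfolding eq by (rule LIMSEQ_unique)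
qed


section \<open>Sine series\<close>

text \<open>Indices start at 0 while frequencies start at \<open>pi\<close>: the shift keeps
  \<open>om n\<close> at least 1, so that it can be divided by and lower powers are dominated by
  higher ones.\<close>

definition om :: "nat \<Rightarrow> real" where
  "om n = real (Suc n) * pi"

definition es :: "nat \<Rightarrow> real \<Rightarrow> real" where
  "es n x = sqrt 2 * sin (om n * x)"

definition des :: "nat \<Rightarrow> real \<Rightarrow> real" where
  "des n x = sqrt 2 * om n * cos (om n * x)"

definition coef :: "(real \<Rightarrow> real) \<Rightarrow> nat \<Rightarrow> real" where
  "coef u n = ip u (es n)"

definition psum :: "nat \<Rightarrow> (nat \<Rightarrow> real) \<Rightarrow> real \<Rightarrow> real" where
  "psum N c x = (\<Sum>n<N. c n * es n x)"

definition dsum :: "nat \<Rightarrow> (nat \<Rightarrow> real) \<Rightarrow> real \<Rightarrow> real" where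
  "dsum N c x = (\<Sum>n<N. c n * des n x)"

lemma om_ge: "real (Suc n) \<le> om n"
  using mult_left_mono[of 1 pi "real (Suc n)"] pi_gt3 by (simp add: om_def)

lemma om_ge_1: "1 \<le> om n"
  using om_ge[of n] by simp

lemma om_pos [simp]: "0 < om n" "om n \<noteq> 0" "0 \<le> om n"
  using om_ge_1[of n] by linarith+

lemma sin_om [simp]: "sin (om n) = 0"
  unfolding om_def by (rule sin_npi)

lemma om_inject: "om n = om m \<longleftrightarrow> n = m"
  by (simp add: om_def)

lemma summable_inverse_om: "summable (\<lambda>n. 1 / (om n)\<^sup>2)"
proof (rule summable_comparison_test')
  have "summable (\<lambda>n. inverse (real n ^ 2))"
    by (rule inverse_power_summable) simp
  then show "summable (\<lambda>n. inverse (real (Suc n) ^ 2))" by (subst summable_Suc_iff)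
  show "norm (1 / (om n)\<^sup>2) \<le> inverse (real (Suc n) ^ 2)" for n
  proof -
    have "inverse ((om n)\<^sup>2) \<le> inverse (real (Suc n) ^ 2)"
      using om_ge[of n] by (intro le_imp_inverse_le power_mono) auto
    then show ?thesis by (simp add: divide_inverse)
  qed
qed

lemma es_DERIV: "(es n has_field_derivative des n x) (at x)"
  unfolding es_def des_def by (auto intro!: derivative_eq_intros)

lemma des_DERIV: "(des n has_field_derivative (- (om n)\<^sup>2 * es n x)) (at x)"
  unfolding es_def des_def by (auto intro!: derivative_eq_intros simp: power2_eq_square)

lemma continuous_es: "continuous_on S (es n)"
  unfolding es_def by (intro continuous_intros)

lemma continuous_des: "continuous_on S (des n)"
  unfolding des_def by (intro continuous_intros)

lemma es_L2 [simp]: "es n \<in> L2"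
  by (rule L2_continuous[OF continuous_es])

lemma des_L2 [simp]: "des n \<in> L2"
  by (rule L2_continuous[OF continuous_des])

lemma es_C1: "C1_deriv (es n) (des n)"
  using es_DERIV continuous_des by (simp add: C1_deriv_def)

lemma des_C1: "C1_deriv (des n) (\<lambda>x. - (om n)\<^sup>2 * es n x)"
  unfolding C1_deriv_def using des_DERIV by (intro conjI ballI continuous_intros continuous_es) auto

lemma es_bc [simp]: "es n 0 = 0" "es n 1 = 0"
  by (simp_all add: es_def)

lemma des_0: "des n 0 = sqrt 2 * om n"
  by (simp add: des_def)

lemma abs_des_le: "\<bar>des n x\<bar> \<le> sqrt 2 * om n"
  using mult_left_mono[of "\<bar>cos (om n * x)\<bar>" 1 "sqrt 2 * om n"] by (simp add: des_def abs_mult)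

lemma es_orthonormal: "ip (es n) (es m) = (if n = m then 1 else 0)"
proof (cases "n = m")
  case True
  have "(LINT x|M01. es n x * es n x) = (1 - sin (2 * om n * 1) / (2 * om n)) - (0 - sin (2 * om n * 0) / (2 * om n))"
  proof (rule lint_M01_FTC)
    show "((\<lambda>x. x - sin (2 * om n * x) / (2 * om n)) has_field_derivative es n x * es n x) (at x)" for x
    proof -
      have "((\<lambda>x. x - sin (2 * om n * x) / (2 * om n)) has_field_derivative 1 - cos (2 * om n * x)) (at x)"
        by (auto intro!: derivative_eq_intros)
      moreover have "1 - cos (2 * om n * x) = es n x * es n x"
        using cos_double_sin[of "om n * x"] by (simp add: es_def power2_eq_square mult_ac)
      ultimately show ?thesis by simp
    qed
  qed (intro continuous_intros continuous_es)
  then show ?thesis using True by (simp add: ip_def sin_double)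
next
  case False
  let ?a = "om n" and ?b = "om m"
  have ne: "?a - ?b \<noteq> 0" "?a + ?b \<noteq> 0" using False om_inject[of n m] om_pos(1)[of n] om_pos(1)[of m] by (auto simp del: om_pos)
  have "(LINT x|M01. es n x * es m x) = (sin ((?a - ?b) * 1) / (?a - ?b) - sin ((?a + ?b) * 1) / (?a + ?b))
      - (sin ((?a - ?b) * 0) / (?a - ?b) - sin ((?a + ?b) * 0) / (?a + ?b))"
  proof (rule lint_M01_FTC)
    show "((\<lambda>x. sin ((?a - ?b) * x) / (?a - ?b) - sin ((?a + ?b) * x) / (?a + ?b)) has_field_derivative es n x * es m x) (at x)" for x
    proof -
      have "((\<lambda>x. sin ((?a - ?b) * x) / (?a - ?b) - sin ((?a + ?b) * x) / (?a + ?b)) has_field_derivative 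
        cos ((?a - ?b) * x) - cos ((?a + ?b) * x)) (at x)"
        using ne by (auto intro!: derivative_eq_intros)
      moreover have "cos ((?a - ?b) * x) - cos ((?a + ?b) * x) = es n x * es m x"
        by (simp add: es_def cos_add cos_diff left_diff_distrib distrib_right)
      ultimately show ?thesis by simp
    qed
  qed (intro continuous_intros continuous_es)
  then show ?thesis using False by (simp add: ip_def sin_diff sin_add)
qed

text \<open>Multiplication by \<open>cos (pi x)\<close> preserves the span of the sines. So if \<open>u\<close> is orthogonal to
  all sines, then \<open>sin (pi x) u\<close> is orthogonal to all polynomials in \<open>cos (pi x)\<close>.\<close>

lemma es_cos_0: "cos (pi * x) * es 0 x = es 1 x / 2"
  using sin_double[of "pi * x"] by (simp add: es_def om_def mult.assoc)

lemma es_cos_Suc: "cos (pi * x) * es (Suc n) x = (es (Suc (Suc n)) x + es n x) / 2"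
proof -
  have "om (Suc (Suc n)) * x = om (Suc n) * x + pi * x" "om n * x = om (Suc n) * x - pi * x"
    by (simp_all add: om_def algebra_simps)
  then have "sin (om (Suc (Suc n)) * x) + sin (om n * x) = 2 * (cos (pi * x) * sin (om (Suc n) * x))"
    by (simp add: sin_add sin_diff)
  then show ?thesis by (simp add: es_def distrib_left[symmetric])
qed

lemma es_complete:
  assumes u: "u \<in> L2" and orth: "\<And>n. ip u (es n) = 0"
  shows "AE x in M01. u x = 0"
proof -
  have cu: "(\<lambda>x. cos (pi * x) ^ k * u x) \<in> L2" for k
    by (rule L2_mult_continuous[OF u]) (intro continuous_intros)
  have cos_orth: "ip (\<lambda>x. cos (pi * x) ^ k * u x) (es n) = 0" for k n
  proof (induction k arbitrary: n)
    case 0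
    then show ?case using orth by simp
  next
    case (Suc k)
    let ?w = "\<lambda>x. cos (pi * x) ^ k * u x"
    have "ip (\<lambda>x. cos (pi * x) ^ Suc k * u x) (es n) = ip ?w (\<lambda>x. cos (pi * x) * es n x)"
      by (simp add: ip_def mult_ac)
    also have "\<dots> = 0"
    proof (cases n)
      case 0
      then show ?thesis using Suc[of 1] ip_cmult_right[of ?w "1/2" "es 1"] by (simp add: es_cos_0)
    next
      case (Suc j)
      have "ip ?w (\<lambda>x. cos (pi * x) * es n x) = ip ?w (\<lambda>x. (1/2) * (es (Suc j + 1) x + es j x))"
        by (simp add: Suc es_cos_Suc)
      also have "\<dots> = 0"
        unfolding ip_cmult_right using Suc.IH by (simp add: ip_add_right cu)
      finally show ?thesis .
    qed
    finally show ?case .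
  qed
  \<comment> \<open>The factor is \<open>es 0\<close> up to \<open>sqrt 2\<close>, which links
    \<open>U\<close> to the orthogonality relations; it is positive inside the interval and can be
    divided out at the end.\<close>
  define U where "U x = sin (pi * x) * u x" for x
  have UL: "U \<in> L2" unfolding U_def by (rule L2_mult_continuous[OF u]) (intro continuous_intros)
  have U0: "ip U (\<lambda>x. cos (pi * x) ^ k) = 0" for k
  proof -
    have "sqrt 2 * ip U (\<lambda>x. cos (pi * x) ^ k) = ip (\<lambda>x. cos (pi * x) ^ k * u x) (es 0)"
      unfolding ip_def U_def by (subst integral_mult_right_zero[symmetric])
        (simp add: es_def om_def mult_ac)
    then show ?thesis using cos_orth by simp
  qed
  have pl: "(\<lambda>x. poly q (cos (pi * x))) \<in> L2" for q
    by (rule L2_continuous) (intro continuous_intros)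
  have Up: "ip U (\<lambda>x. poly q (cos (pi * x))) = 0" for q
  proof -
    have c: "(\<lambda>x. cos (pi * x) ^ i) \<in> L2" for i
      by (rule L2_continuous) (intro continuous_intros)
    show ?thesis unfolding poly_altdef
      by (subst ip_sum_right) (auto simp: ip_cmult_right U0 UL c L2_cmult)
  qed
  have "AE x in M01. U x = 0"
  proof (rule AE_zero_if_approx_orthogonal[OF UL])
    fix e :: real assume e: "e > 0"
    obtain r where r: "L2_dist U (poly r) < e / 2"
      using L2_poly_dense[OF UL, of "e/2"] e by auto
    \<comment> \<open>The substitution \<open>y = cos (pi * x)\<close> is injective on the interval,
      so uniform approximation in \<open>y\<close> approximates any polynomial in \<open>x\<close>
      by polynomials in \<open>cos (pi * x)\<close>.\<close>
    have "continuous_on {-1..1} (\<lambda>y. poly r (arccos y / pi))"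
      by (intro continuous_intros continuous_on_arccos) auto
    then obtain q where q: "\<And>y. y \<in> {-1..1} \<Longrightarrow> \<bar>poly r (arccos y / pi) - poly q y\<bar> < e / 2"
      using continuous_poly_approx[of "-1" 1 _ "e/2"] e by (metis half_gt_zero)
    have "L2_norm (\<lambda>x. poly r x - poly q (cos (pi * x))) \<le> e / 2"
    proof (rule L2_norm_le_bound[OF L2_diff[OF L2_poly pl]])
      fix x :: real assume x: "x \<in> I01"
      have "arccos (cos (pi * x)) = pi * x" using x by (intro arccos_cos) auto
      then show "\<bar>poly r x - poly q (cos (pi * x))\<bar> \<le> e / 2"
        using q[of "cos (pi * x)"] by simp
    qed
    then have "L2_norm (\<lambda>x. U x - poly q (cos (pi * x))) \<le> e"
      using L2_norm_triangle_diff[OF UL L2_poly[of r] pl[of q]] r by linarith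
    then show "\<exists>\<phi>\<in>L2. ip U \<phi> = 0 \<and> L2_dist U \<phi> \<le> e"
      using Up pl by blast
  qed
  moreover have "AE x in M01. x \<in> I01" by (rule AE_I2) (simp add: space_restrict_space)
  ultimately show ?thesis
  proof eventually_elim
    case (elim x)
    then have "sin (pi * x) > 0" by (intro sin_gt_zero) auto
    then show ?case using elim by (simp add: U_def)
  qed
qed

section \<open>Partial sums, Riesz-Fischer and Parseval\<close>

lemma psum_L2 [simp]: "psum N c \<in> L2"
  unfolding psum_def by (intro L2_sum L2_cmult es_L2)

lemma dsum_L2 [simp]: "dsum N c \<in> L2"
  unfolding dsum_def by (intro L2_sum L2_cmult des_L2)

lemma psum_C1: "C1_deriv (psum N c) (dsum N c)"
  unfolding C1_deriv_def
proof
  show "\<forall>x\<in>{0..1}. (psum N c has_field_derivative dsum N c x) (at x)"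
    unfolding psum_def dsum_def by (intro ballI DERIV_sum DERIV_cmult es_DERIV)
  show "continuous_on {0..1} (dsum N c)"
    unfolding dsum_def by (intro continuous_intros continuous_des)
qed

lemma dsum_C1: "C1_deriv (dsum N c) (psum N (\<lambda>n. - (om n)\<^sup>2 * c n))"
  unfolding C1_deriv_def
proof
  have "((\<lambda>x. \<Sum>n<N. c n * des n x) has_field_derivative (\<Sum>n<N. c n * (- (om n)\<^sup>2 * es n x))) (at x)" for x
    by (intro DERIV_sum DERIV_cmult des_DERIV)
  then show "\<forall>x\<in>{0..1}. (dsum N c has_field_derivative psum N (\<lambda>n. - (om n)\<^sup>2 * c n) x) (at x)"
    by (simp add: psum_def dsum_def[abs_def] mult_ac)
  show "continuous_on {0..1} (psum N (\<lambda>n. - (om n)\<^sup>2 * c n))"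
    unfolding psum_def by (intro continuous_intros continuous_es)
qed

lemma psum_H10: "psum N c \<in> H10"
  by (rule C1_H10[OF psum_C1]) (simp_all add: psum_def)

lemma ip_psum: "w \<in> L2 \<Longrightarrow> ip w (psum N c) = (\<Sum>n<N. c n * coef w n)"
  unfolding psum_def by (subst ip_sum_right) (auto simp: L2_cmult ip_cmult_right coef_def)

lemma coef_psum: "coef (psum N c) n = (if n < N then c n else 0)"
proof -
  have "coef (psum N c) n = (\<Sum>m<N. c m * (if n = m then 1 else 0))"
    unfolding coef_def ip_commute[of "psum N c"] by (simp add: ip_psum coef_def es_orthonormal)
  also have "\<dots> = (\<Sum>m<N. if m = n then c n else 0)" by (intro sum.cong) auto
  finally show ?thesis by simp
qed

lemma norm_psum: "(L2_norm (psum N c))\<^sup>2 = (\<Sum>n<N. (c n)\<^sup>2)"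
  unfolding ip_self[symmetric] by (subst ip_psum) (auto simp: coef_psum power2_eq_square)

lemma norm_diff_psum_coef:
  assumes "u \<in> L2"
  shows "(L2_dist u (psum N (coef u)))\<^sup>2 = (L2_norm u)\<^sup>2 - (\<Sum>n<N. (coef u n)\<^sup>2)"
proof -
  have "ip u (psum N (coef u)) = (\<Sum>n<N. (coef u n)\<^sup>2)"
    using ip_psum[OF assms] by (simp add: power2_eq_square)
  moreover have "ip (psum N (coef u)) (psum N (coef u)) = (\<Sum>n<N. (coef u n)\<^sup>2)"
    using norm_psum by (simp add: ip_self)
  ultimately show ?thesis
    unfolding ip_self[symmetric] using assms
    by (simp add: ip_diff_left ip_diff_right L2_diff ip_commute[of "psum N (coef u)" u])
qed

lemma Bessel:
  assumes "u \<in> L2"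
  shows "(\<Sum>n<N. (coef u n)\<^sup>2) \<le> (L2_norm u)\<^sup>2" "summable (\<lambda>n. (coef u n)\<^sup>2)"
proof -
  show 1: "(\<Sum>n<N. (coef u n)\<^sup>2) \<le> (L2_norm u)\<^sup>2" for N
    using norm_diff_psum_coef[OF assms, of N] zero_le_power2[of "L2_dist u (psum N (coef u))"] by linarith
  show "summable (\<lambda>n. (coef u n)\<^sup>2)"
    by (rule summableI_nonneg_bounded[OF _ 1]) simp
qed

text \<open>Orthonormality turns the squared distance of two partial sums into a block of a
  convergent series; completeness of \<open>L2\<close> supplies the limit.\<close>

lemma Riesz_Fischer:
  assumes c: "summable (\<lambda>n. (c n)\<^sup>2)"
  obtains u where "u \<in> L2" "L2_tendsto (\<lambda>N. psum N c) u" "coef u = c"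
proof -
  have diff: "(L2_dist (psum N c) (psum M c))\<^sup>2 = (\<Sum>n=M..<N. (c n)\<^sup>2)" if "M \<le> N" for M N
  proof -
    have split: "(\<Sum>n<N. f n) = (\<Sum>n<M. f n) + (\<Sum>n=M..<N. f n)" for f :: "nat \<Rightarrow> real"
      using sum.atLeastLessThan_concat[of 0 M N f] that by (simp add: lessThan_atLeast0)
    have "psum N c x - psum M c x = psum N (\<lambda>n. if n < M then 0 else c n) x" for x
      unfolding psum_def split by simp
    then have "(L2_dist (psum N c) (psum M c))\<^sup>2 = (\<Sum>n<N. (if n < M then 0 else c n)\<^sup>2)"
      by (simp add: norm_psum)
    also have "\<dots> = (\<Sum>n=M..<N. (c n)\<^sup>2)" unfolding split by simp
    finally show ?thesis .
  qed
  obtain u where u: "L2_tendsto (\<lambda>N. psum N c) u"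
  proof (rule L2_complete[of "\<lambda>N. psum N c"])
    fix e :: real assume e: "e > 0"
    then obtain N where N: "\<And>m n. m \<ge> N \<Longrightarrow> \<bar>\<Sum>k=m..<n. (c k)\<^sup>2\<bar> < e\<^sup>2"
      using c[unfolded summable_Cauchy] by (metis real_norm_def zero_less_power)
    have le: "L2_dist (psum n c) (psum m c) < e" if "m \<ge> N" "m \<le> n" for m n
      using diff[OF that(2)] N[OF that(1), of n] e by (intro power2_less_imp_less[of _ e]) auto
    have "L2_dist (psum m c) (psum n c) < e" if "m \<ge> N" "n \<ge> N" for m n
      using le[of m n] le[of n m] that L2_norm_minus_commute[of "psum m c" "psum n c"] by (cases "m \<le> n") auto
    then show "\<exists>N. \<forall>m\<ge>N. \<forall>n\<ge>N. L2_dist (psum m c) (psum n c) < e" by blast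
  qed auto
  have "coef u n = c n" for n
  proof -
    have "(\<lambda>N. coef (psum N c) n) \<longlonglongrightarrow> coef u n"
      unfolding coef_def by (rule L2_tendsto_ip[OF u es_L2])
    moreover have "(\<lambda>N. coef (psum N c) n) \<longlonglongrightarrow> c n"
      by (intro tendsto_eventually eventually_sequentiallyI[of "Suc n"]) (simp add: coef_psum)
    ultimately show ?thesis by (rule LIMSEQ_unique)
  qed
  then show thesis using that u by (auto simp: L2_tendsto_def)
qed

lemma coef_diff: "u \<in> L2 \<Longrightarrow> w \<in> L2 \<Longrightarrow> coef (\<lambda>x. u x - w x) n = coef u n - coef w n"
  by (simp add: coef_def ip_diff_left)

lemma coef_eq_imp_AE:
  assumes "u \<in> L2" "w \<in> L2" "\<And>n. coef u n = coef w n"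
  shows "AE x in M01. u x = w x"
  using es_complete[OF L2_diff[OF assms(1,2)]] assms by (simp add: ip_diff_left coef_def)

text \<open>The limit provided by Riesz-Fischer has the same coefficients as \<open>u\<close>, and
  completeness of the sines identifies the two.\<close>

lemma psum_coef_tendsto:
  assumes u: "u \<in> L2"
  shows "L2_tendsto (\<lambda>N. psum N (coef u)) u"
proof -
  obtain w where w: "w \<in> L2" "L2_tendsto (\<lambda>N. psum N (coef u)) w" "coef w = coef u"
    using Riesz_Fischer[OF Bessel(2)[OF u]] .
  have ae: "AE x in M01. w x = u x" by (rule coef_eq_imp_AE) (use u w in auto)
  have "L2_dist (psum N (coef u)) u = L2_dist (psum N (coef u)) w" for N
    using ae by (intro L2_norm_cong_AE L2_diff u w) (auto elim: eventually_mono)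
  then show ?thesis using w u by (simp add: L2_tendsto_def)
qed

lemma Parseval:
  assumes u: "u \<in> L2"
  shows "(\<lambda>n. (coef u n)\<^sup>2) sums (L2_norm u)\<^sup>2"
  using tendsto_power[OF L2_tendsto_norm[OF psum_coef_tendsto[OF u]], of 2]
  by (simp add: norm_psum sums_def)

lemma Parseval_ip:
  assumes u: "u \<in> L2" and w: "w \<in> L2"
  shows "(\<lambda>n. coef u n * coef w n) sums ip u w"
  using L2_tendsto_ip[OF psum_coef_tendsto[OF u] w] ip_psum[OF w, of _ "coef u"]
  by (simp add: sums_def ip_commute)


section \<open>Sobolev spaces in terms of sine coefficients\<close>

text \<open>For coefficients of a function in \<open>H2\<close> and \<open>H10\<close> the series
  converges uniformly; it is then the continuous representative of the weak derivative, from which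
  \<open>trace\<close> is read off.\<close>

definition dser :: "(nat \<Rightarrow> real) \<Rightarrow> real \<Rightarrow> real" where
  "dser c x = (\<Sum>n. c n * des n x)"

text \<open>The sine coefficient of \<open>u * u'\<close> with the derivative moved to the sine. In
  this form it is a quadratic expression defined on all of \<open>L2\<close>.\<close>

definition nl :: "(real \<Rightarrow> real) \<Rightarrow> nat \<Rightarrow> real" where
  "nl u n = - (1/2) * ip u (\<lambda>x. des n x * u x)"

lemma H2D:
  assumes "u \<in> H2"
  shows "u \<in> L2" "weak_deriv u \<in> L2" "has_weak_deriv u (weak_deriv u)"
    "weak_deriv (weak_deriv u) \<in> L2" "has_weak_deriv (weak_deriv u) (weak_deriv (weak_deriv u))"
  using assms H1D by (auto simp: H2_def)

text \<open>Two integrations by parts without boundary terms, for different reasons: in the first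
  the sine vanishes at the ends, in the second \<open>u\<close> does.\<close>

lemma coef_weak_deriv2:
  assumes u: "u \<in> H2" "u \<in> H10"
  shows "coef (weak_deriv (weak_deriv u)) n = - (om n)\<^sup>2 * coef u n"
proof -
  note D = H2D[OF u(1)]
  have "ip (weak_deriv u) (des n) = - ip (weak_deriv (weak_deriv u)) (es n)"
    by (rule H1_H10_parts[OF D(2,5,4) C1_H10[OF es_C1] C1_has_weak_deriv[OF es_C1] des_L2]) simp_all
  moreover have "ip (des n) (weak_deriv u) = - ip (\<lambda>x. - (om n)\<^sup>2 * es n x) u"
    by (rule H1_H10_parts[OF des_L2 C1_has_weak_deriv[OF des_C1] _ u(2) D(3,2)])
      (intro L2_cmult es_L2)
  ultimately show ?thesis
    by (simp only: coef_def ip_commute[of "des n"] ip_cmult_left ip_commute[of u])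
qed

lemma summable_om4_coef:
  assumes u: "u \<in> H2" "u \<in> H10"
  shows "summable (\<lambda>n. om n ^ 4 * (coef u n)\<^sup>2)"
  using Bessel(2)[OF H2D(4)[OF u(1)]]
  by (simp add: coef_weak_deriv2[OF u] power_mult_distrib flip: power_mult)

text \<open>The middle term avoids a cosine expansion: integration by parts turns the squared norm
  of the first derivative into \<open>- ip (weak_deriv (weak_deriv u)) u\<close>, which is a sine
  series.\<close>

lemma H2_norm_sums:
  assumes u: "u \<in> H2" "u \<in> H10"
  shows "(\<lambda>n. (1 + (om n)\<^sup>2 + om n ^ 4) * (coef u n)\<^sup>2) sums (H2_norm u)\<^sup>2"
proof -
  note D = H2D[OF u(1)]
  have "ip (weak_deriv u) (weak_deriv u) = - ip (weak_deriv (weak_deriv u)) u"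
    by (rule H1_H10_parts[OF D(2,5,4) u(2) D(3,2)])
  then have "(\<lambda>n. - (coef (weak_deriv (weak_deriv u)) n * coef u n)) sums (L2_norm (weak_deriv u))\<^sup>2"
    using sums_minus[OF Parseval_ip[OF D(4,1)]] by (simp add: ip_self)
  then have 1: "(\<lambda>n. (om n)\<^sup>2 * (coef u n)\<^sup>2) sums (L2_norm (weak_deriv u))\<^sup>2"
    by (simp add: coef_weak_deriv2[OF u] power2_eq_square mult_ac)
  have 2: "(\<lambda>n. om n ^ 4 * (coef u n)\<^sup>2) sums (L2_norm (weak_deriv (weak_deriv u)))\<^sup>2"
    using Parseval[OF D(4)] by (simp add: coef_weak_deriv2[OF u] power_mult_distrib flip: power_mult)
  have "(\<lambda>n. (coef u n)\<^sup>2 + (om n)\<^sup>2 * (coef u n)\<^sup>2 + om n ^ 4 * (coef u n)\<^sup>2) sums (H2_norm u)\<^sup>2"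
    using sums_add[OF sums_add[OF Parseval[OF D(1)] 1] 2] by (simp add: H2_norm_def)
  then show ?thesis by (simp add: distrib_right)
qed

text \<open>The inequality between a product and squares, with factors
  \<open>(om n)\<^sup>2 * \<bar>c\<bar>\<close> and \<open>1 / om n\<close>. It makes the series of
  the first derivative absolutely convergent.\<close>

lemma om_abs_le: "om n * \<bar>c\<bar> \<le> om n ^ 4 * c\<^sup>2 + 1 / (om n)\<^sup>2"
proof -
  have "om n ^ 4 * c\<^sup>2 = ((om n)\<^sup>2 * \<bar>c\<bar>)\<^sup>2" "1 / (om n)\<^sup>2 = (1 / om n)\<^sup>2"
    by (simp_all add: power_mult_distrib power_divide flip: power_mult)
  moreover have "om n * \<bar>c\<bar> = ((om n)\<^sup>2 * \<bar>c\<bar>) * (1 / om n)" by (simp add: power2_eq_square)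
  moreover have "0 \<le> ((om n)\<^sup>2 * \<bar>c\<bar>) * (1 / om n)" by simp
  ultimately show ?thesis using sum_squares_bound[of "(om n)\<^sup>2 * \<bar>c\<bar>" "1 / om n"] by linarith
qed

lemma summable_om_abs:
  assumes c: "summable (\<lambda>n. om n ^ 4 * (c n)\<^sup>2)"
  shows "summable (\<lambda>n. om n * \<bar>c n\<bar>)"
  by (rule summable_comparison_test'[OF summable_add[OF c summable_inverse_om]])
    (use om_abs_le in \<open>auto simp: abs_mult\<close>)

lemma summable_abs_of_om:
  assumes c: "summable (\<lambda>n. om n * \<bar>c n\<bar>)"
  shows "summable (\<lambda>n. \<bar>c n\<bar>)"
  by (rule summable_comparison_test'[OF c]) (use mult_right_mono[OF om_ge_1] in auto)

lemma dsum_uniform_limit: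
  assumes c: "summable (\<lambda>n. om n * \<bar>c n\<bar>)"
  shows "uniform_limit UNIV (\<lambda>N. dsum N c) (dser c) sequentially"
  unfolding dsum_def[abs_def] dser_def[abs_def]
proof (rule Weierstrass_m_test)
  show "summable (\<lambda>n. sqrt 2 * (om n * \<bar>c n\<bar>))" by (rule summable_mult[OF c])
  show "norm (c n * des n x) \<le> sqrt 2 * (om n * \<bar>c n\<bar>)" for n x
    using mult_left_mono[OF abs_des_le[of n x] abs_ge_zero[of "c n"]] by (simp add: abs_mult mult_ac)
qed

lemma psum_uniform_limit:
  assumes c: "summable (\<lambda>n. \<bar>c n\<bar>)"
  shows "uniform_limit UNIV (\<lambda>N. psum N c) (\<lambda>x. \<Sum>n. c n * es n x) sequentially"
  unfolding psum_def[abs_def]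
proof (rule Weierstrass_m_test)
  show "summable (\<lambda>n. sqrt 2 * \<bar>c n\<bar>)" by (rule summable_mult[OF c])
  show "norm (c n * es n x) \<le> sqrt 2 * \<bar>c n\<bar>" for n x
    using mult_left_mono[of "\<bar>sin (om n * x)\<bar>" 1 "sqrt 2 * \<bar>c n\<bar>"] by (simp add: es_def abs_mult mult_ac)
qed

lemma L2_tendsto_uniform_mult:
  assumes s: "\<And>n. continuous_on {0..1} (s n)" and lim: "uniform_limit UNIV s w sequentially" and g: "g \<in> L2"
  shows "continuous_on {0..1} w" "L2_tendsto (\<lambda>n x. s n x * g x) (\<lambda>x. w x * g x)"
proof -
  have "uniform_limit {0..1} s w sequentially" using lim by (rule uniform_limit_on_subset) auto
  then show w: "continuous_on {0..1} w"
    by (rule uniform_limit_theorem[rotated]) (use s in \<open>auto intro: always_eventually\<close>)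
  have "(\<lambda>n. L2_norm (\<lambda>x. s n x * g x - w x * g x)) \<longlonglongrightarrow> 0"
  proof (rule LIMSEQ_I)
    fix e :: real assume e: "e > 0"
    define d where "d = e / (L2_norm g + 1)"
    have g1: "L2_norm g + 1 > 0" using L2_norm_nonneg[of g] by linarith
    have d: "d > 0" using e g1 by (simp add: d_def)
    from uniform_limitD[OF lim d] obtain N where N: "\<And>n x. n \<ge> N \<Longrightarrow> \<bar>s n x - w x\<bar> < d"
      by (auto simp: eventually_sequentially dist_real_def)
    have "L2_norm (\<lambda>x. s n x * g x - w x * g x) < e" if "n \<ge> N" for n
    proof -
      have "L2_norm (\<lambda>x. (s n x - w x) * g x) \<le> d * L2_norm g"
        by (rule L2_mult_bounded(2)[OF g continuous_measurable_M01])
          (use s w N[OF that] in \<open>auto intro!: continuous_intros simp: less_imp_le\<close>)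
      also have "\<dots> < d * (L2_norm g + 1)" using d by simp
      also have "\<dots> = e" using g1 by (simp add: d_def)
      finally show ?thesis by (simp add: left_diff_distrib)
    qed
    then show "\<exists>no. \<forall>n\<ge>no. norm (L2_norm (\<lambda>x. s n x * g x - w x * g x) - 0) < e" by auto
  qed
  then show "L2_tendsto (\<lambda>n x. s n x * g x) (\<lambda>x. w x * g x)"
    using L2_mult_continuous[OF g s] L2_mult_continuous[OF g w] by (simp add: L2_tendsto_def)
qed

lemma continuous_psum: "continuous_on S (psum N c)"
  unfolding psum_def by (intro continuous_intros continuous_es)

lemma continuous_dsum: "continuous_on S (dsum N c)"
  unfolding dsum_def by (intro continuous_intros continuous_des)

lemma
  assumes c: "summable (\<lambda>n. om n * \<bar>c n\<bar>)"
  shows continuous_dser: "continuous_on {0..1} (dser c)"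
    and dsum_tendsto: "L2_tendsto (\<lambda>N. dsum N c) (dser c)"
  using L2_tendsto_uniform_mult[OF continuous_dsum dsum_uniform_limit[OF c] L2_const[of 1]] by auto

text \<open>Partial sums and their first two derivatives converge in \<open>L2\<close>, and weak
  derivatives and \<open>H10\<close> are stable under such limits. With
  \<open>summable_om4_coef\<close> this characterises the space by coefficients.\<close>

lemma H2_H10I:
  assumes u: "u \<in> L2" and c: "summable (\<lambda>n. om n ^ 4 * (coef u n)\<^sup>2)"
  shows "u \<in> H2" "u \<in> H10"
proof -
  let ?W = "dser (coef u)"
  note oc = summable_om_abs[OF c]
  have W: "?W \<in> L2" by (rule L2_continuous[OF continuous_dser[OF oc]])
  have lim0: "L2_tendsto (\<lambda>N. psum N (coef u)) u" by (rule psum_coef_tendsto[OF u])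
  have lim1: "L2_tendsto (\<lambda>N. dsum N (coef u)) ?W" by (rule dsum_tendsto[OF oc])
  have "summable (\<lambda>n. (- (om n)\<^sup>2 * coef u n)\<^sup>2)"
    using c by (simp add: power_mult_distrib flip: power_mult)
  then obtain u2 where u2: "u2 \<in> L2" "L2_tendsto (\<lambda>N. psum N (\<lambda>n. - (om n)\<^sup>2 * coef u n)) u2"
    by (rule Riesz_Fischer)
  have wd1: "has_weak_deriv u ?W"
    by (rule has_weak_deriv_limit[OF lim0 lim1]) (rule C1_has_weak_deriv[OF psum_C1])
  have wd2: "has_weak_deriv ?W u2"
    by (rule has_weak_deriv_limit[OF lim1 u2(2)]) (rule C1_has_weak_deriv[OF dsum_C1])
  show "u \<in> H10"
    by (rule H10_limit[OF psum_H10 _ lim0 lim1]) (rule C1_has_weak_deriv[OF psum_C1])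
  note V = weak_deriv_AE[OF wd1 W]
  have "has_weak_deriv (weak_deriv u) u2"
    by (rule has_weak_deriv_cong[OF wd2]) (use V u2 W in \<open>auto elim: eventually_mono\<close>)
  then have "weak_deriv u \<in> H1" using H1I V u2 by blast
  moreover have "u \<in> H1" using H1I u W wd1 by blast
  ultimately show "u \<in> H2" by (simp add: H2_def)
qed

lemma weak_deriv_AE_dser:
  assumes u: "u \<in> H2" "u \<in> H10"
  shows "AE x in M01. weak_deriv u x = dser (coef u) x"
proof -
  note oc = summable_om_abs[OF summable_om4_coef[OF u]]
  have W: "dser (coef u) \<in> L2" by (rule L2_continuous[OF continuous_dser[OF oc]])
  have "has_weak_deriv u (dser (coef u))"
    by (rule has_weak_deriv_limit[OF psum_coef_tendsto[OF H2D(1)[OF u(1)]] dsum_tendsto[OF oc]])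
      (rule C1_has_weak_deriv[OF psum_C1])
  then show ?thesis using weak_deriv_AE W by blast
qed

section \<open>Boundary values of weak derivatives\<close>

lemma AE_not_in_iff_null:
  assumes "N \<in> sets M"
  shows "(AE x in M. x \<notin> N) \<longleftrightarrow> N \<in> null_sets M"
proof -
  have "{x \<in> space M. \<not> x \<notin> N} = N" using sets.sets_into_space[OF assms] by auto
  then show ?thesis using AE_iff_null[of M "\<lambda>x. x \<notin> N"] assms by simp
qed

text \<open>Inside the interval the set of disagreement is open and null, hence empty; continuity
  extends the equality to the endpoints. This makes the description in \<open>trace\<close>
  unique.\<close>

lemma continuous_AE_eq_imp_eq:
  assumes f: "continuous_on {0..1::real} (f :: real \<Rightarrow> real)" and g: "continuous_on {0..1} g"
    and ae: "AE x in M01. f x = g x" and a: "a \<in> {0..1}"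
  shows "f a = g a"
proof -
  let ?h = "\<lambda>x. f x - g x"
  have h: "continuous_on {0..1} ?h" by (intro continuous_intros f g)
  have 0: "?h x = 0" if x: "x \<in> I01" for x
  proof (rule ccontr)
    assume nz: "?h x \<noteq> 0"
    have op: "open {y \<in> I01. ?h y \<noteq> 0}"
    proof -
      have "continuous_on I01 ?h" using h by (rule continuous_on_subset) auto
      then have "open (I01 \<inter> ?h -` (- {0}))"
        by (rule continuous_open_preimage) auto
      moreover have "I01 \<inter> ?h -` (- {0}) = {y \<in> I01. ?h y \<noteq> 0}" by auto
      ultimately show ?thesis by simp
    qed
    have "AE x in lebesgue. x \<in> I01 \<longrightarrow> f x = g x"
      using ae by (subst (asm) AE_restrict_space_iff) auto
    then have "AE x in lebesgue. x \<notin> {y \<in> I01. ?h y \<noteq> 0}"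
      by (rule eventually_mono) auto
    moreover have "{y \<in> I01. ?h y \<noteq> 0} \<in> sets lebesgue" using op by (simp add: borel_open)
    ultimately have "{y \<in> I01. ?h y \<noteq> 0} \<in> null_sets lebesgue"
      using AE_not_in_iff_null by blast
    then have "negligible {y \<in> I01. ?h y \<noteq> 0}" by (simp add: negligible_iff_null_sets)
    then have "{y \<in> I01. ?h y \<noteq> 0} = {}" using open_not_negligible[OF op] by blast
    then show False using x nz by blast
  qed
  have "?h a = 0"
  proof (rule continuous_constant_on_closure[of "I01" ?h 0])
    show "continuous_on (closure I01) ?h" using h by simp
  qed (use 0 a in auto)
  then show ?thesis by simp
qed

lemma trace_eq:
  assumes w: "continuous_on {0..1} w" and ae: "AE x in M01. u x = w x" and a: "a \<in> {0..1}"
  shows "trace u a = w a"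
  unfolding trace_def
proof (rule the_equality)
  show "\<exists>w'. continuous_on {0..1} w' \<and> (AE x in M01. w' x = u x) \<and> w a = w' a"
    using w ae by (intro exI[of _ w]) (auto elim: eventually_mono)
  fix c assume "\<exists>w'. continuous_on {0..1} w' \<and> (AE x in M01. w' x = u x) \<and> c = w' a"
  then obtain w' where w': "continuous_on {0..1} w'" "AE x in M01. w' x = u x" "c = w' a" by blast
  have "AE x in M01. w' x = w x" using w'(2) ae by eventually_elim simp
  then show "c = w a" using continuous_AE_eq_imp_eq[OF w'(1) w _ a] w'(3) by simp
qed

lemma trace_weak_deriv:
  assumes u: "u \<in> H2" "u \<in> H10"
  shows "(\<lambda>n. coef u n * (sqrt 2 * om n)) sums trace (weak_deriv u) 0"
proof -
  note oc = summable_om_abs[OF summable_om4_coef[OF u]]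
  have "trace (weak_deriv u) 0 = dser (coef u) 0"
    by (rule trace_eq[OF continuous_dser[OF oc] weak_deriv_AE_dser[OF u]]) simp
  moreover have "summable (\<lambda>n. coef u n * (sqrt 2 * om n))"
    by (rule summable_rabs_cancel) (use summable_mult[OF oc, of "sqrt 2"] in \<open>simp add: abs_mult mult_ac\<close>)
  ultimately show ?thesis by (simp add: dser_def des_0 summable_sums)
qed

section \<open>The terms of the equation in sine coefficients\<close>

lemma coef_es: "coef (es m) n = (if n = m then 1 else 0)"
  by (auto simp: coef_def es_orthonormal)

lemma es_H2_H10: "es m \<in> H2" "es m \<in> H10"
proof -
  have "summable (\<lambda>n. om n ^ 4 * (coef (es m) n)\<^sup>2)"
    by (rule summable_finite[of "{m}"]) (auto simp: coef_es)
  then show "es m \<in> H2" "es m \<in> H10" using H2_H10I by auto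
qed

text \<open>The difference of squares factors as \<open>(u - w) * (u + w)\<close>; Cauchy-Schwarz
  and the sup bound of \<open>des n\<close> do the rest.\<close>

lemma nl_lipschitz:
  assumes "u \<in> L2" "w \<in> L2"
  shows "\<bar>nl u n - nl w n\<bar> \<le> om n * ((L2_norm u + L2_norm w) * L2_dist u w)"
proof -
  have d: "(\<lambda>x. des n x * v x) \<in> L2" if "v \<in> L2" for v
    by (rule L2_mult_continuous[OF that continuous_des])
  have "ip u (\<lambda>x. des n x * u x) - ip w (\<lambda>x. des n x * w x) 
      = (LINT x|M01. u x * (des n x * u x) - w x * (des n x * w x))"
    unfolding ip_def using assms d by (intro Bochner_Integration.integral_diff[symmetric] L2_mult_integrable)
  also have "\<dots> = ip (\<lambda>x. u x - w x) (\<lambda>x. des n x * (u x + w x))"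
    unfolding ip_def by (simp add: algebra_simps)
  finally have eq: "nl u n - nl w n = - (1/2) * ip (\<lambda>x. u x - w x) (\<lambda>x. des n x * (u x + w x))"
    by (simp add: nl_def algebra_simps)
  have "\<bar>ip (\<lambda>x. u x - w x) (\<lambda>x. des n x * (u x + w x))\<bar> \<le> 
      L2_dist u w * L2_norm (\<lambda>x. des n x * (u x + w x))"
    using assms by (intro ip_Cauchy_Schwarz L2_diff d L2_add)
  also have "\<dots> \<le> L2_dist u w * ((sqrt 2 * om n) * (L2_norm u + L2_norm w))"
  proof (rule mult_left_mono)
    have "L2_norm (\<lambda>x. des n x * (u x + w x)) \<le> (sqrt 2 * om n) * L2_norm (\<lambda>x. u x + w x)"
      using assms abs_des_le by (intro L2_mult_bounded(2) L2_add continuous_measurable_M01 continuous_des) auto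
    also have "\<dots> \<le> (sqrt 2 * om n) * (L2_norm u + L2_norm w)"
      using assms by (intro mult_left_mono L2_norm_triangle) auto
    finally show "L2_norm (\<lambda>x. des n x * (u x + w x)) \<le> (sqrt 2 * om n) * (L2_norm u + L2_norm w)" .
  qed simp
  also have "\<dots> = sqrt 2 * (om n * ((L2_norm u + L2_norm w) * L2_dist u w))" by (simp add: mult_ac)
  \<comment> \<open>\<open>sqrt 2\<close> is rounded up to 2 so that the factor \<open>1/2\<close>
    in \<open>nl\<close> cancels it.\<close>
  also have "\<dots> \<le> 2 * (om n * ((L2_norm u + L2_norm w) * L2_dist u w))"
    by (intro mult_right_mono) (auto simp: real_sqrt_le_iff intro: real_le_lsqrt)
  finally show ?thesis unfolding eq by (simp add: abs_mult)
qed

lemma nl_bound: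
  assumes "u \<in> L2"
  shows "\<bar>nl u n\<bar> \<le> om n * (L2_norm u)\<^sup>2"
  using nl_lipschitz[OF assms L2_zero, of n] by (simp add: nl_def ip_def power2_eq_square)

text \<open>\<open>v * weak_deriv v\<close> enters as a product of two \<open>L2\<close> functions,
  so termwise integration rests on uniform convergence of the series of \<open>th\<close>. For
  partial sums the identity is \<open>H10_burgers_parts\<close> with the sine sum as
  \<open>c\<close>.\<close>

lemma burgers_expansion:
  assumes v: "v \<in> H2" "v \<in> H10" and th: "th \<in> H2" "th \<in> H10"
  shows "integrable M01 (\<lambda>x. v x * weak_deriv v x * th x)"
    "(\<lambda>n. coef th n * nl v n) sums (LINT x|M01. v x * weak_deriv v x * th x)"
proof -
  note Dv = H2D[OF v(1)] and Dth = H2D[OF th(1)]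
  note oc = summable_om_abs[OF summable_om4_coef[OF th]]
  note ac = summable_abs_of_om[OF oc]
  let ?Th = "\<lambda>x. \<Sum>n. coef th n * es n x"
  note U = L2_tendsto_uniform_mult[OF continuous_psum psum_uniform_limit[OF ac]]
  have "L2_tendsto (\<lambda>N. psum N (coef th)) ?Th" using U(2)[OF L2_const[of 1]] by simp
  from L2_tendsto_unique[OF this psum_coef_tendsto[OF Dth(1)]]
  have ae: "AE x in M01. ?Th x = th x" .
  have P: "(\<lambda>x. ?Th x * weak_deriv v x) \<in> L2" by (rule L2_mult_continuous[OF Dv(2) U(1)[OF L2_zero]])
  have Pi: "integrable M01 (\<lambda>x. v x * (?Th x * weak_deriv v x))"
    by (rule L2_mult_integrable[OF Dv(1) P])
  have ae': "AE x in M01. v x * (?Th x * weak_deriv v x) = v x * weak_deriv v x * th x"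
    using ae by eventually_elim simp
  have m: "(\<lambda>x. v x * weak_deriv v x * th x) \<in> borel_measurable M01"
    using L2D(1)[OF Dv(1)] L2D(1)[OF Dv(2)] L2D(1)[OF Dth(1)] by measurable
  show "integrable M01 (\<lambda>x. v x * weak_deriv v x * th x)"
    using integrable_cong_AE_imp[OF Pi m] ae' by (auto elim: eventually_mono)
  have "ip v (\<lambda>x. ?Th x * weak_deriv v x) = (LINT x|M01. v x * weak_deriv v x * th x)"
    unfolding ip_def using Pi m ae' by (intro integral_cong_AE) auto
  moreover have "(\<lambda>N. ip v (\<lambda>x. psum N (coef th) x * weak_deriv v x)) \<longlonglongrightarrow> ip v (\<lambda>x. ?Th x * weak_deriv v x)"
    by (rule L2_tendsto_ip2[OF L2_tendsto_const[OF Dv(1)] U(2)[OF Dv(2)]])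
  moreover have "ip v (\<lambda>x. psum N (coef th) x * weak_deriv v x) = (\<Sum>n<N. coef th n * nl v n)" for N
  proof -
    have "ip v (\<lambda>x. psum N (coef th) x * weak_deriv v x) = - (1/2) * ip v (\<lambda>x. dsum N (coef th) x * v x)"
      by (rule H10_burgers_parts[OF v(2) Dv(3,2) psum_C1])
    also have "(\<lambda>x. dsum N (coef th) x * v x) = (\<lambda>x. \<Sum>n<N. coef th n * (des n x * v x))"
      by (simp add: dsum_def sum_distrib_right mult.assoc)
    also have "ip v \<dots> = (\<Sum>n<N. coef th n * ip v (\<lambda>x. des n x * v x))"
      using Dv(1) by (subst ip_sum_right) (auto simp: ip_cmult_right intro!: L2_cmult L2_mult_continuous continuous_des)
    also have "- (1/2) * \<dots> = (\<Sum>n<N. coef th n * nl v n)"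
      by (simp add: nl_def sum_distrib_left sum_divide_distrib sum_negf mult_ac)
    finally show ?thesis .
  qed
  ultimately show "(\<lambda>n. coef th n * nl v n) sums (LINT x|M01. v x * weak_deriv v x * th x)"
    by (simp add: sums_def)
qed

definition ks_form :: "real \<Rightarrow> (real \<Rightarrow> real) \<Rightarrow> (real \<Rightarrow> real) \<Rightarrow> real" where
  "ks_form lam v th = (LINT x|M01. weak_deriv (weak_deriv v) x * weak_deriv (weak_deriv th) x
             + lam * weak_deriv (weak_deriv v) x * th x
             + v x * weak_deriv v x * th x)"

text \<open>The eigenvalue of the linear operator on the sine modes; it is negative for modes with
  \<open>(om n)\<^sup>2 < lam\<close>.\<close>

definition mu :: "real \<Rightarrow> nat \<Rightarrow> real" where
  "mu lam n = om n ^ 4 - lam * (om n)\<^sup>2"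

lemma ks_form_expansion:
  assumes v: "v \<in> H2" "v \<in> H10" and th: "th \<in> H2" "th \<in> H10"
  shows "(\<lambda>n. coef th n * (mu lam n * coef v n + nl v n)) sums ks_form lam v th"
proof -
  note Dv = H2D[OF v(1)] and Dth = H2D[OF th(1)] and B = burgers_expansion[OF v th]
  have i1: "integrable M01 (\<lambda>x. weak_deriv (weak_deriv v) x * weak_deriv (weak_deriv th) x)"
    by (rule L2_mult_integrable[OF Dv(4) Dth(4)])
  have i2: "integrable M01 (\<lambda>x. lam * weak_deriv (weak_deriv v) x * th x)"
    unfolding mult.assoc by (intro integrable_mult_right L2_mult_integrable[OF Dv(4) Dth(1)])
  have "ks_form lam v th = ip (weak_deriv (weak_deriv v)) (weak_deriv (weak_deriv th))
      + lam * ip (weak_deriv (weak_deriv v)) th + (LINT x|M01. v x * weak_deriv v x * th x)"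
    unfolding ks_form_def ip_def using i1 i2 B(1) by (simp add: mult.assoc)
  moreover have "(\<lambda>n. coef (weak_deriv (weak_deriv v)) n * coef (weak_deriv (weak_deriv th)) n
      + lam * (coef (weak_deriv (weak_deriv v)) n * coef th n) + coef th n * nl v n) sums \<dots>"
    by (intro sums_add sums_mult B(2) Parseval_ip Dv Dth)
  moreover have "coef (weak_deriv (weak_deriv v)) n * coef (weak_deriv (weak_deriv th)) n
      + lam * (coef (weak_deriv (weak_deriv v)) n * coef th n) + coef th n * nl v n
    = coef th n * (mu lam n * coef v n + nl v n)" for n
    unfolding coef_weak_deriv2[OF v] coef_weak_deriv2[OF th] mu_def
    by (simp add: algebra_simps power2_eq_square power4_eq_xxxx)
  ultimately show ?thesis by simp
qed

lemma ks_form_es: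
  assumes v: "v \<in> H2" "v \<in> H10"
  shows "ks_form lam v (es m) = mu lam m * coef v m + nl v m"
proof -
  have "(\<lambda>n. coef (es m) n * (mu lam n * coef v n + nl v n)) = 
      (\<lambda>n. if n = m then mu lam n * coef v n + nl v n else 0)" by (auto simp: coef_es)
  then show ?thesis
    using ks_form_expansion[OF v es_H2_H10(1,2)[of m], where lam=lam] sums_single[of m "\<lambda>n. mu lam n * coef v n + nl v n"]
    by (simp add: sums_unique2)
qed

lemma trace_weak_deriv_es: "trace (weak_deriv (es m)) 0 = sqrt 2 * om m"
proof -
  have "(\<lambda>n. coef (es m) n * (sqrt 2 * om n)) = (\<lambda>n. if n = m then sqrt 2 * om n else 0)" by (auto simp: coef_es)
  then show ?thesis
    using trace_weak_deriv[OF es_H2_H10(1,2)[of m]] sums_single[of m "\<lambda>n. sqrt 2 * om n"]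
    by (simp add: sums_unique2)
qed


section \<open>Curves of sine coefficients and the Duhamel formula\<close>

definition synth :: "(nat \<Rightarrow> real) \<Rightarrow> real \<Rightarrow> real" where
  "synth c = (SOME u. u \<in> L2 \<and> coef u = c)"

lemma synth:
  assumes "summable (\<lambda>n. (c n)\<^sup>2)"
  shows "synth c \<in> L2" "coef (synth c) = c"
proof -
  obtain u where "u \<in> L2 \<and> coef u = c" using Riesz_Fischer[OF assms] by metis
  then have "synth c \<in> L2 \<and> coef (synth c) = c"
    unfolding synth_def by (rule someI[of "\<lambda>u. u \<in> L2 \<and> coef u = c" u])
  then show "synth c \<in> L2" "coef (synth c) = c" by auto
qed

lemma L2_norm_mono_coef:
  assumes u: "u \<in> L2" and w: "w \<in> L2" and A: "A \<ge> 0" and le: "\<And>n. \<bar>coef u n\<bar> \<le> A * \<bar>coef w n\<bar>"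
  shows "L2_norm u \<le> A * L2_norm w"
proof -
  have "(coef u n)\<^sup>2 \<le> A\<^sup>2 * (coef w n)\<^sup>2" for n
    using power_mono[OF le, of n 2] by (simp add: power_mult_distrib)
  then have "(L2_norm u)\<^sup>2 \<le> A\<^sup>2 * (L2_norm w)\<^sup>2"
    by (rule sums_le[OF _ Parseval[OF u] sums_mult[OF Parseval[OF w]]])
  then have "(L2_norm u)\<^sup>2 \<le> (A * L2_norm w)\<^sup>2" by (simp add: power_mult_distrib)
  then show ?thesis using A by (intro power2_le_imp_le[of "L2_norm u"]) auto
qed

text \<open>The \<open>L2\<close> norm of the function with coefficients
  \<open>1 / (om n)\<^sup>2\<close>, hence the price of passing from a weighted sup bound on
  coefficients to the norm.\<close>

definition om_const :: real where
  "om_const = sqrt (\<Sum>n. (1 / (om n)\<^sup>2)\<^sup>2)"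

lemma summable_inverse_om4: "summable (\<lambda>n. (1 / (om n)\<^sup>2)\<^sup>2)"
proof (rule summable_comparison_test'[OF summable_inverse_om])
  fix n
  have "1 / (om n)\<^sup>2 \<le> 1" using power_mono[OF om_ge_1[of n], of 2] by simp
  then have "1 / (om n)\<^sup>2 * (1 / (om n)\<^sup>2) \<le> 1 * (1 / (om n)\<^sup>2)" by (intro mult_right_mono) auto
  then show "norm ((1 / (om n)\<^sup>2)\<^sup>2) \<le> 1 / (om n)\<^sup>2" by (simp add: power2_eq_square)
qed

lemma om_const_nonneg: "om_const \<ge> 0"
  unfolding om_const_def by (intro real_sqrt_ge_zero suminf_nonneg summable_inverse_om4) simp

lemma L2_norm_le_om_const:
  assumes u: "u \<in> L2" and A: "A \<ge> 0" and le: "\<And>n. \<bar>coef u n\<bar> \<le> A / (om n)\<^sup>2"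
  shows "L2_norm u \<le> A * om_const"
proof -
  obtain w where w: "w \<in> L2" "coef w = (\<lambda>n. 1 / (om n)\<^sup>2)"
    using Riesz_Fischer[OF summable_inverse_om4] by metis
  have "om_const = sqrt ((L2_norm w)\<^sup>2)"
    unfolding om_const_def using sums_unique[OF Parseval[OF w(1)]] w(2) by simp
  then have "L2_norm w = om_const" by simp
  then show ?thesis using L2_norm_mono_coef[OF u w(1) A] le w(2) by simp
qed

text \<open>A majorant independent of time makes the Parseval series of the distance converge
  uniformly, so continuity of each coefficient suffices.\<close>

lemma C0_L2I_coef:
  assumes v: "\<And>t. t \<in> {0..T} \<Longrightarrow> v t \<in> L2"
    and bound: "\<And>t n. t \<in> {0..T} \<Longrightarrow> \<bar>coef (v t) n\<bar> \<le> B n" and B: "summable (\<lambda>n. (B n)\<^sup>2)"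
    and cont: "\<And>n. continuous_on {0..T} (\<lambda>t. coef (v t) n)"
  shows "v \<in> C0_L2 T"
  unfolding C0_L2_def
proof (intro CollectI conjI ballI)
  fix t0 assume t0: "t0 \<in> {0..T}"
  show "v t0 \<in> L2" using v[OF t0] .
  let ?f = "\<lambda>s. \<Sum>n. (coef (v s) n - coef (v t0) n)\<^sup>2"
  have "uniform_limit {0..T} (\<lambda>N s. \<Sum>n<N. (coef (v s) n - coef (v t0) n)\<^sup>2) ?f sequentially"
  proof (rule Weierstrass_m_test)
    show "summable (\<lambda>n. 4 * (B n)\<^sup>2)" by (rule summable_mult[OF B])
    fix n s assume s: "s \<in> {0..T}"
    have "\<bar>coef (v s) n - coef (v t0) n\<bar> \<le> 2 * B n" using bound[OF s, of n] bound[OF t0, of n] by linarith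
    from power_mono[OF this, of 2] show "norm ((coef (v s) n - coef (v t0) n)\<^sup>2) \<le> 4 * (B n)\<^sup>2"
      by (simp add: power_mult_distrib)
  qed
  then have "continuous_on {0..T} ?f"
    by (rule uniform_limit_theorem[rotated]) (auto intro!: always_eventually continuous_intros cont)
  then have "continuous_on {0..T} (\<lambda>s. sqrt (?f s))" by (rule continuous_on_real_sqrt)
  moreover have "L2_dist (v s) (v t0) = sqrt (?f s)" if s: "s \<in> {0..T}" for s
  proof -
    have "(\<lambda>n. (coef (v s) n - coef (v t0) n)\<^sup>2) sums (L2_dist (v s) (v t0))\<^sup>2"
      using Parseval[OF L2_diff[OF v[OF s] v[OF t0]]] v s t0 by (simp add: coef_diff)
    then show ?thesis by (simp add: sums_iff)
  qed
  ultimately have "continuous_on {0..T} (\<lambda>s. L2_dist (v s) (v t0))"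
    using continuous_on_eq[of "{0..T}" "\<lambda>s. sqrt (?f s)" "\<lambda>s. L2_dist (v s) (v t0)"] by metis
  then have "((\<lambda>s. L2_dist (v s) (v t0)) \<longlongrightarrow> L2_dist (v t0) (v t0)) (at t0 within {0..T})"
    using t0 unfolding continuous_on_def by blast
  then show "((\<lambda>s. L2_dist (v s) (v t0)) \<longlongrightarrow> 0) (at t0 within {0..T})" by simp
qed

section \<open>Continuity in time of functionals along a curve\<close>

lemma C0_L2D:
  assumes "v \<in> C0_L2 T" "t \<in> {0..T}"
  shows "v t \<in> L2" "((\<lambda>s. L2_dist (v s) (v t)) \<longlongrightarrow> 0) (at t within {0..T})"
  using assms by (auto simp: C0_L2_def)

lemma C0_L2_continuous_norm:
  assumes v: "v \<in> C0_L2 T"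
  shows "continuous_on {0..T} (\<lambda>t. L2_norm (v t))"
  unfolding continuous_on_def
proof
  fix t assume t: "t \<in> {0..T}"
  have "((\<lambda>s. L2_norm (v s) - L2_norm (v t)) \<longlongrightarrow> 0) (at t within {0..T})"
  proof (rule Lim_null_comparison[OF _ C0_L2D(2)[OF v t]])
    show "\<forall>\<^sub>F s in at t within {0..T}. norm (L2_norm (v s) - L2_norm (v t)) \<le> L2_dist (v s) (v t)"
      unfolding eventually_at_filter using L2_norm_diff_ineq C0_L2D(1)[OF v] t by (auto intro!: always_eventually)
  qed
  then show "((\<lambda>s. L2_norm (v s)) \<longlongrightarrow> L2_norm (v t)) (at t within {0..T})" by (simp add: LIM_zero_iff)
qed

text \<open>The factor \<open>1 + L2_norm u + L2_norm w\<close> covers linear functionals and the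
  quadratic \<open>nl\<close> at once.\<close>

lemma C0_L2_continuous_lipschitz:
  assumes v: "v \<in> C0_L2 T"
    and lip: "\<And>u w. u \<in> L2 \<Longrightarrow> w \<in> L2 \<Longrightarrow> \<bar>f u - f w\<bar> \<le> C * ((1 + L2_norm u + L2_norm w) * L2_dist u w)"
  shows "continuous_on {0..T} (\<lambda>t. f (v t))"
  unfolding continuous_on_def
proof
  fix t assume t: "t \<in> {0..T}"
  have n: "((\<lambda>s. L2_norm (v s)) \<longlongrightarrow> L2_norm (v t)) (at t within {0..T})"
    using C0_L2_continuous_norm[OF v] t by (simp add: continuous_on_def)
  have "((\<lambda>s. f (v s) - f (v t)) \<longlongrightarrow> 0) (at t within {0..T})"
  proof (rule Lim_null_comparison)
    show "\<forall>\<^sub>F s in at t within {0..T}. norm (f (v s) - f (v t)) \<le> C * ((1 + L2_norm (v s) + L2_norm (v t)) * L2_dist (v s) (v t))"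
      unfolding eventually_at_filter using lip C0_L2D(1)[OF v] t by (auto intro!: always_eventually)
    have "((\<lambda>s. C * ((1 + L2_norm (v s) + L2_norm (v t)) * L2_dist (v s) (v t))) \<longlongrightarrow>
        C * ((1 + L2_norm (v t) + L2_norm (v t)) * 0)) (at t within {0..T})"
      by (intro tendsto_intros n C0_L2D(2)[OF v t])
    then show "((\<lambda>s. C * ((1 + L2_norm (v s) + L2_norm (v t)) * L2_dist (v s) (v t))) \<longlongrightarrow> 0) (at t within {0..T})"
      by simp
  qed
  then show "((\<lambda>s. f (v s)) \<longlongrightarrow> f (v t)) (at t within {0..T})" by (simp add: LIM_zero_iff)
qed

lemma C0_L2_bounded:
  assumes v: "v \<in> C0_L2 T"
  obtains B where "B \<ge> 0" "\<And>t. t \<in> {0..T} \<Longrightarrow> L2_norm (v t) \<le> B"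
proof -
  have "bounded ((\<lambda>t. L2_norm (v t)) ` {0..T})"
    by (intro compact_imp_bounded compact_continuous_image C0_L2_continuous_norm[OF v] compact_Icc)
  then obtain B where "\<And>t. t \<in> {0..T} \<Longrightarrow> L2_norm (v t) \<le> B"
    unfolding bounded_iff by (metis abs_le_D1 imageI real_norm_def)
  then show thesis using that[of "max 0 B"] by force
qed

lemma coef_abs_le: "u \<in> L2 \<Longrightarrow> \<bar>coef u n\<bar> \<le> L2_norm u"
proof -
  assume u: "u \<in> L2"
  have "L2_norm (es n) = 1"
    using es_orthonormal[of n n] L2_norm_nonneg[of "es n"] by (simp add: ip_self power2_eq_1_iff)
  then show ?thesis using ip_Cauchy_Schwarz[OF u es_L2[of n]] by (simp add: coef_def)
qed

lemma C0_L2_diff: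
  assumes v: "v \<in> C0_L2 T" and w: "w \<in> C0_L2 T"
  shows "(\<lambda>t x. v t x - w t x) \<in> C0_L2 T"
  unfolding C0_L2_def
proof (intro CollectI conjI ballI)
  fix t assume t: "t \<in> {0..T}"
  show "(\<lambda>x. v t x - w t x) \<in> L2" using C0_L2D(1)[OF v t] C0_L2D(1)[OF w t] by (rule L2_diff)
  show "((\<lambda>s. L2_norm (\<lambda>x. v s x - w s x - (v t x - w t x))) \<longlongrightarrow> 0) (at t within {0..T})"
  proof (rule Lim_null_comparison)
    show "((\<lambda>s. L2_dist (v s) (v t) + L2_dist (w s) (w t)) \<longlongrightarrow> 0) (at t within {0..T})"
      using tendsto_add[OF C0_L2D(2)[OF v t] C0_L2D(2)[OF w t]] by simp
    have "L2_norm (\<lambda>x. v s x - w s x - (v t x - w t x)) \<le> L2_dist (v s) (v t) + L2_dist (w s) (w t)"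
      if s: "s \<in> {0..T}" for s
    proof -
      have "(\<lambda>x. v s x - w s x - (v t x - w t x)) = (\<lambda>x. (v s x - v t x) + - (w s x - w t x))" by auto
      then show ?thesis
        using L2_norm_triangle[OF L2_diff[OF C0_L2D(1)[OF v s] C0_L2D(1)[OF v t]] L2_minus[OF L2_diff[OF C0_L2D(1)[OF w s] C0_L2D(1)[OF w t]]]]
          L2_norm_minus[of "\<lambda>x. w s x - w t x"] by simp
    qed
    then show "\<forall>\<^sub>F s in at t within {0..T}. norm (L2_norm (\<lambda>x. v s x - w s x - (v t x - w t x)))
       \<le> L2_dist (v s) (v t) + L2_dist (w s) (w t)"
      unfolding eventually_at_filter by (auto intro!: always_eventually)
  qed
qed

section \<open>Variation of constants for a single mode\<close>

definition duh :: "real \<Rightarrow> real \<Rightarrow> (real \<Rightarrow> real) \<Rightarrow> real \<Rightarrow> real" where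
  "duh m c0 g t = exp (- m * t) * (c0 - integral {0..t} (\<lambda>s. exp (m * s) * g s))"

lemma duh_has_derivative:
  assumes g: "continuous_on {0..T} g" and t: "t \<in> {0..T}"
  shows "(duh m c0 g has_field_derivative (- m * duh m c0 g t - g t)) (at t within {0..T})"
proof -
  have c: "continuous_on {0..T} (\<lambda>s. exp (m * s) * g s)" by (intro continuous_intros g)
  have "(duh m c0 g has_field_derivative
      exp (- m * t) * (- (exp (m * t) * g t)) + - m * exp (- m * t) * (c0 - integral {0..t} (\<lambda>s. exp (m * s) * g s))) (at t within {0..T})"
    unfolding duh_def[abs_def]
    by (rule derivative_eq_intros integral_has_real_derivative[OF c t] refl)+ simp
  moreover have "exp (- m * t) * (- (exp (m * t) * g t)) = - g t"
    by (simp add: exp_minus)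
  moreover have "- g t + - m * exp (- m * t) * (c0 - integral {0..t} (\<lambda>s. exp (m * s) * g s)) = - m * duh m c0 g t - g t"
    by (simp add: duh_def)
  ultimately show ?thesis by (simp only:)
qed

lemma duh_continuous:
  assumes "continuous_on {0..T} g"
  shows "continuous_on {0..T} (duh m c0 g)"
  by (rule DERIV_continuous_on[OF duh_has_derivative[OF assms]])

lemma duh_integral_eq:
  assumes g: "continuous_on {0..T} g" and t: "t \<in> {0..T}"
  shows "duh m c0 g t - c0 + integral {0..t} (\<lambda>s. m * duh m c0 g s + g s) = 0"
proof -
  have "((\<lambda>s. - m * duh m c0 g s - g s) has_integral (duh m c0 g t - duh m c0 g 0)) {0..t}"
  proof (rule fundamental_theorem_of_calculus)
    fix s assume s: "s \<in> {0..t}"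
    then have "(duh m c0 g has_field_derivative (- m * duh m c0 g s - g s)) (at s within {0..T})"
      using t by (intro duh_has_derivative[OF g]) auto
    then show "(duh m c0 g has_vector_derivative (- m * duh m c0 g s - g s)) (at s within {0..t})"
      unfolding has_real_derivative_iff_has_vector_derivative[symmetric]
      by (rule DERIV_subset) (use t in auto)
  qed (use t in auto)
  from has_integral_neg[OF this]
  have "integral {0..t} (\<lambda>s. m * duh m c0 g s + g s) = - (duh m c0 g t - duh m c0 g 0)"
    by (simp add: integral_unique add.commute)
  then show ?thesis by (simp add: duh_def)
qed

text \<open>The integral equation makes \<open>c\<close> differentiable; the integrating factor
  \<open>exp (m * s)\<close> then cancels the linear term.\<close>

lemma integral_eq_imp_duh:
  assumes g: "continuous_on {0..T} g" and c: "continuous_on {0..T} c" and t: "t \<in> {0..T}"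
    and eq: "\<And>t. t \<in> {0..T} \<Longrightarrow> c t - c0 + integral {0..t} (\<lambda>s. m * c s + g s) = 0"
  shows "c t = duh m c0 g t"
proof -
  have k: "continuous_on {0..T} (\<lambda>s. m * c s + g s)" by (intro continuous_intros g c)
  have dc: "(c has_field_derivative - (m * c s + g s)) (at s within {0..T})" if s: "s \<in> {0..T}" for s
  proof -
    have "((\<lambda>t. c0 - integral {0..t} (\<lambda>s. m * c s + g s)) has_field_derivative (0 - (m * c s + g s))) (at s within {0..T})"
      by (intro DERIV_diff DERIV_const integral_has_real_derivative[OF k s])
    then have "((\<lambda>t. c0 - integral {0..t} (\<lambda>s. m * c s + g s)) has_field_derivative - (m * c s + g s)) (at s within {0..T})"
      by simp
    then show ?thesis
      by (rule has_field_derivative_transform_within[OF _ zero_less_one s]) (use eq in force)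
  qed
  have "((\<lambda>s. - (exp (m * s) * g s)) has_integral (exp (m * t) * c t - exp (m * 0) * c 0)) {0..t}"
  proof (rule fundamental_theorem_of_calculus)
    fix s assume s: "s \<in> {0..t}"
    have "((\<lambda>s. exp (m * s) * c s) has_field_derivative - (exp (m * s) * g s)) (at s within {0..T})"
    proof -
      have "((\<lambda>s. exp (m * s) * c s) has_field_derivative exp (m * s) * (- (m * c s + g s)) + m * exp (m * s) * c s) (at s within {0..T})"
        using s t by (auto intro!: derivative_eq_intros dc)
      then show ?thesis by (simp add: algebra_simps)
    qed
    then show "((\<lambda>s. exp (m * s) * c s) has_vector_derivative - (exp (m * s) * g s)) (at s within {0..t})"
      unfolding has_real_derivative_iff_has_vector_derivative[symmetric]
      by (rule DERIV_subset) (use t in auto)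
  qed (use t in auto)
  from integral_unique[OF has_integral_neg[OF this]]
  have "integral {0..t} (\<lambda>s. exp (m * s) * g s) = c 0 - exp (m * t) * c t" by simp
  moreover have "c 0 = c0" using eq[of 0] t by simp
  ultimately have "duh m c0 g t = exp (- m * t) * (exp (m * t) * c t)" by (simp add: duh_def)
  also have "\<dots> = c t" by (simp add: mult.assoc[symmetric] mult_exp_exp)
  finally show ?thesis by simp
qed

text \<open>A forcing that grows like \<open>exp (ga * s)\<close> shifts the decay rate from
  \<open>m\<close> to \<open>m + ga\<close>. Only this sum has to be positive, which accommodates
  modes with negative \<open>m\<close>.\<close>

lemma duh_bound:
  assumes g: "continuous_on {0..T} g" and t: "t \<in> {0..T}" and le: "\<And>s. s \<in> {0..T} \<Longrightarrow> \<bar>g s\<bar> \<le> G * exp (ga * s)"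
    and G: "G \<ge> 0" and pos: "m + ga > 0"
  shows "\<bar>duh m c0 g t - exp (- m * t) * c0\<bar> \<le> G * exp (ga * t) / (m + ga)"
proof -
  let ?h = "\<lambda>s. exp (m * s) * g s"
  have cg: "continuous_on {0..t} g" using g by (rule continuous_on_subset) (use t in auto)
  have "((\<lambda>s. G * exp ((m + ga) * s)) has_integral (G / (m + ga) * exp ((m + ga) * t) - G / (m + ga) * exp ((m + ga) * 0))) {0..t}"
  proof (rule fundamental_theorem_of_calculus)
    fix s
    have "((\<lambda>s. G / (m + ga) * exp ((m + ga) * s)) has_field_derivative G * exp ((m + ga) * s)) (at s within {0..t})"
      using pos by (auto intro!: derivative_eq_intros)
    then show "((\<lambda>s. G / (m + ga) * exp ((m + ga) * s)) has_vector_derivative G * exp ((m + ga) * s)) (at s within {0..t})"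
      by (simp add: has_real_derivative_iff_has_vector_derivative)
  qed (use t in auto)
  note hi = this
  have "norm (integral {0..t} ?h) \<le> integral {0..t} (\<lambda>s. G * exp ((m + ga) * s))"
  proof (rule integral_norm_bound_integral)
    show "?h integrable_on {0..t}" by (intro integrable_continuous_real continuous_intros cg)
    show "(\<lambda>s. G * exp ((m + ga) * s)) integrable_on {0..t}" using hi by blast
    fix s assume "s \<in> {0..t}"
    then have "exp (m * s) * \<bar>g s\<bar> \<le> exp (m * s) * (G * exp (ga * s))"
      using le[of s] t by (intro mult_left_mono) auto
    also have "\<dots> = G * exp ((m + ga) * s)" by (simp add: distrib_right exp_add)
    finally show "norm (?h s) \<le> G * exp ((m + ga) * s)" by (simp add: abs_mult)
  qed
  also have "\<dots> = G / (m + ga) * exp ((m + ga) * t) - G / (m + ga)" using integral_unique[OF hi] by simp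
  also have "\<dots> \<le> G / (m + ga) * exp ((m + ga) * t)" using G pos by simp
  finally have "exp (- m * t) * \<bar>integral {0..t} ?h\<bar> \<le> exp (- m * t) * (G / (m + ga) * exp ((m + ga) * t))"
    by (intro mult_left_mono) auto
  also have "\<dots> = G / (m + ga) * (exp (- m * t) * exp ((m + ga) * t))" by simp
  also have "exp (- m * t) * exp ((m + ga) * t) = exp (ga * t)"
    by (simp add: mult_exp_exp algebra_simps)
  finally show ?thesis by (simp add: duh_def abs_mult right_diff_distrib)
qed

lemma duh_diff:
  assumes g: "continuous_on {0..T} g" and h: "continuous_on {0..T} h" and t: "t \<in> {0..T}"
  shows "duh m c0 g t - duh m c0 h t = duh m 0 (\<lambda>s. g s - h s) t"
proof -
  have i: "(\<lambda>s. exp (m * s) * f s) integrable_on {0..t}" if "continuous_on {0..T} f" for f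
    by (intro integrable_continuous_real continuous_intros continuous_on_subset[OF that]) (use t in auto)
  have "integral {0..t} (\<lambda>s. exp (m * s) * (g s - h s)) = integral {0..t} (\<lambda>s. exp (m * s) * g s) - integral {0..t} (\<lambda>s. exp (m * s) * h s)"
    unfolding right_diff_distrib by (rule Henstock_Kurzweil_Integration.integral_diff[OF i[OF g] i[OF h]])
  moreover have "duh m c0 g t - duh m c0 h t = exp (- m * t) * (0 - (integral {0..t} (\<lambda>s. exp (m * s) * g s) - integral {0..t} (\<lambda>s. exp (m * s) * h s)))"
    by (simp only: duh_def right_diff_distrib[symmetric]) simp
  ultimately show ?thesis by (simp only: duh_def)
qed


section \<open>The infinite system for the sine coefficients\<close>

text \<open>Completing the square. The loss \<open>lam\<^sup>2 / 2\<close> is the origin of the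
  growth rates of the later estimates.\<close>

lemma mu_lower: "om n ^ 4 / 2 - lam\<^sup>2 / 2 \<le> mu lam n"
proof -
  have "0 \<le> ((om n)\<^sup>2 - lam)\<^sup>2 / 2" by simp
  also have "\<dots> = mu lam n - (om n ^ 4 / 2 - lam\<^sup>2 / 2)"
    by (simp add: mu_def power2_diff field_simps flip: power_mult)
  finally show ?thesis by simp
qed

text \<open>Frequencies above \<open>N\<close> are controlled by the fourth power, those below by
  the constant.\<close>

lemma om_cube_le:
  assumes N: "N > 0"
  shows "om n ^ 3 \<le> 2 / N * (om n ^ 4 / 2 + N ^ 4)"
proof (cases "om n \<ge> N")
  case True
  have "om n ^ 3 = om n ^ 4 / om n" by (simp add: power_eq_if)
  also have "\<dots> \<le> om n ^ 4 / N" using True N by (intro divide_left_mono) auto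
  also have "\<dots> \<le> 2 / N * (om n ^ 4 / 2 + N ^ 4)" using N by (simp add: field_simps)
  finally show ?thesis .
next
  case False
  have "om n ^ 3 \<le> N ^ 3" using False by (intro power_mono) auto
  also have "\<dots> \<le> 2 * N ^ 3" using N by simp
  also have "\<dots> = 2 / N * N ^ 4" using N by (simp add: power_eq_if)
  also have "\<dots> \<le> 2 / N * (om n ^ 4 / 2 + N ^ 4)" using N by (intro mult_left_mono) auto
  finally show ?thesis .
qed

text \<open>In \<open>ga = lam\<^sup>2 / 2 + N ^ 4\<close> the first term repays the loss in
  \<open>mu_lower\<close> and the second damps the low frequencies;
  \<open>N = 2 / \<epsilon>\<close> comes from the factor \<open>2 / N\<close> in
  \<open>om_cube_le\<close>.\<close>

lemma rate_choice:
  assumes "\<epsilon> > 0"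
  obtains ga where "ga \<ge> lam\<^sup>2 / 2" "ga \<ge> 0" "\<And>n. mu lam n + ga \<ge> om n ^ 4 / 2" "\<And>n. om n ^ 3 / (mu lam n + ga) \<le> \<epsilon>"
proof -
  define N where "N = 2 / \<epsilon>"
  have N: "N > 0" "2 / N = \<epsilon>" using assms by (auto simp: N_def)
  define ga where "ga = lam\<^sup>2 / 2 + N ^ 4"
  have lower: "mu lam n + ga \<ge> om n ^ 4 / 2 + N ^ 4" for n
    using mu_lower[of n lam] by (simp add: ga_def)
  have N4: "N ^ 4 > 0" using N by simp
  have pos: "om n ^ 4 / 2 + N ^ 4 > 0" for n using N4 by (simp add: add_nonneg_pos)
  have "om n ^ 3 / (mu lam n + ga) \<le> \<epsilon>" for n
  proof -
    have "om n ^ 3 \<le> \<epsilon> * (om n ^ 4 / 2 + N ^ 4)" using om_cube_le[OF N(1), of n] N(2) by simp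
    also have "\<dots> \<le> \<epsilon> * (mu lam n + ga)" using lower[of n] assms by (intro mult_left_mono) auto
    finally show ?thesis using pos[of n] lower[of n] by (simp add: pos_divide_le_eq)
  qed
  moreover have "mu lam n + ga \<ge> om n ^ 4 / 2" for n using lower[of n] N4 by linarith
  moreover have "ga \<ge> lam\<^sup>2 / 2" "ga \<ge> 0" using N4 by (auto simp: ga_def)
  ultimately show thesis using that by blast
qed

text \<open>The library has this only for a metric space as domain; here the domain is \<open>nat \<times> real\<close>.\<close>

lemma complete_bcontfun: "complete (UNIV :: ('a::topological_space \<Rightarrow>\<^sub>C 'b::complete_space) set)"
proof (rule completeI)
  fix f :: "nat \<Rightarrow> 'a \<Rightarrow>\<^sub>C 'b"
  assume "Cauchy f"
  have "uniformly_Cauchy_on UNIV (\<lambda>n. apply_bcontfun (f n))"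
  proof (rule uniformly_Cauchy_onI)
    fix e :: real assume "e > 0"
    with \<open>Cauchy f\<close> obtain N where "\<And>m n. m \<ge> N \<Longrightarrow> n \<ge> N \<Longrightarrow> dist (f m) (f n) < e"
      by (meson metric_CauchyD)
    then show "\<exists>M. \<forall>x\<in>UNIV. \<forall>m\<ge>M. \<forall>n\<ge>M. dist (f m x) (f n x) < e"
      using dist_bounded le_less_trans by blast
  qed
  then obtain g where "uniform_limit UNIV f g sequentially"
    using Cauchy_uniformly_convergent uniformly_convergent_on_def by blast
  from uniform_limit_bcontfunE[OF this sequentially_bot]
  show "\<exists>l\<in>UNIV. f \<longlonglongrightarrow> l" by (metis UNIV_I)
qed

text \<open>The right-hand side of the infinite system of ordinary differential equations for the
  sine coefficients may grow like the frequency.\<close>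

locale sine_system =
  fixes b :: "(real \<Rightarrow> real) \<Rightarrow> nat \<Rightarrow> real" and K lam T :: real
  assumes K: "K > 0" and T: "T \<ge> 0"
    and lip: "\<lbrakk>u \<in> L2; w \<in> L2\<rbrakk> \<Longrightarrow>
      \<bar>b u n - b w n\<bar> \<le> om n * K * ((1 + L2_norm u + L2_norm w) * L2_dist u w)"
    and zero: "b (\<lambda>x. 0) n = 0"
begin

section \<open>Mild solutions: uniqueness and existence\<close>

definition mild :: "(real \<Rightarrow> real) \<Rightarrow> (real \<Rightarrow> real \<Rightarrow> real) \<Rightarrow> bool" where
  "mild v0 v \<longleftrightarrow> v \<in> C0_L2 T \<and>
     (\<forall>t\<in>{0..T}. \<forall>n. coef (v t) n = duh (mu lam n) (coef v0 n) (\<lambda>s. b (v s) n) t)"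

lemma continuous_b:
  assumes "v \<in> C0_L2 T"
  shows "continuous_on {0..T} (\<lambda>s. b (v s) n)"
  by (rule C0_L2_continuous_lipschitz[OF assms lip])

lemma b_bound:
  assumes "u \<in> L2"
  shows "\<bar>b u n\<bar> \<le> om n * K * ((1 + L2_norm u) * L2_norm u)"
  using lip[OF assms L2_zero, of n] zero by simp

text \<open>The maximum \<open>M\<close> of the distance weighted by \<open>exp (- ga * s)\<close>
  is shown to satisfy \<open>M \<le> M * (1/2)\<close>.\<close>

lemma mild_unique:
  assumes v: "mild v0 v" and w: "mild v0 w" and t: "t \<in> {0..T}"
  shows "L2_dist (v t) (w t) = 0"
proof -
  have vC: "v \<in> C0_L2 T" and wC: "w \<in> C0_L2 T" using v w by (auto simp: mild_def)
  obtain B1 where B1: "B1 \<ge> 0" "\<And>t. t \<in> {0..T} \<Longrightarrow> L2_norm (v t) \<le> B1" using C0_L2_bounded[OF vC] by blast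
  obtain B2 where B2: "B2 \<ge> 0" "\<And>t. t \<in> {0..T} \<Longrightarrow> L2_norm (w t) \<le> B2" using C0_L2_bounded[OF wC] by blast
  \<comment> \<open>Lipschitz constant, per unit of \<open>om n\<close>, on the range of the two
    given curves.\<close>
  define G where "G = K * (1 + B1 + B2)"
  have G: "G > 0" using K B1 B2 by (simp add: G_def)
  \<comment> \<open>Chosen for \<open>G * \<epsilon> * om_const \<le> 1/2\<close>; the summand 1
    keeps the denominator positive, given that \<open>om_const\<close> is known to be
    nonnegative.\<close>
  define \<epsilon> where "\<epsilon> = 1 / (2 * G * (1 + om_const))"
  have oc: "1 + om_const > 0" using om_const_nonneg by linarith
  have \<epsilon>: "\<epsilon> > 0" using G oc by (simp add: \<epsilon>_def)
  obtain ga where ga: "ga \<ge> 0" "\<And>n. mu lam n + ga \<ge> om n ^ 4 / 2" "\<And>n. om n ^ 3 / (mu lam n + ga) \<le> \<epsilon>"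
    using rate_choice[OF \<epsilon>, of lam] by metis
  let ?d = "\<lambda>s. L2_dist (v s) (w s)"
  have dL: "(\<lambda>x. v s x - w s x) \<in> L2" if "s \<in> {0..T}" for s
    using C0_L2D(1)[OF vC that] C0_L2D(1)[OF wC that] by (rule L2_diff)
  have cont: "continuous_on {0..T} (\<lambda>s. exp (- ga * s) * ?d s)"
    by (intro continuous_intros C0_L2_continuous_norm[OF C0_L2_diff[OF vC wC]])
  obtain s0 where s0: "s0 \<in> {0..T}" "\<And>s. s \<in> {0..T} \<Longrightarrow> exp (- ga * s) * ?d s \<le> exp (- ga * s0) * ?d s0"
    using continuous_attains_sup[OF compact_Icc _ cont] T by (metis atLeastAtMost_iff empty_iff order_refl)
  define M where "M = exp (- ga * s0) * ?d s0"
  have M: "M \<ge> 0" by (simp add: M_def)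
  have dM: "?d s \<le> M * exp (ga * s)" if s: "s \<in> {0..T}" for s
  proof -
    have "?d s = exp (ga * s) * (exp (- ga * s) * ?d s)" by (simp add: exp_minus)
    also have "\<dots> \<le> exp (ga * s) * M" unfolding M_def using s0(2)[OF s] by (intro mult_left_mono) auto
    finally show ?thesis by (simp add: mult.commute)
  qed
  have d_le: "?d s \<le> G * M * exp (ga * s) * \<epsilon> * om_const" if s: "s \<in> {0..T}" for s
  proof (rule L2_norm_le_om_const[OF dL[OF s]])
    show "0 \<le> G * M * exp (ga * s) * \<epsilon>" using G M \<epsilon> by simp
    fix n
    have pos: "mu lam n + ga > 0" using ga(2)[of n] om_pos(1)[of n] zero_less_power[OF om_pos(1)[of n], of 4] by linarith
    have cb: "continuous_on {0..T} (\<lambda>r. b (v r) n)" "continuous_on {0..T} (\<lambda>r. b (w r) n)"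
      using continuous_b vC wC by auto
    have "coef (\<lambda>x. v s x - w s x) n = duh (mu lam n) 0 (\<lambda>r. b (v r) n - b (w r) n) s"
      using coef_diff[OF C0_L2D(1)[OF vC s] C0_L2D(1)[OF wC s]] v w s duh_diff[OF cb s] by (simp add: mild_def)
    also have "\<bar>\<dots>\<bar> \<le> (om n * G * M) * exp (ga * s) / (mu lam n + ga)"
    proof -
      have "\<bar>duh (mu lam n) 0 (\<lambda>r. b (v r) n - b (w r) n) s - exp (- mu lam n * s) * 0\<bar> \<le> (om n * G * M) * exp (ga * s) / (mu lam n + ga)"
      proof (rule duh_bound[OF _ s _ _ pos])
        show "continuous_on {0..T} (\<lambda>r. b (v r) n - b (w r) n)" by (intro continuous_intros cb)
        show "0 \<le> om n * G * M" using G M by simp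
        fix r assume r: "r \<in> {0..T}"
        have "\<bar>b (v r) n - b (w r) n\<bar> \<le> om n * K * ((1 + L2_norm (v r) + L2_norm (w r)) * ?d r)"
          by (rule lip[OF C0_L2D(1)[OF vC r] C0_L2D(1)[OF wC r]])
        also have "\<dots> \<le> om n * K * ((1 + B1 + B2) * (M * exp (ga * r)))"
          using B1(1) B2(1) B1(2)[OF r] B2(2)[OF r] dM[OF r] K M by (intro mult_left_mono mult_mono) auto
        finally show "\<bar>b (v r) n - b (w r) n\<bar> \<le> om n * G * M * exp (ga * r)" by (simp add: G_def mult_ac)
      qed
      then show ?thesis by simp
    qed
    also have "\<dots> = G * M * exp (ga * s) * (om n ^ 3 / (mu lam n + ga)) / (om n)\<^sup>2"
      by (simp add: power2_eq_square power3_eq_cube)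
    also have "\<dots> \<le> G * M * exp (ga * s) * \<epsilon> / (om n)\<^sup>2"
      using ga(3)[of n] G M by (intro divide_right_mono mult_left_mono) auto
    finally show "\<bar>coef (\<lambda>x. v s x - w s x) n\<bar> \<le> G * M * exp (ga * s) * \<epsilon> / (om n)\<^sup>2" .
  qed
  have "M \<le> exp (- ga * s0) * (G * M * exp (ga * s0) * \<epsilon> * om_const)"
    unfolding M_def[symmetric] using d_le[OF s0(1)] by (subst M_def) (intro mult_left_mono, auto)
  also have "\<dots> = M * (G * \<epsilon> * om_const)" by (simp add: exp_minus)
  also have "\<dots> \<le> M * (1/2)"
  proof (rule mult_left_mono[OF _ M])
    have "G * \<epsilon> * om_const = om_const / (2 * (1 + om_const))" using G by (simp add: \<epsilon>_def)
    also have "\<dots> \<le> 1/2" using oc om_const_nonneg by (simp add: field_simps)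
    finally show "G * \<epsilon> * om_const \<le> 1/2" .
  qed
  finally have "M = 0" using M by linarith
  then show ?thesis using dM[OF t] L2_norm_nonneg[of "\<lambda>x. v t x - w t x"] by simp
qed

text \<open>Since \<open>nat\<close> is discrete, preimages split into open slices and joint
  continuity follows from continuity in time for each \<open>n\<close>.\<close>

lemma bcontfun_nat_times_real:
  fixes f :: "nat \<Rightarrow> real \<Rightarrow> real"
  assumes "\<And>n. continuous_on UNIV (f n)" "\<And>n t. \<bar>f n t\<bar> \<le> B"
  shows "(\<lambda>(n, t). f n t) \<in> bcontfun"
proof -
  have "open ((\<lambda>(n, t). f n t) -` U)" if U: "open U" for U
  proof -
    have "(\<lambda>(n, t). f n t) -` U = (\<Union>n. {n} \<times> (f n -` U))" by auto
    moreover have "open ({n} \<times> (f n -` U))" for n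
      using open_vimage[OF U assms(1)] by (intro open_Times open_discrete)
    ultimately show ?thesis by auto
  qed
  then have "continuous_on UNIV (\<lambda>(n, t). f n t)"
    by (simp add: continuous_on_open_vimage)
  moreover have "bounded (range (\<lambda>(n, t). f n t))"
    unfolding bounded_iff using assms(2) by (intro exI[of _ B]) auto
  ultimately show ?thesis by (simp add: bcontfun_def)
qed

text \<open>The bound by 1 is recorded beside the linear one because later estimates use it again to
  replace the quadratic growth of \<open>b\<close> by a linear one.\<close>

theorem mild_exists:
  obtains r0 C where "r0 > 0" "C \<ge> 0"
    "\<And>v0. v0 \<in> L2 \<Longrightarrow> L2_norm v0 \<le> r0 \<Longrightarrow>
      \<exists>v. mild v0 v \<and> (\<forall>t\<in>{0..T}. L2_norm (v t) \<le> 1 \<and> L2_norm (v t) \<le> C * L2_norm v0)"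
proof -
  \<comment> \<open>The 1 accounts for the free part and \<open>om_const\<close> for the forced
    part, both measured in units of the norm of \<open>v0\<close>.\<close>
  define S where "S = 1 + om_const"
  have S: "S \<ge> 1" "om_const \<le> S" using om_const_nonneg by (auto simp: S_def)
  \<comment> \<open>The invariance estimate carries the factor \<open>2 * K * S\<close>, the
    contraction estimate \<open>3 * K * S\<close>; this choice turns them into \<open>1/3\<close>
    and \<open>1/2\<close>.\<close>
  define \<epsilon> where "\<epsilon> = 1 / (6 * K * S)"
  have \<epsilon>: "\<epsilon> > 0" using K S by (simp add: \<epsilon>_def)
  have KSe: "K * S * \<epsilon> = 1/6" using K S by (simp add: \<epsilon>_def)
  obtain ga where ga: "ga \<ge> lam\<^sup>2 / 2" "ga \<ge> 0" "\<And>n. mu lam n + ga \<ge> om n ^ 4 / 2" "\<And>n. om n ^ 3 / (mu lam n + ga) \<le> \<epsilon>"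
    using rate_choice[OF \<epsilon>, of lam] by metis
  have pos: "mu lam n + ga > 0" for n using ga(3)[of n] zero_less_power[OF om_pos(1)[of n], of 4] by linarith
  \<comment> \<open>Makes \<open>exp (ga * T) * S * r0 = 1\<close>, which keeps every trajectory in
    the unit ball of \<open>L2\<close>.\<close>
  define r0 where "r0 = exp (- ga * T) / S"
  have r0: "r0 > 0" using S by (simp add: r0_def)
  have "\<exists>v. mild v0 v \<and> (\<forall>t\<in>{0..T}. L2_norm (v t) \<le> 1 \<and> L2_norm (v t) \<le> exp (ga * T) * S * L2_norm v0)"
    if v0: "v0 \<in> L2" and small: "L2_norm v0 \<le> r0" for v0
  proof -
    \<comment> \<open>Taking the norm of the datum itself as radius of the ball makes the resulting
      bound linear in \<open>v0\<close>.\<close>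
    define R where "R = L2_norm v0"
    have R: "R \<ge> 0" by (simp add: R_def)
    define hom where "hom n t = exp (- mu lam n * t) * coef v0 n" for n t
    \<comment> \<open>The unknown \<open>y\<close> is the forced part after removal of the weight
      \<open>exp (ga * t) / (om n)\<^sup>2\<close>; the free part is added explicitly.\<close>
    define cc where "cc y n t = hom n t + exp (ga * t) / (om n)\<^sup>2 * apply_bcontfun y (n, t)"
      for y :: "(nat \<times> real) \<Rightarrow>\<^sub>C real" and n t
    define V where "V y t = synth (\<lambda>n. cc y n t)" for y t
    \<comment> \<open>The unknowns live on the whole real line in time; freezing the argument
      outside \<open>{0..T}\<close> preserves continuity and bounds.\<close>
    define clamp where "clamp t = max 0 (min T t)" for t
    have clamp: "clamp t \<in> {0..T}" "continuous_on UNIV clamp" for t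
      using T unfolding clamp_def by (auto intro!: continuous_intros)
    have clamp_id: "clamp t = t" if "t \<in> {0..T}" for t using that by (auto simp: clamp_def)
    have hom: "\<bar>hom n t\<bar> \<le> exp (ga * t) * \<bar>coef v0 n\<bar>" if "t \<in> {0..T}" for n t
    proof -
      have "- mu lam n \<le> ga" using mu_lower[of n lam] ga(1) by (smt (verit) half_gt_zero_iff om_pos(1) zero_less_power)
      then have "- mu lam n * t \<le> ga * t" using that by (intro mult_right_mono) auto
      then have "exp (- mu lam n * t) \<le> exp (ga * t)" by (simp only: exp_le_cancel_iff)
      then show ?thesis by (simp add: hom_def abs_mult mult_right_mono)
    qed
    have egT: "exp (ga * t) \<le> exp (ga * T)" if "t \<in> {0..T}" for t
      using that ga(2) by (auto intro: mult_left_mono)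
    \<comment> \<open>A majorant independent of \<open>t\<close>: it gives both square summability
      of the coefficients and, through \<open>C0_L2I_coef\<close>, continuity of the curve.\<close>
    have cc_sum: "summable (\<lambda>n. (exp (ga * T) * \<bar>coef v0 n\<bar> + exp (ga * T) * norm y / (om n)\<^sup>2)\<^sup>2)" 
      for y :: "(nat \<times> real) \<Rightarrow>\<^sub>C real"
    proof (rule summable_comparison_test')
      let ?E = "exp (ga * T)"
      show "summable (\<lambda>n. 2 * ?E\<^sup>2 * (coef v0 n)\<^sup>2 + 2 * (?E * norm y)\<^sup>2 * (1 / (om n)\<^sup>2)\<^sup>2)"
        by (intro summable_add summable_mult Bessel(2)[OF v0] summable_inverse_om4)
      have sq: "(a + c)\<^sup>2 \<le> 2 * a\<^sup>2 + 2 * c\<^sup>2" for a c :: real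
        using sum_squares_bound[of a c] by (simp add: power2_sum)
      show "norm ((?E * \<bar>coef v0 n\<bar> + ?E * norm y / (om n)\<^sup>2)\<^sup>2) \<le> 2 * ?E\<^sup>2 * (coef v0 n)\<^sup>2 + 2 * (?E * norm y)\<^sup>2 * (1 / (om n)\<^sup>2)\<^sup>2" for n
        using sq[of "?E * \<bar>coef v0 n\<bar>" "?E * norm y / (om n)\<^sup>2"] by (simp add: power_mult_distrib power_divide)
    qed
    have cc_le: "\<bar>cc y n t\<bar> \<le> exp (ga * T) * \<bar>coef v0 n\<bar> + exp (ga * T) * norm y / (om n)\<^sup>2" if t: "t \<in> {0..T}" for y n t
    proof -
      have "\<bar>hom n t\<bar> \<le> exp (ga * T) * \<bar>coef v0 n\<bar>"
        using hom[OF t, of n] mult_right_mono[OF egT[OF t], of "\<bar>coef v0 n\<bar>"] by simp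
      moreover have "exp (ga * t) / (om n)\<^sup>2 * \<bar>apply_bcontfun y (n, t)\<bar> \<le> exp (ga * T) / (om n)\<^sup>2 * norm y"
        using norm_bounded[of y "(n, t)"] egT[OF t] by (intro mult_mono divide_right_mono) auto
      ultimately show ?thesis unfolding cc_def
        using abs_triangle_ineq[of "hom n t" "exp (ga * t) / (om n)\<^sup>2 * apply_bcontfun y (n, t)"] by (simp add: abs_mult)
    qed
    have V: "V y t \<in> L2" "coef (V y t) = (\<lambda>n. cc y n t)" if t: "t \<in> {0..T}" for y t
    proof -
      have "summable (\<lambda>n. (cc y n t)\<^sup>2)"
        by (rule summable_comparison_test'[OF cc_sum[of y]]) (use cc_le[OF t, of y] in \<open>simp add: abs_le_square_iff[symmetric]\<close>)
      from synth[OF this] show "V y t \<in> L2" "coef (V y t) = (\<lambda>n. cc y n t)" by (auto simp: V_def)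
    qed
    have VC: "V y \<in> C0_L2 T" for y
    proof (rule C0_L2I_coef[OF V(1) _ cc_sum[of y]])
      show "\<bar>coef (V y t) n\<bar> \<le> exp (ga * T) * \<bar>coef v0 n\<bar> + exp (ga * T) * norm y / (om n)\<^sup>2" if "t \<in> {0..T}" for t n
        using cc_le[OF that] V(2)[OF that] by simp
      fix n
      have "continuous_on {0..T} (\<lambda>t. apply_bcontfun y (n, t))"
        by (rule continuous_on_compose2[OF continuous_on_apply_bcontfun[of UNIV y]]) (auto intro!: continuous_intros)
      then have "continuous_on {0..T} (\<lambda>t. cc y n t)" 
        unfolding cc_def hom_def by (intro continuous_intros) auto
      then show "continuous_on {0..T} (\<lambda>t. coef (V y t) n)"
        by (rule continuous_on_eq) (simp add: V(2))
    qed
    have V_diff: "L2_dist (V y t) (V y' t) \<le> exp (ga * t) * dist y y' * om_const" if t: "t \<in> {0..T}" for y y' t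
    proof (rule L2_norm_le_om_const[OF L2_diff[OF V(1)[OF t] V(1)[OF t]]])
        fix n
        have "coef (\<lambda>x. V y t x - V y' t x) n = exp (ga * t) / (om n)\<^sup>2 * (apply_bcontfun y (n, t) - apply_bcontfun y' (n, t))"
          unfolding coef_diff[OF V(1)[OF t] V(1)[OF t]] V(2)[OF t] by (simp add: cc_def right_diff_distrib)
        also have "\<bar>\<dots>\<bar> \<le> exp (ga * t) / (om n)\<^sup>2 * dist y y'"
          using dist_bounded[of y "(n, t)" y'] by (simp add: abs_mult dist_real_def mult_left_mono divide_right_mono)
        finally show "\<bar>coef (\<lambda>x. V y t x - V y' t x) n\<bar> \<le> exp (ga * t) * dist y y' / (om n)\<^sup>2" by simp
    qed simp
    have V_norm: "L2_norm (V y t) \<le> exp (ga * t) * S * R" if t: "t \<in> {0..T}" and y: "norm y \<le> R" for y t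
    proof -
      have "L2_norm (V 0 t) \<le> exp (ga * t) * L2_norm v0"
        using hom[OF t] V(2)[OF t, of 0] by (intro L2_norm_mono_coef[OF V(1)[OF t] v0]) (auto simp: cc_def)
      moreover have "L2_dist (V y t) (V 0 t) \<le> exp (ga * t) * norm y * om_const"
        using V_diff[OF t, of y 0] by (simp add: dist_norm)
      moreover have "exp (ga * t) * norm y * om_const \<le> exp (ga * t) * R * om_const"
        using y om_const_nonneg by (intro mult_right_mono mult_left_mono) auto
      moreover have "L2_norm (V y t) \<le> L2_dist (V y t) (V 0 t) + L2_norm (V 0 t)"
        using L2_norm_triangle[OF L2_diff[OF V(1)[OF t] V(1)[OF t]] V(1)[OF t], of y 0 0] by simp
      ultimately show ?thesis by (simp add: S_def R_def algebra_simps)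
    qed
    \<comment> \<open>Here the smallness of the datum enters: norms along \<open>V y\<close> are at
      most 1, so the quadratic factors below become the constants 2 and 3.\<close>
    have ES: "exp (ga * t) * S * R \<le> 1" if t: "t \<in> {0..T}" for t
    proof -
      have "exp (ga * t) * S * R \<le> exp (ga * T) * S * r0"
        using egT[OF t] small S R r0 by (intro mult_mono) (auto simp: R_def)
      also have "\<dots> = 1" using S by (simp add: r0_def exp_minus)
      finally show ?thesis .
    qed
    \<comment> \<open>The fixed point map in the rescaled unknown: Duhamel integral minus free part,
      with the weight of \<open>cc\<close> divided out.\<close>
    define W where "W y n t = om n ^ 2 * (exp (- ga * t) * (duh (mu lam n) (coef v0 n) (\<lambda>s. b (V y s) n) t - hom n t))" for y n t
    have W_bound: "\<bar>W y n t\<bar> \<le> R" if t: "t \<in> {0..T}" and y: "norm y \<le> R" for y n t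
    proof -
      have "\<bar>duh (mu lam n) (coef v0 n) (\<lambda>s. b (V y s) n) t - exp (- mu lam n * t) * coef v0 n\<bar> 
        \<le> (om n * K * (2 * (S * R))) * exp (ga * t) / (mu lam n + ga)"
      proof (rule duh_bound[OF continuous_b[OF VC] t _ _ pos])
        show "0 \<le> om n * K * (2 * (S * R))" using K S R by simp
        fix s assume s: "s \<in> {0..T}"
        have "\<bar>b (V y s) n\<bar> \<le> om n * K * ((1 + L2_norm (V y s)) * L2_norm (V y s))"
          by (rule b_bound[OF V(1)[OF s]])
        also have "\<dots> \<le> om n * K * (2 * (exp (ga * s) * S * R))"
          using V_norm[OF s y] ES[OF s] K by (intro mult_left_mono mult_mono) auto
        finally show "\<bar>b (V y s) n\<bar> \<le> om n * K * (2 * (S * R)) * exp (ga * s)" by (simp add: mult_ac)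
      qed
      then have "\<bar>W y n t\<bar> \<le> om n ^ 2 * (exp (- ga * t) * ((om n * K * (2 * (S * R))) * exp (ga * t) / (mu lam n + ga)))"
        unfolding W_def hom_def abs_mult by (intro mult_mono) auto
      also have "\<dots> = 2 * (K * S * R) * (om n ^ 3 / (mu lam n + ga))"
        by (simp add: exp_minus power2_eq_square power3_eq_cube)
      also have "\<dots> \<le> 2 * (K * S * R) * \<epsilon>" using ga(4)[of n] K S R by (intro mult_left_mono) auto
      also have "\<dots> = 2 * (K * S * \<epsilon>) * R" by simp
      also have "\<dots> \<le> R" using R unfolding KSe by simp
      finally show ?thesis .
    qed
    have W_lip: "\<bar>W y n t - W y' n t\<bar> \<le> 1/2 * dist y y'" if t: "t \<in> {0..T}" and y: "norm y \<le> R" "norm y' \<le> R" for y y' n t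
    proof -
      let ?D = "duh (mu lam n) 0 (\<lambda>s. b (V y s) n - b (V y' s) n) t"
      have "W y n t - W y' n t = om n ^ 2 * (exp (- ga * t) * 
          (duh (mu lam n) (coef v0 n) (\<lambda>s. b (V y s) n) t - duh (mu lam n) (coef v0 n) (\<lambda>s. b (V y' s) n) t))"
        unfolding W_def by (simp add: right_diff_distrib)
      also have "\<dots> = om n ^ 2 * (exp (- ga * t) * ?D)"
        unfolding duh_diff[OF continuous_b[OF VC] continuous_b[OF VC] t] ..
      finally have eq: "W y n t - W y' n t = om n ^ 2 * (exp (- ga * t) * ?D)" .
      have "\<bar>?D - exp (- mu lam n * t) * 0\<bar> \<le> (om n * K * (3 * (dist y y' * S))) * exp (ga * t) / (mu lam n + ga)"
      proof (rule duh_bound[OF _ t _ _ pos])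
        show "continuous_on {0..T} (\<lambda>s. b (V y s) n - b (V y' s) n)"
          by (intro continuous_intros continuous_b[OF VC])
        show "0 \<le> om n * K * (3 * (dist y y' * S))" using K S by simp
        fix s assume s: "s \<in> {0..T}"
        have "\<bar>b (V y s) n - b (V y' s) n\<bar> \<le> om n * K * ((1 + L2_norm (V y s) + L2_norm (V y' s)) * L2_dist (V y s) (V y' s))"
          by (rule lip[OF V(1)[OF s] V(1)[OF s]])
        also have "\<dots> \<le> om n * K * (3 * (exp (ga * s) * dist y y' * S))"
          using V_norm[OF s y(1)] V_norm[OF s y(2)] ES[OF s] K S
            order_trans[OF V_diff[OF s, of y y'] mult_left_mono[OF S(2)]]
          by (intro mult_left_mono mult_mono) auto
        finally show "\<bar>b (V y s) n - b (V y' s) n\<bar> \<le> om n * K * (3 * (dist y y' * S)) * exp (ga * s)" by (simp add: mult_ac)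
      qed
      then have "\<bar>W y n t - W y' n t\<bar> \<le> om n ^ 2 * (exp (- ga * t) * ((om n * K * (3 * (dist y y' * S))) * exp (ga * t) / (mu lam n + ga)))"
        unfolding eq abs_mult by (intro mult_mono) auto
      also have "\<dots> = 3 * (K * S * dist y y') * (om n ^ 3 / (mu lam n + ga))"
        by (simp add: exp_minus power2_eq_square power3_eq_cube)
      also have "\<dots> \<le> 3 * (K * S * dist y y') * \<epsilon>" using ga(4)[of n] K S by (intro mult_left_mono) auto
      also have "\<dots> = 3 * (K * S * \<epsilon>) * dist y y'" by simp
      also have "\<dots> = 1/2 * dist y y'" unfolding KSe by simp
      finally show ?thesis .
    qed
    \<comment> \<open>\<open>Bcontfun\<close> can be unfolded only for a bounded continuous
      argument; the bound comes from \<open>W_bound\<close>, hence the restriction to the ball of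
      radius \<open>R\<close>.\<close>
    define \<Phi> where "\<Phi> y = Bcontfun (\<lambda>(n, t). W y n (clamp t))" for y
    have \<Phi>: "apply_bcontfun (\<Phi> y) (n, t) = W y n (clamp t)" if y: "norm y \<le> R" for y n t
    proof -
      have "(\<lambda>(n, t). W y n (clamp t)) \<in> bcontfun"
      proof (rule bcontfun_nat_times_real)
        show "\<bar>W y n (clamp t)\<bar> \<le> R" for n t by (rule W_bound[OF clamp(1) y])
        fix n
        have "continuous_on {0..T} (W y n)" unfolding W_def hom_def
          by (intro continuous_intros duh_continuous continuous_b VC)
        then show "continuous_on UNIV (\<lambda>t. W y n (clamp t))"
          by (rule continuous_on_compose2[OF _ clamp(2)]) (use clamp(1) in auto)
      qed
      then show ?thesis by (simp add: \<Phi>_def Bcontfun_inverse)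
    qed
    have "\<exists>!y\<in>cball 0 R. \<Phi> y = y"
    proof (rule Banach_fix)
      show "complete (cball 0 R :: ((nat \<times> real) \<Rightarrow>\<^sub>C real) set)" by (rule complete_closed_subset[OF closed_cball subset_UNIV complete_bcontfun])
      show "cball 0 R \<noteq> ({} :: ((nat \<times> real) \<Rightarrow>\<^sub>C real) set)" using R by simp
      show "(0::real) \<le> 1/2" "1/2 < (1::real)" by auto
      show "\<Phi> ` cball 0 R \<subseteq> cball 0 R"
      proof clarify
        fix y :: "(nat \<times> real) \<Rightarrow>\<^sub>C real" assume "y \<in> cball 0 R"
        then have y: "norm y \<le> R" by (simp add: dist_norm)
        have "norm (\<Phi> y) \<le> R"
        proof (rule norm_bound)
          fix z show "norm (apply_bcontfun (\<Phi> y) z) \<le> R"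
            using W_bound[OF clamp(1) y] by (cases z) (simp add: \<Phi>[OF y])
        qed
        then show "\<Phi> y \<in> cball 0 R" by (simp add: dist_norm)
      qed
      fix y y' :: "(nat \<times> real) \<Rightarrow>\<^sub>C real" assume "y \<in> cball 0 R" "y' \<in> cball 0 R"
      then have y: "norm y \<le> R" "norm y' \<le> R" by (auto simp: dist_norm)
      show "dist (\<Phi> y) (\<Phi> y') \<le> 1/2 * dist y y'"
      proof (rule dist_bound)
        fix z
        show "dist (apply_bcontfun (\<Phi> y) z) (apply_bcontfun (\<Phi> y') z) \<le> 1/2 * dist y y'"
          using W_lip[OF clamp(1) y] by (cases z) (simp add: \<Phi>[OF y(1)] \<Phi>[OF y(2)] dist_real_def)
      qed
    qed
    then obtain y where "y \<in> cball 0 R" and fix_y: "\<Phi> y = y" by blast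
    then have y: "norm y \<le> R" by (simp add: dist_norm)
    have "mild v0 (V y)"
      unfolding mild_def
    proof (intro conjI ballI allI VC)
      fix t n assume t: "t \<in> {0..T}"
      have "apply_bcontfun y (n, t) = W y n t" using \<Phi>[OF y, of n t] fix_y clamp_id[OF t] by simp
      then have "coef (V y t) n = hom n t + exp (ga * t) / (om n)\<^sup>2 * W y n t"
        using V(2)[OF t] by (simp add: cc_def)
      also have "\<dots> = duh (mu lam n) (coef v0 n) (\<lambda>s. b (V y s) n) t"
        by (simp add: W_def exp_minus field_simps)
      finally show "coef (V y t) n = duh (mu lam n) (coef v0 n) (\<lambda>s. b (V y s) n) t" .
    qed
    moreover have "L2_norm (V y t) \<le> 1 \<and> L2_norm (V y t) \<le> exp (ga * T) * S * L2_norm v0" if t: "t \<in> {0..T}" for t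
    proof -
      have "exp (ga * t) * S * R \<le> exp (ga * T) * S * R"
        using egT[OF t] S R by (intro mult_right_mono) auto
      then show ?thesis using V_norm[OF t y] ES[OF t] unfolding R_def by linarith
    qed
    ultimately show ?thesis by blast
  qed
  moreover have "exp (ga * T) * S \<ge> 0" using S by simp
  ultimately show thesis using that r0 by blast
qed

end


section \<open>From solutions to sine coefficients\<close>

lemma integrable_lebesgue_on_subset:
  fixes f :: "real \<Rightarrow> real"
  assumes "integrable (lebesgue_on S) f" "A \<subseteq> S" "A \<in> sets lebesgue" "S \<in> sets lebesgue"
  shows "integrable (lebesgue_on A) f"
proof -
  have "f absolutely_integrable_on S"
    using assms by (simp add: integrable_restrict_space set_integrable_def)
  then have "f absolutely_integrable_on A"
    by (rule set_integrable_subset) (use assms in auto)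
  then show ?thesis
    using assms by (simp add: integrable_restrict_space set_integrable_def)
qed

lemma AE_lebesgue_on_subset:
  assumes "AE x in lebesgue_on S. P x" "A \<subseteq> S" "A \<in> sets lebesgue" "S \<in> sets lebesgue"
  shows "AE x in lebesgue_on A. P x"
  using assms by (auto simp: AE_restrict_space_iff elim: eventually_mono)

text \<open>For \<open>ks_form\<close> along a solution, equality with a continuous function is
  available only almost everywhere in time; modification on a negligible set carries integrability
  and the integral over.\<close>

lemma lint_AE_eq_integral:
  fixes f h :: "real \<Rightarrow> real"
  assumes h: "continuous_on {a..b} h" and ae: "AE x in lebesgue_on {a<..<b}. f x = h x"
  shows "(LINT x|lebesgue_on {a<..<b}. f x) = integral {a..b} h"
proof -
  have "AE x in lebesgue. x \<in> {a<..<b} \<longrightarrow> f x = h x"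
    using ae by (subst (asm) AE_restrict_space_iff) auto
  then obtain N where N: "{x. \<not> (x \<in> {a<..<b} \<longrightarrow> f x = h x)} \<subseteq> N" "N \<in> null_sets lebesgue"
    by (auto elim!: AE_E simp: null_sets_def)
  have neg: "negligible N" using N(2) by (simp add: negligible_iff_null_sets)
  have eq: "f x = h x" if "x \<in> {a<..<b} - N" for x using N(1) that by auto
  have "h absolutely_integrable_on {a<..<b}"
    using lint_eq_integral(2)[OF h] by (simp add: integrable_restrict_space set_integrable_def)
  from absolutely_integrable_spike[OF this neg eq]
  have "integrable (lebesgue_on {a<..<b}) f" by (simp add: integrable_restrict_space set_integrable_def)
  then have "(LINT x|lebesgue_on {a<..<b}. f x) = integral {a<..<b} f"
    by (rule lebesgue_integral_eq_integral) simp
  also have "\<dots> = integral {a<..<b} h" by (rule integral_spike[OF neg, symmetric]) (use eq in auto)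
  finally show ?thesis by (simp add: integral_open_interval_real)
qed

text \<open>Continuity at the zero function gives a ball on which
  \<open>\<bar>F w\<bar> < 1\<close>; scaling into that ball yields the norm bound.\<close>

lemma continuous_linear_L2D:
  assumes F: "continuous_linear_L2 F"
  obtains C where "C \<ge> 0" "\<And>u. u \<in> L2 \<Longrightarrow> \<bar>F u\<bar> \<le> C * L2_norm u"
    "\<And>u w. u \<in> L2 \<Longrightarrow> w \<in> L2 \<Longrightarrow> F (\<lambda>x. u x - w x) = F u - F w"
proof -
  have add: "F (\<lambda>x. u x + w x) = F u + F w" if "u \<in> L2" "w \<in> L2" for u w
    using F that by (auto simp: continuous_linear_L2_def)
  have scale: "F (\<lambda>x. c * u x) = c * F u" if "u \<in> L2" for u c
    using F that by (auto simp: continuous_linear_L2_def)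
  have F0: "F (\<lambda>x. 0) = 0" using scale[OF L2_zero, of 0] by simp
  obtain \<delta> where \<delta>: "\<delta> > 0" "\<And>w. w \<in> L2 \<Longrightarrow> L2_norm w < \<delta> \<Longrightarrow> \<bar>F w\<bar> < 1"
  proof -
    have "\<forall>u\<in>L2. \<forall>\<epsilon>>0. \<exists>\<delta>>0. \<forall>w\<in>L2. L2_dist w u < \<delta> \<longrightarrow> \<bar>F w - F u\<bar> < \<epsilon>"
      using F by (simp add: continuous_linear_L2_def)
    from this[rule_format, OF L2_zero zero_less_one]
    have "\<exists>\<delta>>0. \<forall>w\<in>L2. L2_norm (\<lambda>x. w x - 0) < \<delta> \<longrightarrow> \<bar>F w - F (\<lambda>x. 0)\<bar> < 1" .
    then show thesis using that F0 by auto
  qed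
  have bound: "\<bar>F u\<bar> \<le> (2 / \<delta>) * L2_norm u" if u: "u \<in> L2" for u
  proof (rule field_le_epsilon)
    fix e :: real assume e: "e > 0"
    \<comment> \<open>The summand \<open>e\<close> keeps the scaling factor finite for functions of
      norm zero.\<close>
    define c where "c = 1 / ((2 / \<delta>) * L2_norm u + e)"
    have den: "(2 / \<delta>) * L2_norm u + e > 0" using \<delta>(1) e by (simp add: add_nonneg_pos)
    have c: "c > 0" using den by (simp add: c_def)
    have "c * L2_norm u < \<delta>"
    proof -
      have "L2_norm u < \<delta> * ((2 / \<delta>) * L2_norm u + e)"
        using \<delta>(1) e L2_norm_nonneg[of u] by (simp add: distrib_left add_nonneg_pos less_add_same_cancel1)
      then show ?thesis using den by (simp add: c_def pos_divide_less_eq)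
    qed
    then have "L2_norm (\<lambda>x. c * u x) < \<delta>" using c by (simp add: L2_norm_cmult)
    from \<delta>(2)[OF L2_cmult[OF u] this] have "c * \<bar>F u\<bar> < 1"
      using scale[OF u, of c] c by (simp add: abs_mult)
    then show "\<bar>F u\<bar> \<le> (2 / \<delta>) * L2_norm u + e"
      using den by (simp add: c_def pos_divide_less_eq)
  qed
  have "F (\<lambda>x. u x - w x) = F u - F w" if "u \<in> L2" "w \<in> L2" for u w
    using add[OF that(1) L2_cmult[OF that(2), of "-1"]] scale[OF that(2), of "-1"] by simp
  then show thesis using that[of "2 / \<delta>"] \<delta>(1) bound by simp
qed

text \<open>The factor \<open>sqrt 2 * om n\<close> is the boundary derivative of
  \<open>es n\<close> at 0, through which the feedback enters the weak form.\<close>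

definition loop_rhs :: "((real \<Rightarrow> real) \<Rightarrow> real) \<Rightarrow> (real \<Rightarrow> real) \<Rightarrow> nat \<Rightarrow> real" where
  "loop_rhs F u n = nl u n + sqrt 2 * om n * F u"

lemma loop_rhs_lipschitz:
  assumes C: "C \<ge> 0" "\<And>u. u \<in> L2 \<Longrightarrow> \<bar>F u\<bar> \<le> C * L2_norm u"
    "\<And>u w. u \<in> L2 \<Longrightarrow> w \<in> L2 \<Longrightarrow> F (\<lambda>x. u x - w x) = F u - F w"
    and uw: "u \<in> L2" "w \<in> L2"
  shows "\<bar>loop_rhs F u n - loop_rhs F w n\<bar> \<le> om n * (1 + 2 * C) * ((1 + L2_norm u + L2_norm w) * L2_dist u w)"
proof -
  let ?d = "L2_dist u w" and ?s = "L2_norm u + L2_norm w"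
  have "\<bar>F u - F w\<bar> \<le> C * ?d" using C(2)[OF L2_diff[OF uw]] C(3)[OF uw] by simp
  then have "sqrt 2 * om n * \<bar>F u - F w\<bar> \<le> 2 * om n * (C * ?d)"
    using C(1) sqrt2_less_2 by (intro mult_mono) auto
  then have "\<bar>sqrt 2 * om n * F u - sqrt 2 * om n * F w\<bar> \<le> 2 * om n * (C * ?d)"
    by (simp add: abs_mult flip: right_diff_distrib)
  then have "\<bar>loop_rhs F u n - loop_rhs F w n\<bar> \<le> om n * (?s * ?d) + 2 * om n * (C * ?d)"
    using nl_lipschitz[OF uw, of n] unfolding loop_rhs_def by linarith
  also have "\<dots> = om n * ((?s + 2 * C) * ?d)" by (simp add: algebra_simps)
  also have "\<dots> \<le> om n * (((1 + 2 * C) * (1 + ?s)) * ?d)"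
    using C(1) by (intro mult_left_mono mult_right_mono) (auto simp: algebra_simps)
  finally show ?thesis by (simp add: mult.assoc add.assoc)
qed

lemma C0_L2_continuous_coef:
  assumes "v \<in> C0_L2 T"
  shows "continuous_on {0..T} (\<lambda>t. coef (v t) n)"
proof (rule C0_L2_continuous_lipschitz[OF assms, of _ 1])
  fix u w assume uw: "u \<in> L2" "w \<in> L2"
  have "\<bar>coef u n - coef w n\<bar> \<le> 1 * L2_dist u w"
    using coef_abs_le[OF L2_diff[OF uw], of n] coef_diff[OF uw] by simp
  also have "\<dots> \<le> (1 + L2_norm u + L2_norm w) * L2_dist u w"
    by (rule mult_right_mono) auto
  finally show "\<bar>coef u n - coef w n\<bar> \<le> 1 * ((1 + L2_norm u + L2_norm w) * L2_dist u w)" by simp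
qed

lemma C0_L2_continuous_nl:
  assumes "v \<in> C0_L2 T"
  shows "continuous_on {0..T} (\<lambda>t. nl (v t) n)"
proof (rule C0_L2_continuous_lipschitz[OF assms, of _ "om n"])
  fix u w assume uw: "u \<in> L2" "w \<in> L2"
  have "(L2_norm u + L2_norm w) * L2_dist u w \<le> (1 + L2_norm u + L2_norm w) * L2_dist u w"
    by (rule mult_right_mono) auto
  then show "\<bar>nl u n - nl w n\<bar> \<le> om n * ((1 + L2_norm u + L2_norm w) * L2_dist u w)"
    using nl_lipschitz[OF uw, of n] by (meson mult_left_mono om_pos(3) order_trans)
qed

lemma C0_L2_continuous_linear:
  assumes v: "v \<in> C0_L2 T" and F: "continuous_linear_L2 F"
  shows "continuous_on {0..T} (\<lambda>t. F (v t))"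
proof -
  obtain C where C: "C \<ge> 0" "\<And>u. u \<in> L2 \<Longrightarrow> \<bar>F u\<bar> \<le> C * L2_norm u"
    "\<And>u w. u \<in> L2 \<Longrightarrow> w \<in> L2 \<Longrightarrow> F (\<lambda>x. u x - w x) = F u - F w"
    using continuous_linear_L2D[OF F] by blast
  show ?thesis
  proof (rule C0_L2_continuous_lipschitz[OF v, of _ C])
    fix u w assume uw: "u \<in> L2" "w \<in> L2"
    have "\<bar>F u - F w\<bar> \<le> C * (1 * L2_dist u w)"
      using C(2)[OF L2_diff[OF uw]] C(3)[OF uw] by simp
    also have "\<dots> \<le> C * ((1 + L2_norm u + L2_norm w) * L2_dist u w)"
      using C(1) by (intro mult_left_mono mult_right_mono) auto
    finally show "\<bar>F u - F w\<bar> \<le> C * ((1 + L2_norm u + L2_norm w) * L2_dist u w)" .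
  qed
qed

section \<open>Sine coefficients of weak solutions\<close>

lemma KS_solution_iff:
  "KS_solution lam T v0 f v \<longleftrightarrow>
     v0 \<in> L2 \<and> f \<in> L2_on {0<..<T} \<and> v \<in> X_space T \<and>
     (\<forall>\<tau>\<in>{0..T}. \<forall>\<theta>\<in>H2 \<inter> H10. ip (v \<tau>) \<theta> - ip v0 \<theta>
        + (LINT t|lebesgue_on {0<..<\<tau>}. ks_form lam (v t) \<theta>)
        + trace (weak_deriv \<theta>) 0 * (LINT t|lebesgue_on {0<..<\<tau>}. f t) = 0)"
  by (simp add: KS_solution_def ip_def ks_form_def)

text \<open>Testing with \<open>es n\<close> gives a scalar integral equation whose integrand agrees
  almost everywhere in time with a continuous function; \<open>integral_eq_imp_duh\<close> then
  applies.\<close>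

lemma solution_imp_duh:
  assumes F: "continuous_linear_L2 F" and sol: "closed_loop_KS_solution lam F T v0 v" and t: "t \<in> {0..T}"
  shows "coef (v t) n = duh (mu lam n) (coef v0 n) (\<lambda>s. loop_rhs F (v s) n) t"
proof (rule integral_eq_imp_duh[OF _ _ t])
  have X: "v \<in> C0_L2 T" "v \<in> L2_H2 T"
    using sol by (auto simp: closed_loop_KS_solution_def KS_solution_iff X_space_def)
  note cc = C0_L2_continuous_coef[OF X(1), of n] and cn = C0_L2_continuous_nl[OF X(1), of n]
    and cF = C0_L2_continuous_linear[OF X(1) F]
  show "continuous_on {0..T} (\<lambda>s. loop_rhs F (v s) n)"
    unfolding loop_rhs_def by (intro continuous_intros cn cF)
  show "continuous_on {0..T} (\<lambda>t. coef (v t) n)" by (rule cc)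
  have ae: "AE t in lebesgue_on {0<..<T}. v t \<in> H2 \<inter> H10"
    using X(2) by (auto simp: L2_H2_def strongly_measurable_H2_def elim: eventually_mono)
  fix \<tau> assume \<tau>: "\<tau> \<in> {0..T}"
  have sub: "continuous_on {0..\<tau>} g" if "continuous_on {0..T} g" for g :: "real \<Rightarrow> real"
    by (rule continuous_on_subset[OF that]) (use \<tau> in auto)
  have "AE t in lebesgue_on {0<..<\<tau>}. v t \<in> H2 \<inter> H10"
    by (rule AE_lebesgue_on_subset[OF ae]) (use \<tau> in auto)
  then have "AE t in lebesgue_on {0<..<\<tau>}. ks_form lam (v t) (es n) = mu lam n * coef (v t) n + nl (v t) n"
    by eventually_elim (simp add: ks_form_es)
  then have 1: "(LINT t|lebesgue_on {0<..<\<tau>}. ks_form lam (v t) (es n)) = integral {0..\<tau>} (\<lambda>t. mu lam n * coef (v t) n + nl (v t) n)"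
    by (rule lint_AE_eq_integral[rotated]) (intro continuous_intros sub cc cn)
  have 2: "(LINT t|lebesgue_on {0<..<\<tau>}. F (v t)) = integral {0..\<tau>} (\<lambda>t. F (v t))"
    by (rule lint_eq_integral(1)[OF sub[OF cF]])
  have "integral {0..\<tau>} (\<lambda>s. mu lam n * coef (v s) n + loop_rhs F (v s) n) =
     integral {0..\<tau>} (\<lambda>t. (mu lam n * coef (v t) n + nl (v t) n) + sqrt 2 * om n * F (v t))"
    by (simp add: loop_rhs_def add.assoc)
  also have "\<dots> = integral {0..\<tau>} (\<lambda>t. mu lam n * coef (v t) n + nl (v t) n) + integral {0..\<tau>} (\<lambda>t. sqrt 2 * om n * F (v t))"
    by (intro Henstock_Kurzweil_Integration.integral_add integrable_continuous_real continuous_intros sub cc cn cF)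
  also have "\<dots> = integral {0..\<tau>} (\<lambda>t. mu lam n * coef (v t) n + nl (v t) n) + sqrt 2 * om n * integral {0..\<tau>} (\<lambda>t. F (v t))"
    by simp
  moreover have "ip (v \<tau>) (es n) - ip v0 (es n)
        + (LINT t|lebesgue_on {0<..<\<tau>}. ks_form lam (v t) (es n))
        + trace (weak_deriv (es n)) 0 * (LINT t|lebesgue_on {0<..<\<tau>}. F (v t)) = 0"
    using sol \<tau> es_H2_H10[of n] unfolding closed_loop_KS_solution_def KS_solution_iff by blast
  note 3 = this
  ultimately show "coef (v \<tau>) n - coef v0 n + integral {0..\<tau>} (\<lambda>s. mu lam n * coef (v s) n + loop_rhs F (v s) n) = 0"
    using 3 unfolding 1 2 trace_weak_deriv_es coef_def[symmetric] by simp
qed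

text \<open>As \<open>om n \<ge> 1\<close>, each of the three terms of the norm is dominated by the
  fourth power.\<close>

lemma H2_norm_sq_le:
  assumes u: "u \<in> H2" "u \<in> H10"
  shows "(H2_norm u)\<^sup>2 \<le> 3 * (\<Sum>n. om n ^ 4 * (coef u n)\<^sup>2)"
proof (rule sums_le[OF _ H2_norm_sums[OF u] sums_mult[OF summable_sums[OF summable_om4_coef[OF u]]]])
  fix n
  have "1 \<le> (om n)\<^sup>2" using power_mono[OF om_ge_1[of n], of 2] by simp
  moreover have "om n ^ 4 = (om n)\<^sup>2 * (om n)\<^sup>2" by (simp flip: power_add)
  ultimately have "1 + (om n)\<^sup>2 + om n ^ 4 \<le> 3 * om n ^ 4"
    using mult_mono[of 1 "(om n)\<^sup>2" 1 "(om n)\<^sup>2"] mult_left_mono[of 1 "(om n)\<^sup>2" "(om n)\<^sup>2"] by simp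
  from mult_right_mono[OF this, of "(coef u n)\<^sup>2"]
  show "(1 + (om n)\<^sup>2 + om n ^ 4) * (coef u n)\<^sup>2 \<le> 3 * (om n ^ 4 * (coef u n)\<^sup>2)" by simp
qed

lemma om4_partial_sum_le_H2_norm:
  assumes u: "u \<in> H2" "u \<in> H10"
  shows "(\<Sum>n<N. om n ^ 4 * (coef u n)\<^sup>2) \<le> (H2_norm u)\<^sup>2"
proof -
  have "(\<Sum>n<N. om n ^ 4 * (coef u n)\<^sup>2) \<le> (\<Sum>n<N. (1 + (om n)\<^sup>2 + om n ^ 4) * (coef u n)\<^sup>2)"
    by (intro sum_mono mult_right_mono) auto
  also have "\<dots> \<le> (\<Sum>n. (1 + (om n)\<^sup>2 + om n ^ 4) * (coef u n)\<^sup>2)"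
    by (rule sum_le_suminf[OF sums_summable[OF H2_norm_sums[OF u]]]) auto
  also have "\<dots> = (H2_norm u)\<^sup>2" using sums_unique[OF H2_norm_sums[OF u]] by simp
  finally show ?thesis .
qed

text \<open>Strong measurability is witnessed by rounding finitely many coefficients to a grid.\<close>

lemma strongly_measurable_H2I:
  assumes meas: "\<And>n. (\<lambda>t. coef (v t) n) \<in> borel_measurable (lebesgue_on {0<..<T})"
    and bound: "\<And>t n. t \<in> {0<..<T} \<Longrightarrow> \<bar>coef (v t) n\<bar> \<le> B"
    and H: "\<And>t. t \<in> {0<..<T} \<Longrightarrow> v t \<in> H2 \<inter> H10"
  shows "strongly_measurable_H2 T v"
proof -
  \<comment> \<open>\<open>1 / D k\<close> is the width of the grid. The sum compensates the weights
    \<open>om n ^ 4\<close> of the \<open>H2\<close> norm, and the factor \<open>k + 1\<close>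
    forces the total rounding error to 0.\<close>
  define D where "D k = real (k + 1) * (1 + (\<Sum>n<k. om n ^ 4))" for k
  have D1: "D k \<ge> 1" for k
    using mult_mono[of 1 "real (k+1)" 1 "1 + (\<Sum>n<k. om n ^ 4)"] sum_nonneg[of "{..<k}" "\<lambda>n. om n ^ 4"]
    by (simp add: D_def)
  define rd where "rd k y = real_of_int \<lfloor>D k * y\<rfloor> / D k" for k y
  have rd: "\<bar>rd k y - y\<bar> \<le> 1 / D k" for k y
  proof -
    have "rd k y - y = (real_of_int \<lfloor>D k * y\<rfloor> - D k * y) / D k" using D1[of k] by (simp add: rd_def diff_divide_distrib)
    moreover have "\<bar>real_of_int \<lfloor>D k * y\<rfloor> - D k * y\<bar> \<le> 1" by linarith
    ultimately show ?thesis using D1[of k] by (simp add: abs_divide divide_right_mono)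
  qed
  define s where "s k t = psum k (\<lambda>n. rd k (coef (v t) n))" for k t
  \<comment> \<open>Bounded coefficients meet only finitely many grid points.\<close>
  have simp_rd: "simple_function (lebesgue_on {0<..<T}) (\<lambda>t. rd k (coef (v t) n))" for k n
  proof (rule simple_function_borel_measurable)
    show "(\<lambda>t. rd k (coef (v t) n)) \<in> borel_measurable (lebesgue_on {0<..<T})"
      using meas[of n] unfolding rd_def by measurable
    have "(\<lambda>t. rd k (coef (v t) n)) ` space (lebesgue_on {0<..<T}) \<subseteq> (\<lambda>i. real_of_int i / D k) ` {\<lfloor>- (D k * B)\<rfloor>..\<lfloor>D k * B\<rfloor>}"
    proof clarify
      fix t assume "t \<in> space (lebesgue_on {0<..<T})"
      then have "\<bar>coef (v t) n\<bar> \<le> B" using bound by (simp add: space_restrict_space)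
      then have "D k * coef (v t) n \<le> D k * B" "D k * (- B) \<le> D k * coef (v t) n"
        using D1[of k] by (intro mult_left_mono; simp add: abs_le_iff)+
      then have "\<lfloor>D k * coef (v t) n\<rfloor> \<in> {\<lfloor>- (D k * B)\<rfloor>..\<lfloor>D k * B\<rfloor>}"
        by (auto intro: floor_mono)
      then show "rd k (coef (v t) n) \<in> (\<lambda>i. real_of_int i / D k) ` {\<lfloor>- (D k * B)\<rfloor>..\<lfloor>D k * B\<rfloor>}"
        unfolding rd_def by blast
    qed
    then show "finite ((\<lambda>t. rd k (coef (v t) n)) ` space (lebesgue_on {0<..<T}))"
      by (rule finite_subset) simp
  qed
  \<comment> \<open>The number of modes \<open>j\<close> is separated from the grid index
    \<open>k\<close>, so that the induction leaves the grid fixed.\<close>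
  have "simple_function (lebesgue_on {0<..<T}) (\<lambda>t. psum j (\<lambda>n. rd k (coef (v t) n)))" for j k
  proof (induction j)
    case 0
    then show ?case by (simp add: psum_def[abs_def])
  next
    case (Suc j)
    have "psum (Suc j) c = (\<lambda>x. psum j c x + c j * es j x)" for c
      by (simp add: psum_def[abs_def])
    then show ?case
      using simple_function_compose2[OF Suc.IH simp_rd[of k j], of "\<lambda>f a x. f x + a * es j x"] by simp
  qed
  then have simp_s: "simple_function (lebesgue_on {0<..<T}) (s k)" for k
    by (simp add: s_def[abs_def])
  have psH: "psum k c \<in> H2" "psum k c \<in> H10" for k c
  proof -
    have "summable (\<lambda>n. om n ^ 4 * (coef (psum k c) n)\<^sup>2)"
      by (rule summable_finite[of "{..<k}"]) (auto simp: coef_psum)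
    then show "psum k c \<in> H2" "psum k c \<in> H10" using H2_H10I by auto
  qed
  have conv: "(\<lambda>k. H2_norm (\<lambda>x. s k t x - v t x)) \<longlonglongrightarrow> 0" if t: "t \<in> {0<..<T}" for t
  proof -
    have vH: "v t \<in> H2" "v t \<in> H10" using H[OF t] by auto
    define c where "c = coef (v t)"
    define a where "a n = om n ^ 4 * (c n)\<^sup>2" for n
    have a: "summable a" using summable_om4_coef[OF vH] by (simp add: a_def[abs_def] c_def)
    have bnd: "(H2_norm (\<lambda>x. s k t x - v t x))\<^sup>2 \<le> 3 * (1 / real (k + 1) + (suminf a - (\<Sum>n<k. a n)))" for k
    proof -
      let ?d = "\<lambda>x. s k t x - v t x"
      \<comment> \<open>Rounding error on the first \<open>k\<close> modes, the untouched tail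
        \<open>a n\<close> on the others, written so that its sum is explicit.\<close>
      let ?m = "\<lambda>n. (if n \<in> {..<k} then om n ^ 4 / (D k)\<^sup>2 - a n else 0) + a n"
      have m: "?m sums ((\<Sum>n<k. om n ^ 4 / (D k)\<^sup>2 - a n) + suminf a)"
        by (intro sums_add sums_If_finite_set summable_sums a) simp
      have dL: "?d \<in> L2" unfolding s_def using H2D(1)[OF vH(1)] by (intro L2_diff psum_L2)
      have cd: "coef ?d n = (if n < k then rd k (c n) else 0) - c n" for n
        unfolding s_def using H2D(1)[OF vH(1)] by (simp add: coef_diff coef_psum c_def)
      have dm: "om n ^ 4 * (coef ?d n)\<^sup>2 \<le> ?m n" for n
      proof (cases "n < k")
        case True
        have "\<bar>coef ?d n\<bar> \<le> 1 / D k" using rd[of k "c n"] True by (simp add: cd)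
        from power_mono[OF this, of 2] have "(coef ?d n)\<^sup>2 \<le> 1 / (D k)\<^sup>2" by (simp add: power_divide)
        from mult_left_mono[OF this, of "om n ^ 4"] show ?thesis using True by simp
      next
        case False
        then show ?thesis by (simp add: cd a_def)
      qed
      have sd: "summable (\<lambda>n. om n ^ 4 * (coef ?d n)\<^sup>2)"
        by (rule summable_comparison_test'[OF sums_summable[OF m]]) (use dm in auto)
      have "(H2_norm ?d)\<^sup>2 \<le> 3 * (\<Sum>n. om n ^ 4 * (coef ?d n)\<^sup>2)"
        by (rule H2_norm_sq_le[OF H2_H10I[OF dL sd]])
      also have "(\<Sum>n. om n ^ 4 * (coef ?d n)\<^sup>2) \<le> (\<Sum>n<k. om n ^ 4 / (D k)\<^sup>2 - a n) + suminf a"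
        by (rule sums_le[OF dm summable_sums[OF sd] m])
      also have "\<dots> = (\<Sum>n<k. om n ^ 4) / (D k)\<^sup>2 + (suminf a - (\<Sum>n<k. a n))"
        by (simp add: sum_subtractf sum_divide_distrib)
      also have "(\<Sum>n<k. om n ^ 4) / (D k)\<^sup>2 \<le> 1 / real (k + 1)"
      proof -
        have "real (k + 1) * (\<Sum>n<k. om n ^ 4) \<le> D k" by (simp add: D_def)
        also have "\<dots> \<le> D k * D k" using D1[of k] by simp
        finally have "real (k + 1) * (\<Sum>n<k. om n ^ 4) \<le> (D k)\<^sup>2" by (simp add: power2_eq_square)
        then show ?thesis using D1[of k] by (simp add: divide_simps mult.commute)
      qed
      finally show ?thesis by simp
    qed
    have lim: "(\<lambda>k. 3 * (1 / real (k + 1) + (suminf a - (\<Sum>n<k. a n)))) \<longlonglongrightarrow> 3 * (0 + (suminf a - suminf a))"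
      by (intro tendsto_intros summable_LIMSEQ[OF a] LIMSEQ_ignore_initial_segment[OF lim_1_over_n])
    have "(\<lambda>k. (H2_norm (\<lambda>x. s k t x - v t x))\<^sup>2) \<longlonglongrightarrow> 0"
      by (rule Lim_null_comparison[of _ "\<lambda>k. 3 * (1 / real (k + 1) + (suminf a - (\<Sum>n<k. a n)))"])
        (use bnd lim in \<open>auto intro: always_eventually\<close>)
    from tendsto_real_sqrt[OF this] show ?thesis by (simp add: H2_norm_def)
  qed
  show ?thesis
    unfolding strongly_measurable_H2_def
  proof (intro exI[of _ s] conjI allI)
    show "simple_function (lebesgue_on {0<..<T}) (s k)" for k by (rule simp_s)
    show "s k ` {0<..<T} \<subseteq> H2 \<inter> H10" for k using psH by (auto simp: s_def)
    show "AE t in lebesgue_on {0<..<T}. v t \<in> H2 \<inter> H10 \<and> (\<lambda>n. H2_norm (\<lambda>x. s n t x - v t x)) \<longlonglongrightarrow> 0"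
      by (rule AE_I2) (use H conv in \<open>simp add: space_restrict_space\<close>)
  qed
qed


section \<open>From sine coefficients to solutions\<close>

lemma abs_mu_le: "\<bar>mu lam n\<bar> \<le> (1 + \<bar>lam\<bar>) * om n ^ 4"
proof -
  have "1 \<le> (om n)\<^sup>2" using power_mono[OF om_ge_1[of n], of 2] by simp
  then have "(om n)\<^sup>2 \<le> om n ^ 4"
    using mult_left_mono[of 1 "(om n)\<^sup>2" "(om n)\<^sup>2"] by (simp flip: power_add)
  then have "\<bar>lam\<bar> * (om n)\<^sup>2 \<le> \<bar>lam\<bar> * om n ^ 4" by (rule mult_left_mono) simp
  moreover have "\<bar>mu lam n\<bar> \<le> om n ^ 4 + \<bar>lam\<bar> * (om n)\<^sup>2"
    unfolding mu_def using abs_triangle_ineq4[of "om n ^ 4" "lam * (om n)\<^sup>2"] by (simp add: abs_mult)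
  ultimately show ?thesis by (simp add: distrib_right)
qed

text \<open>The scalar equations are multiplied by the coefficients of \<open>th\<close> and summed.
  The exchange of sum and time integral is dominated convergence, with a majorant built from the
  integrable \<open>(H2_norm (v t))\<^sup>2\<close>.\<close>

lemma weak_identity:
  assumes F: "continuous_linear_L2 F" and v0: "v0 \<in> L2" and vC: "v \<in> C0_L2 T"
    and duh: "\<And>t n. t \<in> {0..T} \<Longrightarrow> coef (v t) n = duh (mu lam n) (coef v0 n) (\<lambda>s. loop_rhs F (v s) n) t"
    and le1: "\<And>t. t \<in> {0..T} \<Longrightarrow> L2_norm (v t) \<le> 1"
    and H: "\<And>t. t \<in> {0<..<T} \<Longrightarrow> v t \<in> H2 \<inter> H10"
    and int: "integrable (lebesgue_on {0<..<T}) (\<lambda>t. (H2_norm (v t))\<^sup>2)"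
    and \<tau>: "\<tau> \<in> {0..T}" and th: "th \<in> H2" "th \<in> H10"
  shows "ip (v \<tau>) th - ip v0 th + (LINT t|lebesgue_on {0<..<\<tau>}. ks_form lam (v t) th)
        + trace (weak_deriv th) 0 * (LINT t|lebesgue_on {0<..<\<tau>}. F (v t)) = 0"
proof -
  let ?M = "lebesgue_on {0<..<\<tau>}"
  have cc: "continuous_on {0..T} (\<lambda>t. coef (v t) n)" for n by (rule C0_L2_continuous_coef[OF vC])
  have cn: "continuous_on {0..T} (\<lambda>t. nl (v t) n)" for n by (rule C0_L2_continuous_nl[OF vC])
  have cF: "continuous_on {0..T} (\<lambda>t. F (v t))" by (rule C0_L2_continuous_linear[OF vC F])
  have sub: "continuous_on {0..\<tau>} g" if "continuous_on {0..T} g" for g :: "real \<Rightarrow> real"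
    by (rule continuous_on_subset[OF that]) (use \<tau> in auto)
  have thL: "th \<in> L2" using H2D(1)[OF th(1)] .
  have vL: "v t \<in> L2" if "t \<in> {0..T}" for t using C0_L2D(1)[OF vC that] .
  define I where "I = integral {0..\<tau>} (\<lambda>t. F (v t))"
  have I: "(LINT t|?M. F (v t)) = I" unfolding I_def by (rule lint_eq_integral(1)[OF sub[OF cF]])
  define j where "j n t = mu lam n * coef (v t) n + nl (v t) n" for n t
  have cj: "continuous_on {0..\<tau>} (j n)" for n
    unfolding j_def by (intro continuous_intros sub cc cn)
  have ij: "integrable ?M (j n)" for n by (rule lint_eq_integral(2)[OF cj])
  \<comment> \<open>The integrated scalar equation expresses each mode by end values and feedback;
    the sum over modes is then Parseval's identity together with the series for the trace.\<close>
  have Lj: "(LINT t|?M. j n t) = - (coef (v \<tau>) n - coef v0 n) - sqrt 2 * om n * I" for n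
  proof -
    have g: "continuous_on {0..T} (\<lambda>s. loop_rhs F (v s) n)"
      unfolding loop_rhs_def by (intro continuous_intros cn cF)
    have "integral {0..\<tau>} (\<lambda>s. mu lam n * duh (mu lam n) (coef v0 n) (\<lambda>s. loop_rhs F (v s) n) s + loop_rhs F (v s) n)
      = integral {0..\<tau>} (\<lambda>s. j n s + sqrt 2 * om n * F (v s))"
      by (rule integral_cong) (use duh[symmetric] \<tau> in \<open>simp add: j_def loop_rhs_def\<close>)
    also have "\<dots> = integral {0..\<tau>} (j n) + integral {0..\<tau>} (\<lambda>s. sqrt 2 * om n * F (v s))"
      by (intro Henstock_Kurzweil_Integration.integral_add integrable_continuous_real continuous_intros cj sub cF)
    also have "\<dots> = integral {0..\<tau>} (j n) + sqrt 2 * om n * I" by (simp add: I_def)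
    finally show ?thesis
      using duh_integral_eq[OF g \<tau>, of "mu lam n" "coef v0 n"] duh[OF \<tau>, of n] lint_eq_integral(1)[OF cj, of n]
      by simp
  qed
  define J where "J N t = (\<Sum>n<N. coef th n * j n t)" for N t
  have iJ: "integrable ?M (J N)" for N
    unfolding J_def[abs_def] by (intro Bochner_Integration.integrable_sum integrable_mult_right ij)
  have lim: "(\<lambda>N. J N t) \<longlonglongrightarrow> ks_form lam (v t) th" if t: "t \<in> {0<..<\<tau>}" for t
  proof -
    have "v t \<in> H2" "v t \<in> H10" using H[of t] t \<tau> by auto
    from ks_form_expansion[OF this th, of lam] show ?thesis by (simp add: sums_def J_def j_def)
  qed
  define A where "A = (\<Sum>n. om n ^ 4 * (coef th n)\<^sup>2)"
  define B where "B = (\<Sum>n. om n * \<bar>coef th n\<bar>)"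
  have sA: "summable (\<lambda>n. om n ^ 4 * (coef th n)\<^sup>2)" by (rule summable_om4_coef[OF th])
  have sB: "summable (\<lambda>n. om n * \<bar>coef th n\<bar>)" by (rule summable_om_abs[OF sA])
  \<comment> \<open>Majorant independent of \<open>N\<close>: mixed products of coefficients are
    split into squares, and the nonlinear term is at most \<open>om n\<close> per mode because
    \<open>L2_norm (v t) \<le> 1\<close>.\<close>
  define w where "w t = (1 + \<bar>lam\<bar>) * (A + (H2_norm (v t))\<^sup>2) + B" for t
  have iw: "integrable ?M w"
  proof -
    have i: "integrable ?M (\<lambda>t. (H2_norm (v t))\<^sup>2)"
      by (rule integrable_lebesgue_on_subset[OF int]) (use \<tau> in auto)
    have c: "integrable ?M (\<lambda>t. c)" for c :: real by (rule lint_eq_integral(2)) simp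
    show ?thesis unfolding w_def
      by (intro Bochner_Integration.integrable_add integrable_mult_right i c)
  qed
  have dom: "\<bar>J N t\<bar> \<le> w t" if t: "t \<in> {0<..<\<tau>}" for N t
  proof -
    have vt: "v t \<in> H2" "v t \<in> H10" "t \<in> {0..T}" using H[of t] t \<tau> by auto
    have "\<bar>J N t\<bar> \<le> (\<Sum>n<N. \<bar>coef th n * j n t\<bar>)" unfolding J_def by (rule sum_abs)
    also have "\<dots> \<le> (\<Sum>n<N. (1 + \<bar>lam\<bar>) * (om n ^ 4 * (coef th n)\<^sup>2 + om n ^ 4 * (coef (v t) n)\<^sup>2) + om n * \<bar>coef th n\<bar>)"
    proof (rule sum_mono)
      fix n
      let ?a = "\<bar>coef th n\<bar>" and ?c = "\<bar>coef (v t) n\<bar>"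
      have "?a * ?c \<le> ?a\<^sup>2 + ?c\<^sup>2"
        using sum_squares_bound[of ?a ?c] mult_nonneg_nonneg[of ?a ?c] by linarith
      then have ac: "?a * ?c \<le> (coef th n)\<^sup>2 + (coef (v t) n)\<^sup>2" by simp
      have "\<bar>mu lam n\<bar> * (?a * ?c) \<le> ((1 + \<bar>lam\<bar>) * om n ^ 4) * ((coef th n)\<^sup>2 + (coef (v t) n)\<^sup>2)"
        using abs_mu_le[of lam n] ac by (intro mult_mono) auto
      moreover have "\<bar>nl (v t) n\<bar> * ?a \<le> om n * ?a"
      proof (rule mult_right_mono)
        have "(L2_norm (v t))\<^sup>2 \<le> 1" using le1[OF vt(3)] by (simp add: power_le_one)
        then have "om n * (L2_norm (v t))\<^sup>2 \<le> om n * 1" by (intro mult_left_mono) auto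
        then show "\<bar>nl (v t) n\<bar> \<le> om n" using nl_bound[OF vL[OF vt(3)], of n] by linarith
      qed simp
      moreover have "\<bar>coef th n * j n t\<bar> \<le> \<bar>mu lam n\<bar> * (?a * ?c) + \<bar>nl (v t) n\<bar> * ?a"
      proof -
        have "\<bar>coef th n * j n t\<bar> = \<bar>mu lam n * (coef th n * coef (v t) n) + nl (v t) n * coef th n\<bar>"
          by (simp add: j_def algebra_simps)
        then show ?thesis
          using abs_triangle_ineq[of "mu lam n * (coef th n * coef (v t) n)" "nl (v t) n * coef th n"] by (simp add: abs_mult)
      qed
      ultimately show "\<bar>coef th n * j n t\<bar> \<le> (1 + \<bar>lam\<bar>) * (om n ^ 4 * (coef th n)\<^sup>2 + om n ^ 4 * (coef (v t) n)\<^sup>2) + om n * ?a"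
        by (simp add: distrib_left mult.assoc)
    qed
    also have "\<dots> = (1 + \<bar>lam\<bar>) * ((\<Sum>n<N. om n ^ 4 * (coef th n)\<^sup>2) + (\<Sum>n<N. om n ^ 4 * (coef (v t) n)\<^sup>2)) + (\<Sum>n<N. om n * \<bar>coef th n\<bar>)"
      by (simp only: sum.distrib sum_distrib_left[symmetric])
    also have "\<dots> \<le> w t"
      unfolding w_def A_def B_def
      by (intro add_mono mult_left_mono sum_le_suminf[OF sA] sum_le_suminf[OF sB] om4_partial_sum_le_H2_norm[OF vt(1,2)]) auto
    finally show ?thesis .
  qed
  have "(\<lambda>N. LINT t|?M. J N t) \<longlonglongrightarrow> (LINT t|?M. ks_form lam (v t) th)"
  proof (rule integral_dominated_convergence[OF _ _ iw])
    show "J N \<in> borel_measurable ?M" for N using iJ by (rule borel_measurable_integrable)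
    \<comment> \<open>\<open>ks_form\<close> contains weak derivatives chosen separately for each
      time, so its measurability is inherited from the limit of the \<open>J N\<close>.\<close>
    then show "(\<lambda>t. ks_form lam (v t) th) \<in> borel_measurable ?M"
      by (rule borel_measurable_LIMSEQ_real[rotated]) (use lim in \<open>simp add: space_restrict_space\<close>)
    show "AE t in ?M. (\<lambda>N. J N t) \<longlonglongrightarrow> ks_form lam (v t) th"
      by (rule AE_I2) (use lim in \<open>simp add: space_restrict_space\<close>)
    show "AE t in ?M. norm (J N t) \<le> w t" for N
      by (rule AE_I2) (use dom in \<open>simp add: space_restrict_space\<close>)
  qed
  moreover have "(LINT t|?M. J N t) = (\<Sum>n<N. coef v0 n * coef th n - coef (v \<tau>) n * coef th n - I * (coef th n * (sqrt 2 * om n)))" for N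
    unfolding J_def using ij by (subst Bochner_Integration.integral_sum) (auto simp: Lj algebra_simps)
  ultimately have "(\<lambda>n. coef v0 n * coef th n - coef (v \<tau>) n * coef th n - I * (coef th n * (sqrt 2 * om n)))
     sums (LINT t|?M. ks_form lam (v t) th)" by (simp add: sums_def)
  moreover have "(\<lambda>n. coef v0 n * coef th n - coef (v \<tau>) n * coef th n - I * (coef th n * (sqrt 2 * om n)))
     sums (ip v0 th - ip (v \<tau>) th - I * trace (weak_deriv th) 0)"
    by (intro sums_diff sums_mult Parseval_ip v0 vL[OF \<tau>] thL trace_weak_deriv th)
  ultimately have "(LINT t|?M. ks_form lam (v t) th) = ip v0 th - ip (v \<tau>) th - I * trace (weak_deriv th) 0"
    by (rule sums_unique2)
  then show ?thesis by (simp add: I)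
qed

section \<open>Smoothing by the free evolution\<close>

lemma mult_exp_minus_le:
  fixes x t :: real
  assumes "t > 0"
  shows "x * exp (- x * t) \<le> 1 / t"
proof -
  have "x * t \<le> exp (x * t)" using exp_ge_add_one_self[of "x * t"] by linarith
  then have "(x * t) * exp (- x * t) \<le> exp (x * t) * exp (- x * t)" by (rule mult_right_mono) simp
  then have "(x * exp (- x * t)) * t \<le> 1" by (simp add: mult_exp_exp mult_ac)
  then show ?thesis using assms by (simp add: pos_le_divide_eq)
qed

text \<open>Each term is minus the time derivative of
  \<open>exp (- (om n ^ 4) * t) * (c n)\<^sup>2\<close>, so its integral is at most
  \<open>(c n)\<^sup>2\<close>. Pointwise convergence comes from
  \<open>x * exp (- x * t) \<le> 1 / t\<close>, which degenerates at the initial time.\<close>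

lemma heat_energy:
  assumes T: "T > 0" and c: "summable (\<lambda>n. (c n)\<^sup>2)"
  defines "p \<equiv> \<lambda>n t. om n ^ 4 * exp (- (om n ^ 4) * t) * (c n)\<^sup>2"
  shows "\<And>t. t > 0 \<Longrightarrow> summable (\<lambda>n. p n t)"
    and "integrable (lebesgue_on {0<..<T}) (\<lambda>t. \<Sum>n. p n t)"
    and "(LINT t|lebesgue_on {0<..<T}. (\<Sum>n. p n t)) \<le> (\<Sum>n. (c n)\<^sup>2)"
proof -
  let ?M = "lebesgue_on {0<..<T}"
  have p0: "p n t \<ge> 0" for n t by (simp add: p_def)
  show sp: "summable (\<lambda>n. p n t)" if t: "t > 0" for t
  proof (rule summable_comparison_test'[OF summable_mult[OF c, of "1 / t"]])
    fix n
    show "norm (p n t) \<le> 1 / t * (c n)\<^sup>2"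
      using mult_right_mono[OF mult_exp_minus_le[OF t, of "om n ^ 4"], of "(c n)\<^sup>2"] p0[of n t]
      by (simp add: p_def)
  qed
  have cp: "continuous_on {0..T} (p n)" for n unfolding p_def by (intro continuous_intros)
  have ip: "integrable ?M (p n)" for n by (rule lint_eq_integral(2)[OF cp])
  have Lp: "(LINT t|?M. p n t) \<le> (c n)\<^sup>2" for n
  proof -
    have "((p n) has_integral (- (exp (- (om n ^ 4) * T) * (c n)\<^sup>2) - - (exp (- (om n ^ 4) * 0) * (c n)\<^sup>2))) {0..T}"
    proof (rule fundamental_theorem_of_calculus)
      fix t
      have "((\<lambda>t. - (exp (- (om n ^ 4) * t) * (c n)\<^sup>2)) has_field_derivative p n t) (at t within {0..T})"
        unfolding p_def by (auto intro!: derivative_eq_intros)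
      then show "((\<lambda>t. - (exp (- (om n ^ 4) * t) * (c n)\<^sup>2)) has_vector_derivative p n t) (at t within {0..T})"
        by (simp add: has_real_derivative_iff_has_vector_derivative)
    qed (use T in simp)
    then have "integral {0..T} (p n) = (c n)\<^sup>2 - exp (- (om n ^ 4) * T) * (c n)\<^sup>2"
      by (simp add: integral_unique)
    then show ?thesis using lint_eq_integral(1)[OF cp, of n] by simp
  qed
  have sL: "summable (\<lambda>n. LINT t|?M. norm (p n t))"
    by (rule summable_comparison_test'[OF c]) (use Lp p0 in \<open>simp add: integral_nonneg_AE\<close>)
  have ae: "AE t in ?M. summable (\<lambda>n. norm (p n t))"
    by (rule AE_I2) (use sp p0 in \<open>simp add: space_restrict_space\<close>)
  show "integrable ?M (\<lambda>t. \<Sum>n. p n t)" by (rule integrable_suminf[OF ip ae sL])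
  have "(\<lambda>n. LINT t|?M. p n t) sums (LINT t|?M. (\<Sum>n. p n t))" by (rule sums_integral[OF ip ae sL])
  then show "(LINT t|?M. (\<Sum>n. p n t)) \<le> (\<Sum>n. (c n)\<^sup>2)"
    by (rule sums_le[OF Lp _ summable_sums[OF c]])
qed

text \<open>\<open>A\<close> measures the forcing per unit of \<open>om n\<close>. It is kept apart
  from the bound by 1 so that it can later be taken proportional to the norm of \<open>v0\<close>,
  making the whole estimate quadratic in that norm.\<close>

lemma duh_imp_solution:
  assumes F: "continuous_linear_L2 F" and T: "T > 0" and v0: "v0 \<in> L2" and vC: "v \<in> C0_L2 T"
    and duh: "\<And>t n. t \<in> {0..T} \<Longrightarrow> coef (v t) n = duh (mu lam n) (coef v0 n) (\<lambda>s. loop_rhs F (v s) n) t"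
    and le1: "\<And>t. t \<in> {0..T} \<Longrightarrow> L2_norm (v t) \<le> 1"
    and A: "A \<ge> 0" "\<And>t n. t \<in> {0..T} \<Longrightarrow> \<bar>loop_rhs F (v t) n\<bar> \<le> om n * A"
  shows "closed_loop_KS_solution lam F T v0 v"
    and "(L2_H2_norm T v)\<^sup>2 \<le> exp (lam\<^sup>2 * T) * (6 * (L2_norm v0)\<^sup>2 + 24 * (\<Sum>n. 1 / (om n)\<^sup>2) * T * A\<^sup>2)"
proof -
  let ?M = "lebesgue_on {0<..<T}"
  define E where "E = exp (lam\<^sup>2 * T)"
  define c where "c = coef v0"
  define p where "p n t = om n ^ 4 * exp (- (om n ^ 4) * t) * (c n)\<^sup>2" for n t
  define P where "P t = (\<Sum>n. p n t)" for t
  define S where "S = (\<Sum>n. 1 / (om n)\<^sup>2)"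
  have c: "summable (\<lambda>n. (c n)\<^sup>2)" unfolding c_def by (rule Bessel(2)[OF v0])
  note heat = heat_energy[OF T c, folded p_def[abs_def]]
  have sp: "summable (\<lambda>n. p n t)" if "t > 0" for t using heat(1)[OF that] by (simp add: p_def)
  have iP: "integrable ?M P" using heat(2) by (simp add: P_def[abs_def] p_def)
  have LP: "(LINT t|?M. P t) \<le> (L2_norm v0)\<^sup>2"
    using heat(3) sums_unique[OF Parseval[OF v0]] by (simp add: P_def p_def c_def)
  have vL: "v t \<in> L2" if "t \<in> {0..T}" for t using C0_L2D(1)[OF vC that] .
  have g: "continuous_on {0..T} (\<lambda>s. loop_rhs F (v s) n)" for n
    unfolding loop_rhs_def by (intro continuous_intros C0_L2_continuous_nl[OF vC] C0_L2_continuous_linear[OF vC F])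
  \<comment> \<open>Free part \<open>?h\<close> plus forced part \<open>?z\<close>; the square of a
    sum costs a factor 2. The 8 is this 2 times the square of the 2 from \<open>om n ^ 4 / 2\<close>
    in \<open>mu_lower\<close>, and \<open>E\<close> is \<open>exp (?ga * T)\<close>
    squared.\<close>
  have key: "om n ^ 4 * (coef (v t) n)\<^sup>2 \<le> 2 * E * p n t + 8 * E * A\<^sup>2 * (1 / (om n)\<^sup>2)" if t: "t \<in> {0..T}" for n t
  proof -
    let ?h = "exp (- mu lam n * t) * c n" and ?ga = "lam\<^sup>2 / 2"
    let ?z = "coef (v t) n - ?h"
    have low: "om n ^ 4 / 2 \<le> mu lam n + ?ga" using mu_lower[of n lam] by simp
    have o4: "0 < om n ^ 4" by simp
    have pos: "mu lam n + ?ga > 0" using low o4 by linarith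
    have lamt: "lam\<^sup>2 * t \<le> lam\<^sup>2 * T" using t by (intro mult_left_mono) auto
    have "\<bar>?z\<bar> \<le> om n * A * exp (?ga * t) / (mu lam n + ?ga)"
      unfolding duh[OF t] c_def
    proof (rule duh_bound[OF g t _ _ pos])
      show "0 \<le> om n * A" using A by simp
      fix s assume s: "s \<in> {0..T}"
      have "om n * A * 1 \<le> om n * A * exp (?ga * s)" using A s by (intro mult_left_mono) auto
      then show "\<bar>loop_rhs F (v s) n\<bar> \<le> om n * A * exp (?ga * s)" using A(2)[OF s, of n] by linarith
    qed
    also have "\<dots> \<le> om n * A * exp (?ga * T) / (om n ^ 4 / 2)"
      using A t low o4 lamt by (intro frac_le mult_left_mono) auto
    also have "\<dots> = 2 * A * exp (?ga * T) / om n ^ 3" by (simp add: power_eq_if)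
    finally have "\<bar>?z\<bar>\<^sup>2 \<le> (2 * A * exp (?ga * T) / om n ^ 3)\<^sup>2" by (rule power_mono) simp
    also have "\<dots> = 4 * A\<^sup>2 * E / (om n ^ 3)\<^sup>2"
      by (simp add: power_mult_distrib power_divide E_def flip: exp_double)
    finally have z: "?z\<^sup>2 \<le> 4 * A\<^sup>2 * E / (om n ^ 3)\<^sup>2" by simp
    have "om n ^ 4 * ?z\<^sup>2 \<le> om n ^ 4 * (4 * A\<^sup>2 * E / (om n ^ 3)\<^sup>2)" using z by (rule mult_left_mono) simp
    also have "\<dots> = 4 * E * A\<^sup>2 * (1 / (om n)\<^sup>2)" by (simp add: power_eq_if)
    finally have z': "om n ^ 4 * ?z\<^sup>2 \<le> 4 * E * A\<^sup>2 * (1 / (om n)\<^sup>2)" .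
    have "?h\<^sup>2 = exp (2 * (- mu lam n * t)) * (c n)\<^sup>2" by (simp only: power_mult_distrib exp_double)
    also have "\<dots> \<le> (E * exp (- (om n ^ 4) * t)) * (c n)\<^sup>2"
    proof (rule mult_right_mono)
      have "(om n ^ 4 - lam\<^sup>2) * t \<le> 2 * mu lam n * t"
        using mu_lower[of n lam] t by (intro mult_right_mono) auto
      then have "2 * (- mu lam n * t) \<le> lam\<^sup>2 * T + - (om n ^ 4) * t"
        using lamt by (simp add: left_diff_distrib)
      then show "exp (2 * (- mu lam n * t)) \<le> E * exp (- (om n ^ 4) * t)"
        unfolding E_def mult_exp_exp by (simp only: exp_le_cancel_iff)
    qed simp
    finally have "om n ^ 4 * ?h\<^sup>2 \<le> om n ^ 4 * ((E * exp (- (om n ^ 4) * t)) * (c n)\<^sup>2)" by (rule mult_left_mono) simp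
    then have h': "om n ^ 4 * ?h\<^sup>2 \<le> E * p n t" by (simp add: p_def mult_ac)
    have "(coef (v t) n)\<^sup>2 \<le> 2 * ?h\<^sup>2 + 2 * ?z\<^sup>2"
      using sum_squares_bound[of ?h ?z] power2_sum[of ?h ?z] by simp
    then have "om n ^ 4 * (coef (v t) n)\<^sup>2 \<le> om n ^ 4 * (2 * ?h\<^sup>2 + 2 * ?z\<^sup>2)" by (rule mult_left_mono) simp
    also have "\<dots> = 2 * (om n ^ 4 * ?h\<^sup>2) + 2 * (om n ^ 4 * ?z\<^sup>2)" by (simp add: distrib_left)
    finally show ?thesis using h' z' by linarith
  qed
  have maj: "(\<lambda>n. 2 * E * p n t + 8 * E * A\<^sup>2 * (1 / (om n)\<^sup>2)) sums (2 * E * P t + 8 * E * A\<^sup>2 * S)" if "t > 0" for t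
    unfolding P_def S_def by (intro sums_add sums_mult summable_sums sp[OF that] summable_inverse_om)
  have so: "summable (\<lambda>n. om n ^ 4 * (coef (v t) n)\<^sup>2)" if t: "t \<in> {0<..<T}" for t
    by (rule summable_comparison_test'[OF sums_summable[OF maj[of t]]]) (use t key[of t] in auto)
  have H: "v t \<in> H2" "v t \<in> H10" if t: "t \<in> {0<..<T}" for t
    using H2_H10I[OF vL so[OF t]] t by auto
  have H2le: "(H2_norm (v t))\<^sup>2 \<le> 6 * E * P t + 24 * E * A\<^sup>2 * S" if t: "t \<in> {0<..<T}" for t
  proof -
    have "(H2_norm (v t))\<^sup>2 \<le> 3 * (\<Sum>n. om n ^ 4 * (coef (v t) n)\<^sup>2)" by (rule H2_norm_sq_le[OF H[OF t]])
    also have "(\<Sum>n. om n ^ 4 * (coef (v t) n)\<^sup>2) \<le> 2 * E * P t + 8 * E * A\<^sup>2 * S"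
      by (rule sums_le[OF key summable_sums[OF so[OF t]] maj]) (use t in auto)
    finally show ?thesis by simp
  qed
  have mc: "(\<lambda>t. coef (v t) n) \<in> borel_measurable ?M" for n
    by (rule borel_measurable_integrable[OF lint_eq_integral(2)[OF C0_L2_continuous_coef[OF vC]]])
  \<comment> \<open>\<open>H2_norm\<close> involves weak derivatives picked by choice at each time;
    measurability is read off the coefficient series instead.\<close>
  have mH: "(\<lambda>t. (H2_norm (v t))\<^sup>2) \<in> borel_measurable ?M"
  proof -
    have "(\<lambda>t. \<Sum>n. (1 + (om n)\<^sup>2 + om n ^ 4) * (coef (v t) n)\<^sup>2) \<in> borel_measurable ?M"
      using mc by measurable
    moreover have "(\<Sum>n. (1 + (om n)\<^sup>2 + om n ^ 4) * (coef (v t) n)\<^sup>2) = (H2_norm (v t))\<^sup>2" if "t \<in> space ?M" for t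
      using sums_unique[OF H2_norm_sums[OF H, of t]] that by (simp add: space_restrict_space)
    ultimately show ?thesis by (subst (asm) measurable_cong) auto
  qed
  have ic: "integrable ?M (\<lambda>t. r)" for r :: real by (rule lint_eq_integral(2)) simp
  have imaj: "integrable ?M (\<lambda>t. 6 * E * P t + 24 * E * A\<^sup>2 * S)"
    by (intro Bochner_Integration.integrable_add integrable_mult_right iP ic)
  have iH: "integrable ?M (\<lambda>t. (H2_norm (v t))\<^sup>2)"
    by (rule Bochner_Integration.integrable_bound[OF imaj mH])
      (use H2le in \<open>fastforce simp: space_restrict_space intro!: AE_I2\<close>)
  have "(L2_H2_norm T v)\<^sup>2 = (LINT t|?M. (H2_norm (v t))\<^sup>2)"
    by (simp add: L2_H2_norm_def integral_nonneg_AE)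
  also have "\<dots> \<le> (LINT t|?M. 6 * E * P t + 24 * E * A\<^sup>2 * S)"
    by (rule integral_mono[OF iH imaj]) (use H2le in \<open>simp add: space_restrict_space\<close>)
  also have "\<dots> = 6 * E * (LINT t|?M. P t) + (LINT t|?M. 24 * E * A\<^sup>2 * S)"
    using iP ic by (subst Bochner_Integration.integral_add) auto
  also have "(LINT t|?M. 24 * E * A\<^sup>2 * S) = 24 * E * A\<^sup>2 * S * T"
    using T lint_eq_integral(1)[of 0 T "\<lambda>_. 24 * E * A\<^sup>2 * S"] by simp
  also have "6 * E * (LINT t|?M. P t) \<le> 6 * E * (L2_norm v0)\<^sup>2"
    using LP by (intro mult_left_mono) (auto simp: E_def)
  finally show "(L2_H2_norm T v)\<^sup>2 \<le> exp (lam\<^sup>2 * T) * (6 * (L2_norm v0)\<^sup>2 + 24 * (\<Sum>n. 1 / (om n)\<^sup>2) * T * A\<^sup>2)"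
    by (simp add: E_def S_def algebra_simps)
  have "strongly_measurable_H2 T v"
  proof (rule strongly_measurable_H2I[OF mc])
    show "\<bar>coef (v t) n\<bar> \<le> 1" if "t \<in> {0<..<T}" for t n
      using coef_abs_le[OF vL, of t n] le1[of t] that by auto
  qed (use H in auto)
  then have X: "v \<in> X_space T" using vC iH by (simp add: X_space_def L2_H2_def)
  have cF: "continuous_on {0..T} (\<lambda>t. F (v t))" by (rule C0_L2_continuous_linear[OF vC F])
  have "(\<lambda>t. F (v t)) \<in> L2_on {0<..<T}"
    unfolding L2_on_def
    using borel_measurable_integrable[OF lint_eq_integral(2)[OF cF]]
      lint_eq_integral(2)[OF continuous_on_power[OF cF, of 2]] by simp
  moreover have "ip (v \<tau>) \<theta> - ip v0 \<theta> + (LINT t|lebesgue_on {0<..<\<tau>}. ks_form lam (v t) \<theta>)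
        + trace (weak_deriv \<theta>) 0 * (LINT t|lebesgue_on {0<..<\<tau>}. F (v t)) = 0"
    if "\<tau> \<in> {0..T}" "\<theta> \<in> H2 \<inter> H10" for \<tau> \<theta>
    by (rule weak_identity[OF F v0 vC duh le1 _ iH that(1)]) (use H that in auto)
  ultimately show "closed_loop_KS_solution lam F T v0 v"
    using v0 X by (simp add: closed_loop_KS_solution_def KS_solution_iff)
qed

theorem theorem1p1:
  fixes lam T0 :: real and F :: "(real \<Rightarrow> real) \<Rightarrow> real"
  assumes "lam > 0" and "T0 > 0" and "continuous_linear_L2 F"
  shows "(\<forall>v0\<in>L2_on I01. \<forall>v w.
            closed_loop_KS_solution lam F T0 v0 v \<longrightarrow> closed_loop_KS_solution lam F T0 v0 w \<longrightarrow>
            (\<forall>t\<in>{0..T0}. AE x in lebesgue_on I01. v t x = w t x)) \<and>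
         (\<exists>r0>0. \<exists>C0>0. \<forall>v0\<in>L2_on I01. L2_norm v0 \<le> r0 \<longrightarrow>
            (\<exists>v. closed_loop_KS_solution lam F T0 v0 v \<and> X_norm T0 v \<le> C0 * L2_norm v0))"
proof -
  note F = assms(3)
  obtain CF where CF: "CF \<ge> 0" "\<And>u. u \<in> L2 \<Longrightarrow> \<bar>F u\<bar> \<le> CF * L2_norm u"
    "\<And>u w. u \<in> L2 \<Longrightarrow> w \<in> L2 \<Longrightarrow> F (\<lambda>x. u x - w x) = F u - F w"
    using continuous_linear_L2D[OF F] by blast
  define K where "K = 1 + 2 * CF"
  have K: "K > 0" using CF(1) by (simp add: K_def)
  interpret sine_system "loop_rhs F" K lam T0
  proof
    show "0 < K" "0 \<le> T0" using K assms(2) by auto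
    show "loop_rhs F (\<lambda>x. 0) n = 0" for n
      using CF(2)[OF L2_zero] by (simp add: loop_rhs_def nl_def ip_def)
    show "\<bar>loop_rhs F u n - loop_rhs F w n\<bar> \<le> om n * K * ((1 + L2_norm u + L2_norm w) * L2_dist u w)"
      if "u \<in> L2" "w \<in> L2" for u w n
      unfolding K_def by (rule loop_rhs_lipschitz[OF CF that])
  qed
  have unique: "AE x in M01. v t x = w t x"
    if v: "closed_loop_KS_solution lam F T0 v0 v" and w: "closed_loop_KS_solution lam F T0 v0 w"
      and t: "t \<in> {0..T0}" for v0 v w t
  proof -
    have C: "v \<in> C0_L2 T0" "w \<in> C0_L2 T0"
      using v w by (auto simp: closed_loop_KS_solution_def KS_solution_iff X_space_def)
    have "mild v0 v" "mild v0 w"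
      using C solution_imp_duh[OF F v] solution_imp_duh[OF F w] by (simp_all add: mild_def)
    then have "L2_dist (v t) (w t) = 0" using mild_unique t by blast
    then show ?thesis
      using L2_norm_eq_0_iff[OF L2_diff[OF C0_L2D(1)[OF C(1) t] C0_L2D(1)[OF C(2) t]]] by simp
  qed
  obtain r0 C where r0: "r0 > 0" and C: "C \<ge> 0" and
    ex: "\<And>v0. v0 \<in> L2 \<Longrightarrow> L2_norm v0 \<le> r0 \<Longrightarrow>
      \<exists>v. mild v0 v \<and> (\<forall>t\<in>{0..T0}. L2_norm (v t) \<le> 1 \<and> L2_norm (v t) \<le> C * L2_norm v0)"
    using mild_exists by blast
  \<comment> \<open>The constant of \<open>duh_imp_solution\<close> for
    \<open>A = 2 * K * C * L2_norm v0\<close>, with the squared norm of \<open>v0\<close> factored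
    out.\<close>
  define Q where "Q = exp (lam\<^sup>2 * T0) * (6 + 24 * (\<Sum>n. 1 / (om n)\<^sup>2) * T0 * (2 * K * C)\<^sup>2)"
  have S: "(\<Sum>n. 1 / (om n)\<^sup>2) \<ge> 0" by (rule suminf_nonneg[OF summable_inverse_om]) simp
  have Q: "Q > 0" using S assms(2) by (simp add: Q_def add_pos_nonneg)
  have exist: "\<exists>v. closed_loop_KS_solution lam F T0 v0 v \<and> X_norm T0 v \<le> sqrt (C\<^sup>2 + Q) * L2_norm v0"
    if v0: "v0 \<in> L2" and small: "L2_norm v0 \<le> r0" for v0
  proof -
    obtain v where v: "mild v0 v" "\<And>t. t \<in> {0..T0} \<Longrightarrow> L2_norm (v t) \<le> 1"
        "\<And>t. t \<in> {0..T0} \<Longrightarrow> L2_norm (v t) \<le> C * L2_norm v0"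
      using ex[OF v0 small] by blast
    \<comment> \<open>The 2 bounds \<open>1 + L2_norm (v t)\<close> and the remaining factor
      \<open>L2_norm (v t)\<close> is at most \<open>C * L2_norm v0\<close>.\<close>
    define A where "A = 2 * K * C * L2_norm v0"
    have A: "A \<ge> 0" using K C by (simp add: A_def)
    have vC: "v \<in> C0_L2 T0" and dv: "\<And>t n. t \<in> {0..T0} \<Longrightarrow> coef (v t) n = duh (mu lam n) (coef v0 n) (\<lambda>s. loop_rhs F (v s) n) t"
      using v(1) by (auto simp: mild_def)
    have bA: "\<bar>loop_rhs F (v t) n\<bar> \<le> om n * A" if t: "t \<in> {0..T0}" for t n
    proof -
      have "\<bar>loop_rhs F (v t) n\<bar> \<le> om n * K * ((1 + L2_norm (v t)) * L2_norm (v t))"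
        by (rule b_bound[OF C0_L2D(1)[OF vC t]])
      also have "\<dots> \<le> om n * K * (2 * (C * L2_norm v0))"
        using v(2)[OF t] v(3)[OF t] K C by (intro mult_left_mono mult_mono) auto
      finally show ?thesis by (simp add: A_def mult_ac)
    qed
    note sol = duh_imp_solution[OF F assms(2) v0 vC dv v(2) A bA]
    have "0 \<le> C0_L2_norm T0 v" "C0_L2_norm T0 v \<le> C * L2_norm v0"
    proof -
      show "C0_L2_norm T0 v \<le> C * L2_norm v0"
        unfolding C0_L2_norm_def using assms(2) v(3) by (intro cSUP_least) auto
      \<comment> \<open>The supremum is an upper bound only for a bounded family; its nonnegativity
        permits squaring the estimate.\<close>
      have "bdd_above ((\<lambda>t. L2_norm (v t)) ` {0..T0})" using v(2) by (intro bdd_aboveI2[of _ _ 1])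
      then have "L2_norm (v 0) \<le> C0_L2_norm T0 v"
        unfolding C0_L2_norm_def using assms(2) by (intro cSUP_upper) auto
      then show "0 \<le> C0_L2_norm T0 v" using L2_norm_nonneg[of "v 0"] by linarith
    qed
    then have "(C0_L2_norm T0 v)\<^sup>2 \<le> (C * L2_norm v0)\<^sup>2" by (intro power_mono)
    moreover have "(L2_H2_norm T0 v)\<^sup>2 \<le> Q * (L2_norm v0)\<^sup>2"
      using sol(2) by (simp add: Q_def A_def power_mult_distrib algebra_simps)
    ultimately have "(C0_L2_norm T0 v)\<^sup>2 + (L2_H2_norm T0 v)\<^sup>2 \<le> (C\<^sup>2 + Q) * (L2_norm v0)\<^sup>2"
      by (simp add: power_mult_distrib distrib_right)
    then have "X_norm T0 v \<le> sqrt ((C\<^sup>2 + Q) * (L2_norm v0)\<^sup>2)"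
      unfolding X_norm_def by (rule real_sqrt_le_mono)
    also have "\<dots> = sqrt (C\<^sup>2 + Q) * L2_norm v0" by (simp add: real_sqrt_mult)
    finally show ?thesis using sol(1) by blast
  qed
  have "sqrt (C\<^sup>2 + Q) > 0" using Q by (simp add: add_nonneg_pos)
  then show ?thesis using unique exist r0 by blast
qed

end
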